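(* Let $X$ be a set, $A$ a finitely generated commutative unital $\mathbb{R}$-algebra, $\bar{}\colon A\to\mathbb{R}^X$ a unital $\mathbb{R}$-algebra homomorphism, and $Q\subseteq A$ a quadratic module which is finitely generated as a quadratic module and closed under multiplication. Let $Y$, $m$, $K_{Q,X}$, $K_{Q,Y}$ be as in the context. Then: (1) The following condition Q1 holds if and only if $m(K_{Q,X})=K_{Q,Y}$. Q1: for every $f\in A$ with $\bar f>0$ on $K_{Q,X}$ there exist $p\in\sum A^2$ and $q\in Q$ with $pf=1+q$. (2) The following condition Q2 holds if and only if $\overline{m(K_{Q,X})}=K_{Q,Y}$ (closure in $Y$). Q2: for every $f\in A$ with $\bar f\ge0$ on $K_{Q,X}$ there exist $p\in\sum A^2$, $q\in Q$ and an integer $k\ge0$ with $pf=f^{2k}+q$.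
   Context: A quadratic module of $A$ is a subset $Q\subseteq A$ with $Q+Q\subseteq Q$, $a^2Q\subseteq Q$ for all $a\in A$, and $1\in Q$; it is finitely generated if $Q=\sum A^2+\sum A^2g_1+\dots+\sum A^2g_s$ for some $g_1,\dots,g_s\in A$, where $\sum A^2$ denotes the finite sums of squares in $A$. $K_{Q,X}:=\{x\in X\mid \bar g(x)\ge 0\ \forall g\in Q\}$. $Y$ denotes the set of all unital $\mathbb{R}$-algebra homomorphisms $y\colon A\to\mathbb{R}$; for $a\in A$, $\hat a(y)=y(a)$, and $Y$ carries the weakest topology making all $\hat a$ continuous. $K_{Q,Y}:=\{y\in Y\mid \hat g(y)\ge0\ \forall g\in Q\}$. The map $m\colon X\to Y$ is $m(x)(a)=\bar a(x)$. *)

theory Defs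
  imports "HOL-Analysis.Analysis"
begin

inductive_set subalg_gen :: "'a::{comm_ring_1,real_algebra_1} set \<Rightarrow> 'a set"
  for G :: "'a set" where
  gen: "a \<in> G \<Longrightarrow> a \<in> subalg_gen G"
| one: "1 \<in> subalg_gen G"
| add: "a \<in> subalg_gen G \<Longrightarrow> b \<in> subalg_gen G \<Longrightarrow> a + b \<in> subalg_gen G"
| mult: "a \<in> subalg_gen G \<Longrightarrow> b \<in> subalg_gen G \<Longrightarrow> a * b \<in> subalg_gen G"
| scale: "a \<in> subalg_gen G \<Longrightarrow> r *\<^sub>R a \<in> subalg_gen G"

definition fin_gen_algebra :: "'a::{comm_ring_1,real_algebra_1} itself \<Rightarrow> bool" where
  "fin_gen_algebra _ \<longleftrightarrow> (\<exists>G::'a set. finite G \<and> subalg_gen G = UNIV)"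

definition real_alg_hom :: "('a::{comm_ring_1,real_algebra_1} \<Rightarrow> real) \<Rightarrow> bool" where
  "real_alg_hom y \<longleftrightarrow> y 1 = 1 \<and> (\<forall>a b. y (a + b) = y a + y b) \<and>
     (\<forall>a b. y (a * b) = y a * y b) \<and> (\<forall>r a. y (r *\<^sub>R a) = r * y a)"

text \<open>Unital R-algebra homomorphisms A \<rightarrow> R^X (functions on the set X, compared pointwise on X).\<close>
definition alg_hom_to_funs :: "'x set \<Rightarrow> ('a::{comm_ring_1,real_algebra_1} \<Rightarrow> 'x \<Rightarrow> real) \<Rightarrow> bool" where
  "alg_hom_to_funs X bar \<longleftrightarrow> (\<forall>x\<in>X. real_alg_hom (\<lambda>a. bar a x))"

definition homs_Y :: "'a::{comm_ring_1,real_algebra_1} itself \<Rightarrow> ('a \<Rightarrow> real) set" where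
  "homs_Y _ = {y. real_alg_hom y}"

text \<open>Weakest topology on Y making all evaluations continuous: subspace of the product topology.\<close>
definition Y_topology :: "'a::{comm_ring_1,real_algebra_1} itself \<Rightarrow> ('a \<Rightarrow> real) topology" where
  "Y_topology T = subtopology (product_topology (\<lambda>_. euclideanreal) UNIV) (homs_Y T)"

definition sos :: "'a::comm_ring_1 set" where
  "sos = {s. \<exists>fs::'a list. s = sum_list (map (\<lambda>a. a ^ 2) fs)}"

definition quadratic_module :: "'a::comm_ring_1 set \<Rightarrow> bool" where
  "quadratic_module Q \<longleftrightarrow> (\<forall>a\<in>Q. \<forall>b\<in>Q. a + b \<in> Q) \<and> (\<forall>a. \<forall>q\<in>Q. a^2 * q \<in> Q) \<and> 1 \<in> Q"

definition fin_gen_qm :: "'a::comm_ring_1 set \<Rightarrow> bool" where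
  "fin_gen_qm Q \<longleftrightarrow> (\<exists>gs::'a list. Q =
     {sum_list (map2 (*) ss (1 # gs)) | ss. length ss = Suc (length gs) \<and> set ss \<subseteq> sos})"

definition K_X :: "'x set \<Rightarrow> ('a \<Rightarrow> 'x \<Rightarrow> real) \<Rightarrow> 'a set \<Rightarrow> 'x set" where
  "K_X X bar Q = {x\<in>X. \<forall>g\<in>Q. bar g x \<ge> 0}"

definition K_Y :: "'a::{comm_ring_1,real_algebra_1} set \<Rightarrow> ('a \<Rightarrow> real) set" where
  "K_Y Q = {y\<in>homs_Y TYPE('a). \<forall>g\<in>Q. y g \<ge> 0}"

definition m_map :: "('a \<Rightarrow> 'x \<Rightarrow> real) \<Rightarrow> 'x \<Rightarrow> ('a \<Rightarrow> real)" where
  "m_map bar x = (\<lambda>a. bar a x)"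

end

theory Submission
imports
  Defs
  "HOL-Algebra.Algebraic_Closure_Type"
  "HOL-Computational_Algebra.Fraction_Field"
  "HOL-Library.Function_Algebras"
begin

text \<open>
  Both equivalences rest on the Positivstellensatz for the preordering \<open>Q\<close>: if there is no identity
  \<open>p f = s + q\<close> with \<open>p, q \<in> Q\<close> and \<open>s\<close> in a multiplicative set of squares (\<open>{1}\<close>, respectively the even
  powers of \<open>f\<close>), then Zorn's lemma extends \<open>Q - f Q\<close> to a prime cone, i.e. to an ordering of a residue
  domain of the algebra. That domain embeds into a real closed field, constructed as a maximal ordered
  subfield of an algebraic closure. The resulting point over the real closed field is moved to a point
  over the reals by eliminating one variable at a time in the manner of Cohen and Hoermander, and the
  Hilbert basis theorem reduces the relations of the algebra to finitely many equations. In the other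
  direction a point outside (the closure of) \<open>m(K)\<close> is detected by the sum of squares of
  \<open>a - y(a)\<close> over the generators \<open>a\<close> of the algebra.
\<close>

(* HOL-Algebra reserves the token X, which the theorem uses as a variable. *)
no_notation var (\<open>X\<index>\<close>)
no_notation univ_poly (\<open>(\<open>open_block notation=\<open>postfix X\<close>\<close>_ [X]\<index>)\<close> 80)
hide_const (open) Polynomials.degree Polynomials.lead_coeff up_ring.coeff up_ring.monom Coset.order module.smult

section \<open>Real closed fields\<close>

text \<open>No syntax of first-order formulas is used. Signs are compared in two real closed fields
  at once: a polynomial is carried as a pair of its value at the abstract point and the
  corresponding function on real space, and eliminating a variable replaces finitely many pairs of
  univariate polynomials by finitely many pairs of coefficients. Only finitely many signs can be
  moved in this way. This is where the finite generation of \<open>Q\<close> enters (nonnegativity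
  on generators gives membership in \<open>K_Y Q\<close>), and it is why the relations of the
  algebra need a finite basis. The intermediate value property serves as the definition of a real
  closed field because it is what Rolle's theorem and the sign tables consume, and because it can be
  proved directly for the maximal ordered subfield. The Positivstellensatz produces a multiplier in
  \<open>Q\<close>, whereas both conditions ask for one in \<open>sos\<close>; a separate identity
  repairs this at the price of squaring the term \<open>1\<close> or
  \<open>f ^ (2 * k)\<close>.\<close>

(* Polynomials appear as coefficient sequences because a class specification cannot use the type 'a poly. *)
class real_closed_field = linordered_field +
  assumes sum_IVT: "a < b \<Longrightarrow> (\<Sum>i\<le>n. f i * a ^ i) < 0 \<Longrightarrow> (\<Sum>i\<le>n. f i * b ^ i) > 0 \<Longrightarrow>
    \<exists>c. a < c \<and> c < b \<and> (\<Sum>i\<le>n. f i * c ^ i) = 0"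

lemma rc_poly_IVT_pos:
  fixes p :: "'a::real_closed_field poly"
  assumes "a < b" "poly p a < 0" "poly p b > 0"
  shows "\<exists>c. a < c \<and> c < b \<and> poly p c = 0"
  using sum_IVT[of a b "coeff p" "degree p"] assms by (simp add: poly_altdef)

lemma rc_poly_IVT:
  fixes p :: "'a::real_closed_field poly"
  assumes "a < b" "poly p a * poly p b < 0"
  shows "\<exists>c. a < c \<and> c < b \<and> poly p c = 0"
  using rc_poly_IVT_pos[of a b p] rc_poly_IVT_pos[of a b "-p"] assms
  by (auto simp: mult_less_0_iff)

instance real :: real_closed_field
proof
  fix a b :: real and f :: "nat \<Rightarrow> real" and n
  assume *: "a < b" "(\<Sum>i\<le>n. f i * a ^ i) < 0" "(\<Sum>i\<le>n. f i * b ^ i) > 0"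
  let ?g = "\<lambda>x. \<Sum>i\<le>n. f i * x ^ i"
  have "\<exists>c\<ge>a. c \<le> b \<and> ?g c = 0"
    using * by (intro IVT') (auto intro!: continuous_intros)
  then obtain c where "a \<le> c" "c \<le> b" "?g c = 0" by blast
  with * have "a < c" "c < b" by (auto simp: less_le)
  then show "\<exists>c. a < c \<and> c < b \<and> ?g c = 0" using \<open>?g c = 0\<close> by blast
qed

text \<open>
  Write \<open>p = (X - a)\<^sup>m (X - b)\<^sup>n g\<close>; after cancelling \<open>(X - a)\<^sup>m\<^sup>-\<^sup>1 (X - b)\<^sup>n\<^sup>-\<^sup>1\<close> the
  derivative takes values of opposite sign at \<open>a\<close> and \<open>b\<close>.
\<close>
lemma rc_Rolle_consecutive:
  fixes p :: "'a::real_closed_field poly"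
  assumes ab: "a < b" and p0: "poly p a = 0" "poly p b = 0" "p \<noteq> 0"
    and nz: "\<And>x. a < x \<Longrightarrow> x < b \<Longrightarrow> poly p x \<noteq> 0"
  shows "\<exists>c. a < c \<and> c < b \<and> poly (pderiv p) c = 0"
proof -
  obtain r where r: "p = [:-a, 1:] ^ order a p * r" "\<not> [:-a, 1:] dvd r"
    using order_decomp[OF p0(3)] by blast
  define m where "m = order a p"
  have "m \<noteq> 0" using p0 order_root m_def by metis
  then obtain m' where m': "m = Suc m'" by (cases m) auto
  have ra: "poly r a \<noteq> 0" using r(2) by (simp add: poly_eq_0_iff_dvd)
  have pr: "p = [:-a, 1:] ^ m * r" using r(1) m_def by simp
  have rb: "poly r b = 0" using p0(2) ab unfolding pr by (auto simp: poly_power)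
  have "r \<noteq> 0" using ra by auto
  obtain g where g: "r = [:-b, 1:] ^ order b r * g" "\<not> [:-b, 1:] dvd g"
    using order_decomp[OF \<open>r \<noteq> 0\<close>] by blast
  define n where "n = order b r"
  have "n \<noteq> 0" using rb \<open>r \<noteq> 0\<close> order_root n_def by metis
  then obtain n' where n': "n = Suc n'" by (cases n) auto
  have gb: "poly g b \<noteq> 0" using g(2) by (simp add: poly_eq_0_iff_dvd)
  have rg: "r = [:-b, 1:] ^ n * g" using g(1) n_def by simp
  have ga: "poly g a \<noteq> 0" using ra unfolding rg by auto
  have pg: "p = [:-a, 1:] ^ m * ([:-b, 1:] ^ n * g)" using pr rg by simp
  have gx: "poly g x \<noteq> 0" if "a < x" "x < b" for x
    using nz[OF that] unfolding pg by auto
  have gab: "poly g a * poly g b > 0"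
  proof (rule ccontr)
    assume "\<not> ?thesis"
    then have "poly g a * poly g b < 0" using ga gb by (metis linorder_neqE_linordered_idom mult_eq_0_iff)
    from rc_poly_IVT[OF ab this] gx show False by blast
  qed
  define h where "h = smult (of_nat m) ([:-b, 1:] * g) + smult (of_nat n) ([:-a, 1:] * g) + [:-a, 1:] * [:-b, 1:] * pderiv g"
  have d: "pderiv p = [:-a, 1:] ^ m' * [:-b, 1:] ^ n' * h"
  proof -
    have "pderiv (u ^ Suc m' * (v ^ Suc n' * g)) = u ^ m' * v ^ n' *
      (smult (of_nat (Suc m')) (v * g) + smult (of_nat (Suc n')) (u * g) + u * v * pderiv g)"
      if "pderiv u = 1" "pderiv v = 1" for u v :: "'a poly"
      using that by (simp only: pderiv_mult pderiv_power_Suc) (simp add: algebra_simps smult_add_right)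
    then show ?thesis
      unfolding pg m' n' h_def by (simp add: pderiv_pCons del: power_Suc)
  qed
  have ha: "poly h a = of_nat m * (a - b) * poly g a" unfolding h_def by (simp add: algebra_simps)
  have hb: "poly h b = of_nat n * (b - a) * poly g b" unfolding h_def by (simp add: algebra_simps)
  have e: "poly h a * poly h b = - (of_nat m * of_nat n * (b - a)^2 * (poly g a * poly g b))"
    unfolding ha hb by (simp add: power2_eq_square algebra_simps)
  have "of_nat m * of_nat n * (b - a)^2 > (0::'a)"
    using ab \<open>m \<noteq> 0\<close> \<open>n \<noteq> 0\<close> by simp
  then have "of_nat m * of_nat n * (b - a)^2 * (poly g a * poly g b) > 0"
    using gab by (rule mult_pos_pos)
  then have "poly h a * poly h b < 0" unfolding e by simp
  from rc_poly_IVT[OF ab this] obtain c where "a < c" "c < b" "poly h c = 0" by blast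
  then show ?thesis unfolding d by auto
qed

text \<open>The zeros of \<open>q\<close> in the interval are finitely many, so there is a first one
  \<open>z\<close> after \<open>a\<close>; no zero lies between \<open>a\<close> and
  \<open>z\<close>, and the consecutive case applies. If \<open>q\<close> is the zero polynomial,
  any interior point serves.\<close>

lemma rc_Rolle:
  fixes p :: "'a::real_closed_field poly"
  assumes ab: "a < b" and "poly p a = poly p b"
  shows "\<exists>c. a < c \<and> c < b \<and> poly (pderiv p) c = 0"
proof -
  define q where "q = p - [:poly p a:]"
  have dq: "pderiv q = pderiv p" by (simp add: q_def pderiv_diff pderiv_pCons)
  have q0: "poly q a = 0" "poly q b = 0" using assms by (auto simp: q_def)
  show ?thesis
  proof (cases "q = 0")
    case True
    obtain c where "a < c" "c < b" using dense[OF ab] by blast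
    then show ?thesis using True dq by (metis poly_0 pderiv_0)
  next
    case False
    define Z where "Z = {x. a < x \<and> x \<le> b \<and> poly q x = 0}"
    have fin: "finite Z" using poly_roots_finite[OF False] by (rule finite_subset[rotated]) (auto simp: Z_def)
    have "b \<in> Z" using ab q0 by (auto simp: Z_def)
    define z where "z = Min Z"
    have zZ: "z \<in> Z" unfolding z_def using fin \<open>b \<in> Z\<close> by (intro Min_in) auto
    have "poly q x \<noteq> 0" if "a < x" "x < z" for x
    proof
      assume "poly q x = 0"
      with that zZ have "x \<in> Z" by (auto simp: Z_def)
      then have "z \<le> x" unfolding z_def using fin by simp
      with that show False by simp
    qed
    with rc_Rolle_consecutive[of a z q] zZ False q0 obtain c where "a < c" "c < z" "poly (pderiv q) c = 0"
      by (auto simp: Z_def)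
    then show ?thesis using zZ dq by (auto simp: Z_def)
  qed
qed

lemma rc_MVT:
  fixes p :: "'a::real_closed_field poly"
  assumes ab: "a < b"
  shows "\<exists>c. a < c \<and> c < b \<and> poly p b - poly p a = (b - a) * poly (pderiv p) c"
proof -
  define s where "s = (poly p b - poly p a) / (b - a)"
  define q where "q = p - [:0, s:]"
  have s: "s * (b - a) = poly p b - poly p a" using ab by (simp add: s_def)
  have "poly q a = poly q b" using s by (simp add: q_def algebra_simps)
  from rc_Rolle[OF ab this] obtain c where c: "a < c" "c < b" "poly (pderiv q) c = 0" by blast
  then have "poly (pderiv p) c = s" by (simp add: q_def pderiv_diff pderiv_pCons)
  with c s show ?thesis by (metis mult.commute)
qed

lemma rc_poly_strict_mono:
  fixes p :: "'a::real_closed_field poly"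
  assumes "a < b" "\<And>x. a < x \<Longrightarrow> x < b \<Longrightarrow> poly (pderiv p) x > 0"
  shows "poly p a < poly p b"
proof -
  obtain c where "a < c" "c < b" "poly p b - poly p a = (b - a) * poly (pderiv p) c"
    using rc_MVT[OF assms(1)] by blast
  with assms have "poly p b - poly p a > 0" by simp
  then show ?thesis by simp
qed

section \<open>Transfer of sign conditions between real closed fields\<close>

text \<open>The arguments live in different ordered rings, so signs are compared by equivalences and
  not through the values of \<open>sgn\<close>.\<close>

definition same_sign :: "'k::linordered_idom \<Rightarrow> 'l::linordered_idom \<Rightarrow> bool" where
  "same_sign x y \<longleftrightarrow> (x > 0 \<longleftrightarrow> y > 0) \<and> (x < 0 \<longleftrightarrow> y < 0)"

lemma same_sign_0_iff: "same_sign x y \<Longrightarrow> x = 0 \<longleftrightarrow> y = 0"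
  unfolding same_sign_def by (metis not_less_iff_gr_or_eq)

lemma same_sign_uminus [simp]: "same_sign (- x) (- y) \<longleftrightarrow> same_sign x y"
  unfolding same_sign_def by auto

lemma same_sign_pos: "x > 0 \<Longrightarrow> y > 0 \<Longrightarrow> same_sign x y"
  unfolding same_sign_def by auto

lemma same_sign_neg: "x < 0 \<Longrightarrow> y < 0 \<Longrightarrow> same_sign x y"
  unfolding same_sign_def by auto

definition agree ::
  "('k::real_closed_field poly \<times> 'l::real_closed_field poly) set \<Rightarrow> 'k \<Rightarrow> 'l \<Rightarrow> bool" where
  "agree F x y \<longleftrightarrow> (\<forall>(p, q)\<in>F. same_sign (poly p x) (poly q y))"

lemma agree_insert [simp]:
  "agree (insert (p, q) F) x y \<longleftrightarrow> same_sign (poly p x) (poly q y) \<and> agree F x y"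
  unfolding agree_def by auto

lemma agreeD: "agree F x y \<Longrightarrow> (p, q) \<in> F \<Longrightarrow> same_sign (poly p x) (poly q y)"
  unfolding agree_def by auto

text \<open>A sign table for both fields in one object: \<open>[a, b]\<close> and
  \<open>[a', b']\<close> are cut into equally many pieces that match in order. Since
  \<open>cell\<close> compares every interior \<open>x\<close> with every interior \<open>y\<close>,
  each member of \<open>F\<close> has constant sign on a piece. A cut point in \<open>join\<close>
  must be a root of a nonzero member of \<open>F\<close>, because the sign of a further polynomial
  there will be read off from a remainder modulo that member.\<close>

inductive chain ::
  "('k::real_closed_field poly \<times> 'l::real_closed_field poly) set \<Rightarrow> 'k \<Rightarrow> 'k \<Rightarrow> 'l \<Rightarrow> 'l \<Rightarrow> bool"
  for F where
  cell: "a < b \<Longrightarrow> a' < b' \<Longrightarrow> agree F a a' \<Longrightarrow> agree F b b' \<Longrightarrow>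
    (\<And>x y. a < x \<Longrightarrow> x < b \<Longrightarrow> a' < y \<Longrightarrow> y < b' \<Longrightarrow> agree F x y) \<Longrightarrow> chain F a b a' b'"
| join: "chain F a c a' c' \<Longrightarrow> chain F c b c' b' \<Longrightarrow> (f, g) \<in> F \<Longrightarrow> f \<noteq> 0 \<Longrightarrow> poly f c = 0 \<Longrightarrow>
    chain F a b a' b'"

lemma chain_ends: "chain F a b a' b' \<Longrightarrow> a < b \<and> a' < b' \<and> agree F a a' \<and> agree F b b'"
  by (induction rule: chain.induct) auto

text \<open>Locating \<open>x\<close> in the table and answering with a point of the matching piece
  is what eliminates one existential quantifier.\<close>

lemma chain_realize:
  "chain F a b a' b' \<Longrightarrow> a \<le> x \<Longrightarrow> x \<le> b \<Longrightarrow> \<exists>y. a' \<le> y \<and> y \<le> b' \<and> agree F x y"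
proof (induction arbitrary: x rule: chain.induct)
  case (cell a b a' b')
  obtain m where m: "a' < m" "m < b'" using dense[OF cell(2)] by blast
  consider "x = a" | "x = b" | "a < x" "x < b" using cell.prems by fastforce
  then show ?case
  proof cases
    case 3
    then show ?thesis using cell(5)[OF 3 m] m by (meson less_imp_le)
  qed (use cell(2,3,4) in \<open>auto intro: less_imp_le\<close>)
next
  case (join a c a' c' b b' f g)
  have "a' < c'" "c' < b'" using chain_ends[OF join.hyps(1)] chain_ends[OF join.hyps(2)] by auto
  show ?case
  proof (cases "x \<le> c")
    case True
    then show ?thesis using join.IH(1)[OF join.prems(1)] \<open>c' < b'\<close> by (meson order_trans less_imp_le)
  next
    case False
    then have "c \<le> x" by simp
    then show ?thesis using join.IH(2)[of x] join.prems(2) \<open>a' < c'\<close> by (meson order_trans less_imp_le)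
  qed
qed

lemma chain_insert_everywhere:
  assumes "chain F a b a' b'" "\<And>x y. same_sign (poly p x) (poly q y)"
  shows "chain (insert (p, q) F) a b a' b'"
  using assms(1)
proof (induction rule: chain.induct)
  case (cell a b a' b')
  then show ?case using assms(2) by (intro chain.cell) auto
next
  case (join a c a' c' b b' f g)
  then show ?case by (intro chain.join[of _ a c a' c' b b' f g]) auto
qed

text \<open>Strict monotonicity leaves at most one zero on each side, and the signs at the ends
  decide, equally in both fields, whether it exists in the interior. Either nothing happens or both
  intervals are cut once, at corresponding zeros.\<close>

lemma increasing_split:
  fixes p :: "'k::real_closed_field poly" and q :: "'l::real_closed_field poly"
  assumes ab: "a < b" "a' < b'"
    and p': "\<And>x. a < x \<Longrightarrow> x < b \<Longrightarrow> poly (pderiv p) x > 0"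
    and q': "\<And>y. a' < y \<Longrightarrow> y < b' \<Longrightarrow> poly (pderiv q) y > 0"
    and sa: "same_sign (poly p a) (poly q a')" and sb: "same_sign (poly p b) (poly q b')"
  shows "(\<forall>x y. a < x \<longrightarrow> x < b \<longrightarrow> a' < y \<longrightarrow> y < b' \<longrightarrow> same_sign (poly p x) (poly q y)) \<or>
    (\<exists>c c'. a < c \<and> c < b \<and> a' < c' \<and> c' < b' \<and> poly p c = 0 \<and> poly q c' = 0 \<and>
      (\<forall>x y. a < x \<longrightarrow> x < c \<longrightarrow> a' < y \<longrightarrow> y < c' \<longrightarrow> same_sign (poly p x) (poly q y)) \<and>
      (\<forall>x y. c < x \<longrightarrow> x < b \<longrightarrow> c' < y \<longrightarrow> y < b' \<longrightarrow> same_sign (poly p x) (poly q y)))"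
proof -
  have mp: "poly p u < poly p v" if "a \<le> u" "u < v" "v \<le> b" for u v
    using that by (intro rc_poly_strict_mono) (auto intro!: p')
  have mq: "poly q u < poly q v" if "a' \<le> u" "u < v" "v \<le> b'" for u v
    using that by (intro rc_poly_strict_mono) (auto intro!: q')
  consider "poly p a \<ge> 0" | "poly p b \<le> 0" | "poly p a < 0" "poly p b > 0" by linarith
  then show ?thesis
  proof cases
    case 1
    then have "poly q a' \<ge> 0" using sa by (auto simp: same_sign_def not_less[symmetric])
    have "poly p x > 0" "poly q y > 0" if "a < x" "x < b" "a' < y" "y < b'" for x y
      using mp[of a x] mq[of a' y] that 1 \<open>poly q a' \<ge> 0\<close> by auto
    then have "same_sign (poly p x) (poly q y)" if "a < x" "x < b" "a' < y" "y < b'" for x y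
      using that by (intro same_sign_pos)
    then show ?thesis by blast
  next
    case 2
    then have "poly q b' \<le> 0" using sb by (auto simp: same_sign_def not_less[symmetric])
    have "poly p x < 0" "poly q y < 0" if "a < x" "x < b" "a' < y" "y < b'" for x y
      using mp[of x b] mq[of y b'] that 2 \<open>poly q b' \<le> 0\<close> by auto
    then have "same_sign (poly p x) (poly q y)" if "a < x" "x < b" "a' < y" "y < b'" for x y
      using that by (intro same_sign_neg)
    then show ?thesis by blast
  next
    case 3
    then have q: "poly q a' < 0" "poly q b' > 0" using sa sb by (auto simp: same_sign_def)
    obtain c where c: "a < c" "c < b" "poly p c = 0" using rc_poly_IVT_pos[OF ab(1) 3] by blast
    obtain c' where c': "a' < c'" "c' < b'" "poly q c' = 0" using rc_poly_IVT_pos[OF ab(2) q] by blast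
    have 1: "same_sign (poly p x) (poly q y)" if "a < x" "x < c" "a' < y" "y < c'" for x y
      using mp[of x c] mq[of y c'] that c c' by (intro same_sign_neg) auto
    have 2: "same_sign (poly p x) (poly q y)" if "c < x" "x < b" "c' < y" "y < b'" for x y
      using mp[of c x] mq[of c' y] that c c' by (intro same_sign_pos) auto
    show ?thesis
      using c c' 1 2 by blast
  qed
qed

text \<open>With the derivatives already in the table, \<open>p\<close> and \<open>q\<close> are
  strictly monotone on each piece, so inserting them cuts a piece at most once, and at a zero of
  \<open>p\<close>, which is an admissible cut point. The hypothesis \<open>roots\<close> supplies
  the signs of the new pair at the old cut points.\<close>

lemma chain_refine:
  fixes F :: "('k::real_closed_field poly \<times> 'l::real_closed_field poly) set"
  assumes "chain F a b a' b'"
    and dF: "(pderiv p, pderiv q) \<in> F" and p0: "pderiv p \<noteq> 0"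
    and roots: "\<And>f g c c'. (f, g) \<in> F \<Longrightarrow> f \<noteq> 0 \<Longrightarrow> poly f c = 0 \<Longrightarrow> agree F c c' \<Longrightarrow>
      same_sign (poly p c) (poly q c')"
    and "same_sign (poly p a) (poly q a')" "same_sign (poly p b) (poly q b')"
  shows "chain (insert (p, q) F) a b a' b'"
  using assms(1,5,6)
proof (induction rule: chain.induct)
  case (join a c a' c' b b' f g)
  have "agree F c c'" using chain_ends[OF join.hyps(1)] by blast
  then have "same_sign (poly p c) (poly q c')" using roots join.hyps(3-5) by blast
  with join show ?case by (intro chain.join[of _ a c a' c' b b' f g]) auto
next
  case (cell a b a' b')
  have ss: "same_sign (poly (pderiv p) x) (poly (pderiv q) y)" if "a < x" "x < b" "a' < y" "y < b'" for x y
    using cell(5)[OF that] dF by (rule agreeD)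
  obtain y0 where y0: "a' < y0" "y0 < b'" using dense[OF cell(2)] by blast
  \<comment> \<open>The derivative cannot vanish on a whole piece, having finitely many roots, so
    its sign there is strict. Comparison with \<open>x0\<close> fixes this sign for all
    \<open>y\<close>, and comparison with \<open>y0\<close> then fixes it for all
    \<open>x\<close>.\<close>
  have "\<exists>x0. a < x0 \<and> x0 < b \<and> poly (pderiv p) x0 \<noteq> 0"
  proof (rule ccontr)
    assume "\<not> ?thesis"
    then have "{a<..<b} \<subseteq> {x. poly (pderiv p) x = 0}" by auto
    with poly_roots_finite[OF p0] have "finite {a<..<b}" by (rule finite_subset[rotated])
    with infinite_Ioo[OF cell(1)] show False by blast
  qed
  then obtain x0 where x0: "a < x0" "x0 < b" "poly (pderiv p) x0 \<noteq> 0" by blast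
  have "(\<forall>x y. a < x \<longrightarrow> x < b \<longrightarrow> a' < y \<longrightarrow> y < b' \<longrightarrow> same_sign (poly p x) (poly q y)) \<or>
    (\<exists>c c'. a < c \<and> c < b \<and> a' < c' \<and> c' < b' \<and> poly p c = 0 \<and> poly q c' = 0 \<and>
      (\<forall>x y. a < x \<longrightarrow> x < c \<longrightarrow> a' < y \<longrightarrow> y < c' \<longrightarrow> same_sign (poly p x) (poly q y)) \<and>
      (\<forall>x y. c < x \<longrightarrow> x < b \<longrightarrow> c' < y \<longrightarrow> y < b' \<longrightarrow> same_sign (poly p x) (poly q y)))"
  proof (cases "poly (pderiv p) x0 > 0")
    case True
    have "poly (pderiv q) y > 0" if "a' < y" "y < b'" for y
      using ss[OF x0(1,2) that] True by (simp add: same_sign_def)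
    moreover have "poly (pderiv p) x > 0" if "a < x" "x < b" for x
      using ss[OF that y0] calculation[OF y0] by (simp add: same_sign_def)
    ultimately show ?thesis using cell by (intro increasing_split) auto
  next
    case False
    with x0 have n: "poly (pderiv p) x0 < 0" by simp
    have "poly (pderiv q) y < 0" if "a' < y" "y < b'" for y
      using ss[OF x0(1,2) that] n by (simp add: same_sign_def)
    moreover have "poly (pderiv p) x < 0" if "a < x" "x < b" for x
      using ss[OF that y0] calculation[OF y0] by (simp add: same_sign_def)
    ultimately show ?thesis
      using increasing_split[of a b a' b' "-p" "-q"] cell by (simp add: pderiv_minus)
  qed
  then show ?case
  proof (elim disjE exE conjE)
    assume "\<forall>x y. a < x \<longrightarrow> x < b \<longrightarrow> a' < y \<longrightarrow> y < b' \<longrightarrow> same_sign (poly p x) (poly q y)"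
    then show ?thesis using cell by (intro chain.cell) auto
  next
    fix c c'
    assume c: "a < c" "c < b" "a' < c'" "c' < b'" "poly p c = 0" "poly q c' = 0"
      "\<forall>x y. a < x \<longrightarrow> x < c \<longrightarrow> a' < y \<longrightarrow> y < c' \<longrightarrow> same_sign (poly p x) (poly q y)"
      "\<forall>x y. c < x \<longrightarrow> x < b \<longrightarrow> c' < y \<longrightarrow> y < b' \<longrightarrow> same_sign (poly p x) (poly q y)"
    have "p \<noteq> 0" using p0 by auto
    have cc: "agree (insert (p, q) F) c c'" using cell(5) c by (simp add: same_sign_def)
    have "chain (insert (p, q) F) a c a' c'"
      using cell c cc by (intro chain.cell) auto
    moreover have "chain (insert (p, q) F) c b c' b'"
      using cell c cc by (intro chain.cell) auto
    ultimately show ?thesis using \<open>p \<noteq> 0\<close> c by (intro chain.join[of _ a c a' c' b b' p q]) auto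
  qed
qed

section \<open>Finite closure of a family and pseudo-division\<close>

text \<open>An element that is new at stage \<open>i + 1\<close> has a parent that was new at stage
  \<open>i\<close>, since otherwise it would have been produced earlier. Hence the rank has dropped
  \<open>i + 1\<close> times from at most \<open>N\<close>, and nothing new appears after stage
  \<open>N\<close>. Only one parent need be new, so the rank has to drop below both.\<close>

lemma finite_rank_closure:
  fixes ops :: "'e \<Rightarrow> 'e \<Rightarrow> 'e set" and rank :: "'e \<Rightarrow> nat"
  assumes F: "finite F" "F \<subseteq> U" and fin: "\<And>x y. finite (ops x y)"
    and U: "\<And>x y. x \<in> U \<Longrightarrow> y \<in> U \<Longrightarrow> ops x y \<subseteq> U"
    and rank: "\<And>x y z. z \<in> ops x y \<Longrightarrow> rank z < rank x \<and> rank z < rank y"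
  shows "\<exists>C. finite C \<and> F \<subseteq> C \<and> C \<subseteq> U \<and> (\<forall>x\<in>C. \<forall>y\<in>C. ops x y \<subseteq> C)"
proof -
  define step where "step S = S \<union> (\<Union>x\<in>S. \<Union>y\<in>S. ops x y)" for S
  define C where "C i = (step ^^ i) F" for i
  have C0: "C 0 = F" and CS: "C (Suc i) = step (C i)" for i by (simp_all add: C_def)
  have finC: "finite (C i)" for i
    by (induction i) (auto simp: C0 CS step_def F fin)
  have CU: "C i \<subseteq> U" for i
    using U F by (induction i) (auto simp: C0 CS step_def, blast)
  have FC: "F \<subseteq> C i" for i
    by (induction i) (auto simp: C0 CS step_def)
  obtain N where N: "\<And>x. x \<in> F \<Longrightarrow> rank x \<le> N"
    using F(1) by (metis finite_imageI finite_nat_set_iff_bounded_le imageI)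
  have new: "rank z + Suc i \<le> N" if "z \<in> C (Suc i)" "z \<notin> C i" for z i
    using that
  proof (induction i arbitrary: z)
    case 0
    then obtain x y where "x \<in> F" "z \<in> ops x y" by (auto simp: C0 CS step_def)
    with N[of x] rank[of z x y] show ?case by simp
  next
    case (Suc i)
    then obtain x y where xy: "x \<in> C (Suc i)" "y \<in> C (Suc i)" "z \<in> ops x y"
      by (auto simp: CS[of "Suc i"] step_def)
    have "x \<notin> C i \<or> y \<notin> C i"
      using Suc.prems(2) xy(3) by (auto simp: CS step_def)
    then have "rank x + Suc i \<le> N \<or> rank y + Suc i \<le> N"
      using Suc.IH[OF xy(1)] Suc.IH[OF xy(2)] by blast
    then show ?case using rank[OF xy(3)] by auto
  qed
  have "C (Suc N) \<subseteq> C N"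
  proof
    fix z assume "z \<in> C (Suc N)"
    then show "z \<in> C N" using new[of z N] by (cases "z \<in> C N") simp_all
  qed
  then have "\<forall>x\<in>C N. \<forall>y\<in>C N. ops x y \<subseteq> C N" unfolding CS step_def by blast
  then show ?thesis using finC[of N] CU[of N] FC[of N] by (intro exI[of _ "C N"]) simp
qed

text \<open>Division by \<open>f\<close> without inverting coefficients: each step cancels the
  coefficient at \<open>n + k\<close> and scales by the square of the leading coefficient, so that
  signs at the roots of \<open>f\<close> survive. \<open>n\<close> is an argument in place of
  \<open>degree f\<close> because the same computation is run on the second components, whose degree
  may vary with the parameter.\<close>

primrec pseudo_rem :: "nat \<Rightarrow> 'a::comm_ring_1 poly \<Rightarrow> 'a poly \<Rightarrow> nat \<Rightarrow> 'a poly" where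
  "pseudo_rem n f p 0 = p"
| "pseudo_rem n f p (Suc k) =
    pseudo_rem n f (smult (coeff f n ^ 2) p - monom (coeff f n * coeff p (n + k)) k * f) k"

lemma poly_pseudo_rem_root:
  assumes "poly f x = 0"
  shows "poly (pseudo_rem n f p k) x = (coeff f n ^ 2) ^ k * poly p x"
  by (induction k arbitrary: p) (auto simp: assms algebra_simps)

lemma coeff_pseudo_rem_eq_0:
  assumes "degree f = n" "\<And>i. i \<ge> n + k \<Longrightarrow> coeff p i = 0" "i \<ge> n"
  shows "coeff (pseudo_rem n f p k) i = 0"
  using assms(2)
proof (induction k arbitrary: p)
  case 0
  then show ?case using assms(3) by simp
next
  case (Suc k)
  have "coeff (smult (coeff f n ^ 2) p - monom (coeff f n * coeff p (n + k)) k * f) j = 0" if "j \<ge> n + k" for j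
  proof (cases "j = n + k")
    case True
    then show ?thesis by (simp add: coeff_monom_mult power2_eq_square)
  next
    case False
    with that have "j \<ge> n + Suc k" "j - k > degree f" using assms(1) by auto
    then show ?thesis using Suc.prems[of j] by (simp add: coeff_monom_mult coeff_eq_0)
  qed
  then show ?case using Suc.IH by simp
qed

section \<open>Pairs of an abstract value and a real function\<close>

text \<open>\<open>'z\<close> is the parameter space: a pair joins an element of one ring, the value
  at the abstract point, with a function of the parameters that is meant to take its sign. This is a
  relation and not a map, since one element may be the value of many functions.\<close>

locale pair_ring =
  fixes D :: "('k::idom \<times> ('z \<Rightarrow> 'l::idom)) set"
  assumes one: "(1, \<lambda>_. 1) \<in> D"
    and diff: "(a, u) \<in> D \<Longrightarrow> (b, v) \<in> D \<Longrightarrow> (a - b, \<lambda>z. u z - v z) \<in> D"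
    and mult: "(a, u) \<in> D \<Longrightarrow> (b, v) \<in> D \<Longrightarrow> (a * b, \<lambda>z. u z * v z) \<in> D"
begin

lemma zero: "(0, \<lambda>_. 0) \<in> D"
  using diff[OF one one] by simp

lemma add: "(a, u) \<in> D \<Longrightarrow> (b, v) \<in> D \<Longrightarrow> (a + b, \<lambda>z. u z + v z) \<in> D"
  using diff[OF _ diff[OF zero], of a u b v] by simp

lemma of_nat: "(of_nat n, \<lambda>_. of_nat n) \<in> D"
  using zero add[OF one] by (induction n) auto

lemma sum:
  assumes "\<And>i. i \<in> I \<Longrightarrow> (a i, \<lambda>z. u i z) \<in> D"
  shows "(\<Sum>i\<in>I. a i, \<lambda>z. \<Sum>i\<in>I. u i z) \<in> D"
  using assms
proof (induction I rule: infinite_finite_induct)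
  case (insert x I)
  then show ?case using add[of "a x" "u x" "\<Sum>i\<in>I. a i" "\<lambda>z. \<Sum>i\<in>I. u i z"] by simp
qed (simp_all add: zero)

text \<open>The bound \<open>N\<close> is uniform in \<open>z\<close>, although the degree of
  \<open>q z\<close> may depend on \<open>z\<close>. It lets finitely many coefficient pairs control
  the polynomials for all parameters at once.\<close>

definition poly_pairs :: "('k poly \<times> ('z \<Rightarrow> 'l poly)) set" where
  "poly_pairs = {(p, q). (\<forall>i. (coeff p i, \<lambda>z. coeff (q z) i) \<in> D) \<and>
    (\<exists>N. \<forall>i>N. coeff p i = 0 \<and> (\<forall>z. coeff (q z) i = 0))}"

lemma poly_pairs_I:
  assumes "\<And>i. (coeff p i, \<lambda>z. coeff (q z) i) \<in> D"
    and "\<And>i. i > N \<Longrightarrow> coeff p i = 0" "\<And>i z. i > N \<Longrightarrow> coeff (q z) i = 0"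
  shows "(p, q) \<in> poly_pairs"
  using assms unfolding poly_pairs_def by blast

lemma poly_pairs_coeff: "(p, q) \<in> poly_pairs \<Longrightarrow> (coeff p i, \<lambda>z. coeff (q z) i) \<in> D"
  unfolding poly_pairs_def by blast

lemma poly_pairs_bound:
  assumes "(p, q) \<in> poly_pairs"
  obtains N where "\<And>i. i > N \<Longrightarrow> coeff p i = 0" "\<And>i z. i > N \<Longrightarrow> coeff (q z) i = 0"
  using assms unfolding poly_pairs_def by blast

lemma poly_pairs_const: "(c, w) \<in> D \<Longrightarrow> ([:c:], \<lambda>z. [:w z:]) \<in> poly_pairs"
  by (rule poly_pairs_I[where N = 0]) (auto simp: coeff_pCons zero split: nat.splits)

lemma poly_pairs_X: "([:0, 1:], \<lambda>z. [:0, 1:]) \<in> poly_pairs"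
  by (rule poly_pairs_I[where N = 1]) (auto simp: coeff_pCons zero one split: nat.splits)

lemma poly_pairs_diff:
  assumes "(p, q) \<in> poly_pairs" "(f, g) \<in> poly_pairs"
  shows "(p - f, \<lambda>z. q z - g z) \<in> poly_pairs"
proof -
  obtain N where "\<And>i. i > N \<Longrightarrow> coeff p i = 0" "\<And>i z. i > N \<Longrightarrow> coeff (q z) i = 0"
    using poly_pairs_bound[OF assms(1)] by blast
  moreover obtain M where "\<And>i. i > M \<Longrightarrow> coeff f i = 0" "\<And>i z. i > M \<Longrightarrow> coeff (g z) i = 0"
    using poly_pairs_bound[OF assms(2)] by blast
  ultimately show ?thesis
    using assms by (intro poly_pairs_I[where N = "max N M"]) (auto intro: diff poly_pairs_coeff)
qed

lemma poly_pairs_mult: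
  assumes "(p, q) \<in> poly_pairs" "(f, g) \<in> poly_pairs"
  shows "(p * f, \<lambda>z. q z * g z) \<in> poly_pairs"
proof -
  obtain N where N: "\<And>i. i > N \<Longrightarrow> coeff p i = 0" "\<And>i z. i > N \<Longrightarrow> coeff (q z) i = 0"
    using poly_pairs_bound[OF assms(1)] by blast
  obtain M where M: "\<And>i. i > M \<Longrightarrow> coeff f i = 0" "\<And>i z. i > M \<Longrightarrow> coeff (g z) i = 0"
    using poly_pairs_bound[OF assms(2)] by blast
  have z: "i > N \<or> k - i > M" if "k > N + M" for i k using that by auto
  show ?thesis
  proof (rule poly_pairs_I[where N = "N + M"])
    show "(coeff (p * f) i, \<lambda>z. coeff (q z * g z) i) \<in> D" for i
      unfolding coeff_mult using assms by (intro sum mult poly_pairs_coeff)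
    show "coeff (p * f) i = 0" if "i > N + M" for i
      unfolding coeff_mult using z[OF that] N(1) M(1) by (intro sum.neutral) (metis mult_zero_left mult_zero_right)
    show "coeff (q z * g z) i = 0" if "i > N + M" for i z
      unfolding coeff_mult using z[OF that] N(2) M(2) by (intro sum.neutral) (metis mult_zero_left mult_zero_right)
  qed
qed

lemma poly_pairs_smult: "(c, w) \<in> D \<Longrightarrow> (p, q) \<in> poly_pairs \<Longrightarrow> (smult c p, \<lambda>z. smult (w z) (q z)) \<in> poly_pairs"
  using poly_pairs_mult[OF poly_pairs_const[of c w], of p q] by simp

lemma poly_pairs_monom: "(c, w) \<in> D \<Longrightarrow> (monom c n, \<lambda>z. monom (w z) n) \<in> poly_pairs"
  by (rule poly_pairs_I[where N = n]) (auto simp: zero)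

lemma poly_pairs_pderiv:
  assumes "(p, q) \<in> poly_pairs"
  shows "(pderiv p, \<lambda>z. pderiv (q z)) \<in> poly_pairs"
proof -
  obtain N where "\<And>i. i > N \<Longrightarrow> coeff p i = 0" "\<And>i z. i > N \<Longrightarrow> coeff (q z) i = 0"
    using poly_pairs_bound[OF assms(1)] by blast
  then show ?thesis
    by (intro poly_pairs_I[where N = N]) (auto simp del: of_nat_Suc simp: coeff_pderiv intro!: mult of_nat poly_pairs_coeff[OF assms])
qed

lemma poly_pairs_pseudo_rem:
  assumes "(f, g) \<in> poly_pairs" "(p, q) \<in> poly_pairs"
  shows "(pseudo_rem n f p k, \<lambda>z. pseudo_rem n (g z) (q z) k) \<in> poly_pairs"
  using assms(2)
proof (induction k arbitrary: p q)
  case (Suc k)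
  show ?case
    unfolding pseudo_rem.simps
    by (rule Suc.IH) (intro poly_pairs_diff poly_pairs_smult poly_pairs_mult poly_pairs_monom mult poly_pairs_coeff assms Suc.prems, unfold power2_eq_square, intro mult poly_pairs_coeff assms)
qed simp

end

section \<open>Signs of polynomials near infinity\<close>

lemma poly_pos_at_top:
  fixes p :: "'a::linordered_field poly"
  assumes "lead_coeff p > 0"
  shows "\<exists>B. \<exists>e>0. \<forall>x\<ge>B. poly p x \<ge> e"
  using assms
proof (induction p)
  case (pCons a p)
  show ?case
  proof (cases "p = 0")
    case True
    then show ?thesis using pCons by auto
  next
    case False
    then obtain B e where e: "e > 0" "\<And>x. x \<ge> B \<Longrightarrow> poly p x \<ge> e" using pCons by auto
    \<comment> \<open>From here on \<open>x * e\<close> is at least \<open>1 + |a|\<close>, which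
      absorbs the constant term. A positive lower bound \<open>e\<close> is carried through the
      induction because mere positivity of \<open>p\<close> would not dominate
      \<open>a\<close>.\<close>
    have "poly (pCons a p) x \<ge> 1" if x: "x \<ge> max B ((1 + \<bar>a\<bar>) / e)" for x
    proof -
      have "(1 + \<bar>a\<bar>) / e \<le> x" "0 \<le> (1 + \<bar>a\<bar>) / e" using x e(1) by auto
      then have "0 \<le> x" by (rule order_trans[rotated])
      have "1 + \<bar>a\<bar> \<le> x * e" using \<open>(1 + \<bar>a\<bar>) / e \<le> x\<close> e(1) by (simp add: field_simps)
      moreover have "x * e \<le> x * poly p x" using e(2)[of x] x \<open>0 \<le> x\<close> by (intro mult_left_mono) auto
      ultimately show ?thesis by simp
    qed
    then show ?thesis by (metis zero_less_one)
  qed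
qed simp

lemma same_sign_trans: "same_sign x y \<Longrightarrow> same_sign y z \<Longrightarrow> same_sign x z"
  unfolding same_sign_def by auto

lemma same_sign_sym: "same_sign x y \<Longrightarrow> same_sign y x"
  unfolding same_sign_def by auto

lemma poly_sign_at_top:
  fixes p :: "'a::linordered_field poly"
  shows "\<exists>B. \<forall>x\<ge>B. same_sign (poly p x) (lead_coeff p)"
proof (cases "lead_coeff p" "0::'a" rule: linorder_cases)
  case less
  then show ?thesis using poly_pos_at_top[of "-p"]
    by (simp add: same_sign_def) (metis less_le_trans less_imp_not_less neg_0_less_iff_less)
next
  case equal
  then show ?thesis by (simp add: same_sign_def)
next
  case greater
  then show ?thesis using poly_pos_at_top[of p]
    by (simp add: same_sign_def) (metis less_le_trans less_imp_not_less)
qed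

lemma poly_sign_at_bot:
  fixes p :: "'a::linordered_field poly"
  shows "\<exists>B. \<forall>x\<ge>B. same_sign (poly p (- x)) ((-1) ^ degree p * lead_coeff p)"
  using poly_sign_at_top[of "pcompose p [:0, -1:]"]
  by (simp add: poly_pcompose lead_coeff_comp mult.commute)

lemma same_sign_mult:
  "same_sign a b \<Longrightarrow> same_sign c d \<Longrightarrow> same_sign (a * c) (b * d)"
  unfolding same_sign_def by (auto simp: zero_less_mult_iff mult_less_0_iff)

lemma same_sign_minus_one_power: "same_sign ((-1) ^ n) ((-1) ^ n)"
  by (cases "even n") (auto simp: same_sign_def)

lemma same_sign_degree:
  assumes "\<And>i. same_sign (coeff p i) (coeff q i)"
  shows "degree p = degree q"
proof -
  have "coeff p i = 0 \<longleftrightarrow> coeff q i = 0" for i using same_sign_0_iff[OF assms] .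
  then show ?thesis by (metis degree_le leading_coeff_0_iff coeff_eq_0 le_antisym not_le)
qed

text \<open>Equal signs of coefficients force equal degrees, and the leading coefficients decide the
  signs far out in both directions. This provides the outer end points of the sign tables.\<close>

lemma eventually_same_sign_ends:
  assumes "finite C"
    and "\<And>p q i. (p, q) \<in> C \<Longrightarrow> same_sign (coeff p i) (coeff q i)"
  shows "\<exists>(B::'k::linordered_field) (B'::'l::linordered_field). \<forall>x\<ge>B. \<forall>y\<ge>B'. \<forall>(p, q)\<in>C.
    same_sign (poly p x) (poly q y) \<and> same_sign (poly p (- x)) (poly q (- y))"
  using assms
proof (induction C rule: finite_induct)
  case (insert e C)
  obtain p q where e: "e = (p, q)" by fastforce
  obtain B B' where B: "\<forall>x\<ge>B. \<forall>y\<ge>B'. \<forall>(p, q)\<in>C.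
    same_sign (poly p x) (poly q y) \<and> same_sign (poly p (- x)) (poly q (- y))"
    using insert.IH insert.prems by blast
  have s: "same_sign (coeff p i) (coeff q i)" for i using insert.prems e by blast
  have dg: "degree p = degree q" using same_sign_degree s by blast
  obtain B1 where B1: "\<forall>x\<ge>B1. same_sign (poly p x) (lead_coeff p)" using poly_sign_at_top by blast
  obtain B2 where B2: "\<forall>x\<ge>B2. same_sign (poly p (-x)) ((-1) ^ degree p * lead_coeff p)" using poly_sign_at_bot by blast
  obtain B1' where B1': "\<forall>x\<ge>B1'. same_sign (poly q x) (lead_coeff q)" using poly_sign_at_top by blast
  obtain B2' where B2': "\<forall>x\<ge>B2'. same_sign (poly q (-x)) ((-1) ^ degree q * lead_coeff q)" using poly_sign_at_bot by blast
  have l: "same_sign (lead_coeff p) (lead_coeff q)" using s dg by simp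
  have l2: "same_sign ((-1) ^ degree p * lead_coeff p) ((-1) ^ degree q * lead_coeff q)"
    using l dg by (auto intro: same_sign_mult same_sign_minus_one_power)
  have "same_sign (poly p x) (poly q y)" "same_sign (poly p (- x)) (poly q (- y))"
    if "x \<ge> B1" "x \<ge> B2" "y \<ge> B1'" "y \<ge> B2'" for x y
    using B1 B1' B2 B2' l l2 that by (meson same_sign_trans same_sign_sym)+
  with B show ?case
    by (intro exI[of _ "max B (max B1 B2)"] exI[of _ "max B' (max B1' B2')"]) (auto simp: e)
qed auto

section \<open>Sign tables of closed families and elimination of one variable\<close>

text \<open>At a root of \<open>f\<close> the value of \<open>p\<close> is, up to a positive factor,
  that of its pseudo-remainder modulo \<open>f\<close>, whose sign the table already matches. A
  constant \<open>p\<close> is settled by its only coefficient.\<close>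

lemma chain_insert_closed:
  fixes F :: "('k::real_closed_field poly \<times> 'l::real_closed_field poly) set"
  assumes chain: "chain F a b a' b'"
    and coeffs: "\<And>f g i. (f, g) \<in> insert (p, q) F \<Longrightarrow> same_sign (coeff f i) (coeff g i)"
    and deriv: "degree p > 0 \<Longrightarrow> (pderiv p, pderiv q) \<in> F"
    and rems: "\<And>f g. (f, g) \<in> F \<Longrightarrow> degree f > 0 \<Longrightarrow>
      \<exists>k. (pseudo_rem (degree f) f p k, pseudo_rem (degree f) g q k) \<in> F"
    and ends: "same_sign (poly p a) (poly q a')" "same_sign (poly p b) (poly q b')"
  shows "chain (insert (p, q) F) a b a' b'"
proof (cases "degree p = 0")
  case True
  have "degree q = 0" using True coeffs[of p q] same_sign_degree by fastforce
  with True obtain c d where "p = [:c:]" "q = [:d:]" by (meson degree_eq_zeroE)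
  then show ?thesis using coeffs[of p q 0] chain by (intro chain_insert_everywhere) auto
next
  case False
  show ?thesis
  proof (rule chain_refine[OF chain _ _ _ ends])
    show "(pderiv p, pderiv q) \<in> F" using deriv False by simp
    show "pderiv p \<noteq> 0" using False by (simp add: pderiv_eq_0_iff)
    fix f g c c'
    assume f: "(f, g) \<in> F" "f \<noteq> 0" "poly f c = 0" and ag: "agree F c c'"
    have "degree f > 0" using f(2,3) by (metis degree_eq_zeroE gr0I mult_zero_right add.right_neutral poly_pCons poly_0 pCons_0_0)
    with rems[OF f(1)] obtain k where k: "(pseudo_rem (degree f) f p k, pseudo_rem (degree f) g q k) \<in> F" by blast
    have g0: "poly g c' = 0" using same_sign_0_iff[OF agreeD[OF ag f(1)]] f(3) by simp
    have lc: "coeff f (degree f) \<noteq> 0" using f(2) by simp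
    then have lc': "coeff g (degree f) \<noteq> 0"
      using same_sign_0_iff[OF coeffs[of f g "degree f"]] f(1) by blast
    have "(coeff f (degree f) ^ 2) ^ k > 0" "(coeff g (degree f) ^ 2) ^ k > 0"
      using lc lc' by (auto intro!: zero_less_power)
    moreover have "same_sign ((coeff f (degree f) ^ 2) ^ k * poly p c) ((coeff g (degree f) ^ 2) ^ k * poly q c')"
      using agreeD[OF ag k] by (simp add: poly_pseudo_rem_root f(3) g0)
    ultimately show "same_sign (poly p c) (poly q c')"
      by (auto simp: same_sign_def zero_less_mult_iff mult_less_0_iff)
  qed
qed

text \<open>Remainder and derivative are packed into one binary operation, the derivative on the
  diagonal, so that a single closure lemma applies. The number of steps, one more than the degree
  difference, is just enough to bring the degree below that of the divisor. All degrees are read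
  from the first component, also when the second one is computed.\<close>

definition closure_ops where
  "closure_ops d e =
    (if degree (fst d) > 0 \<and> degree (fst d) \<le> degree (fst e)
     then {(pseudo_rem (degree (fst d)) (fst d) (fst e) (Suc (degree (fst e)) - degree (fst d)),
            \<lambda>z. pseudo_rem (degree (fst d)) (snd d z) (snd e z) (Suc (degree (fst e)) - degree (fst d)))}
     else {}) \<union>
    (if d = e \<and> degree (fst e) > 0 then {(pderiv (fst e), \<lambda>z. pderiv (snd e z))} else {})"

lemma closure_ops_degree:
  fixes d :: "'k::{idom,ring_char_0} poly \<times> ('z \<Rightarrow> 'l::idom poly)"
  assumes "x \<in> closure_ops d e"
  shows "degree (fst x) < degree (fst d) \<and> degree (fst x) < degree (fst e)"
proof -
  have *: "degree (pseudo_rem (degree f) f p (Suc (degree p) - degree f)) < degree f"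
    if "degree f > 0" "degree f \<le> degree p" for f p :: "'k poly"
  proof -
    have "coeff (pseudo_rem (degree f) f p (Suc (degree p) - degree f)) i = 0" if "i \<ge> degree f" for i
      using that \<open>degree f \<le> degree p\<close> by (intro coeff_pseudo_rem_eq_0) (auto intro: coeff_eq_0)
    then have "degree (pseudo_rem (degree f) f p (Suc (degree p) - degree f)) \<le> degree f - 1"
      using that(1) by (intro degree_le) auto
    with that show ?thesis by linarith
  qed
  show ?thesis
    using assms *[of "fst d" "fst e"]
    by (auto simp: closure_ops_def degree_pderiv split: if_splits)
qed

lemma (in pair_ring) closure_ops_poly_pairs: "d \<in> poly_pairs \<Longrightarrow> e \<in> poly_pairs \<Longrightarrow> closure_ops d e \<subseteq> poly_pairs"
  by (cases d; cases e) (auto simp: closure_ops_def simp del: pseudo_rem.simps Suc_diff_le intro!: poly_pairs_pseudo_rem poly_pairs_pderiv)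

text \<open>Members are inserted in order of degree. What a new member of degree \<open>n\<close>
  needs, its derivative and its remainders modulo members of degree at most \<open>n\<close>, has
  degree below \<open>n\<close> and is therefore in the table already.\<close>

lemma closed_family_chain:
  fixes C :: "('k::real_closed_field poly \<times> ('z \<Rightarrow> 'l::real_closed_field poly)) set"
  assumes fin: "finite C"
    and closed: "\<And>d e. d \<in> C \<Longrightarrow> e \<in> C \<Longrightarrow> closure_ops d e \<subseteq> C"
    and coeffs: "\<And>p q i. (p, q) \<in> C \<Longrightarrow> same_sign (coeff p i) (coeff (q z) i)"
    and ab: "a < b" "a' < b'"
    and ends: "\<And>p q. (p, q) \<in> C \<Longrightarrow> same_sign (poly p a) (poly (q z) a') \<and> same_sign (poly p b) (poly (q z) b')"
  shows "chain ((\<lambda>(p, q). (p, q z)) ` C) a b a' b'"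
proof -
  define inst where "inst S = (\<lambda>(p, q). (p, q z)) ` S" for S :: "('k poly \<times> ('z \<Rightarrow> 'l poly)) set"
  have *: "chain (inst {e \<in> C. degree (fst e) < n}) a b a' b'" for n
  proof (induction n)
    case 0
    show ?case using ab by (auto simp: inst_def agree_def intro: chain.cell)
  next
    case (Suc n)
    have "chain (inst ({e \<in> C. degree (fst e) < n} \<union> S)) a b a' b'"
      if "finite S" "S \<subseteq> {e \<in> C. degree (fst e) = n}" for S
      using that
    proof (induction S rule: finite_induct)
      case empty
      then show ?case using Suc.IH by simp
    next
      case (insert e S)
      obtain p q where e: "e = (p, q)" by fastforce
      have eC: "(p, q) \<in> C" "degree p = n" using insert.prems e by auto
      let ?F = "{e \<in> C. degree (fst e) < n} \<union> S"
      have FC: "?F \<subseteq> C" using insert.prems by auto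
      have low: "x \<in> ?F" if "d \<in> C" "x \<in> closure_ops d (p, q)" for d x
        using closed[OF that(1) eC(1)] closure_ops_degree[OF that(2)] that(2) eC(2) by auto
      have "chain (insert (p, q z) (inst ?F)) a b a' b'"
      proof (rule chain_insert_closed)
        show "chain (inst ?F) a b a' b'" using insert by blast
        show "same_sign (coeff f i) (coeff g i)" if "(f, g) \<in> insert (p, q z) (inst ?F)" for f g i
          using that FC eC coeffs unfolding inst_def by auto
        show "same_sign (poly p a) (poly (q z) a')" "same_sign (poly p b) (poly (q z) b')"
          using ends eC by auto
        show "(pderiv p, pderiv (q z)) \<in> inst ?F" if "degree p > 0"
        proof -
          have "(pderiv p, \<lambda>z. pderiv (q z)) \<in> closure_ops (p, q) (p, q)"
            using that by (simp add: closure_ops_def)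
          from low[OF eC(1) this] show ?thesis unfolding inst_def by (rule rev_image_eqI) simp
        qed
        fix f g assume "(f, g) \<in> inst ?F" and f: "degree f > 0"
        then obtain e' where e': "e' \<in> ?F" "f = fst e'" "g = snd e' z"
          unfolding inst_def by (elim imageE) (simp add: case_prod_beta)
        define g' where "g' = snd e'"
        have g': "(f, g') \<in> ?F" "g = g' z" using e' by (simp_all add: g'_def)
        have fn: "degree f \<le> degree p" using g'(1) insert.prems eC(2) by auto
        let ?k = "Suc (degree p) - degree f"
        have "(pseudo_rem (degree f) f p ?k, \<lambda>z. pseudo_rem (degree f) (g' z) (q z) ?k) \<in> closure_ops (f, g') (p, q)"
          using f fn by (simp add: closure_ops_def)
        moreover have "(f, g') \<in> C" using g' FC by blast
        ultimately have "(pseudo_rem (degree f) f p ?k, \<lambda>z. pseudo_rem (degree f) (g' z) (q z) ?k) \<in> ?F"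
          using low by blast
        then have "(pseudo_rem (degree f) f p ?k, pseudo_rem (degree f) g (q z) ?k) \<in> inst ?F"
          unfolding inst_def g'(2) by (rule rev_image_eqI) simp
        then show "\<exists>k. (pseudo_rem (degree f) f p k, pseudo_rem (degree f) g (q z) k) \<in> inst ?F" by blast
      qed
      then show ?case by (simp add: inst_def e)
    qed
    from this[of "{e \<in> C. degree (fst e) = n}"]
    have "chain (inst ({e \<in> C. degree (fst e) < n} \<union> {e \<in> C. degree (fst e) = n})) a b a' b'"
      using fin by simp
    moreover have "{e \<in> C. degree (fst e) < n} \<union> {e \<in> C. degree (fst e) = n} = {e \<in> C. degree (fst e) < Suc n}"
      by auto
    ultimately show ?case by simp
  qed
  obtain N where "\<forall>e\<in>C. degree (fst e) < N"
    using fin by (metis finite_imageI finite_nat_set_iff_bounded imageI)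
  then have "{e \<in> C. degree (fst e) < N} = C" by auto
  with *[of N] show ?thesis by (simp add: inst_def)
qed

text \<open>The signs of all coefficients of a closed family determine its sign table: they fix the
  signs near infinity, and the rest follows by induction on the degree. The coefficients of the
  closure of \<open>F\<close> therefore serve as \<open>G\<close>.\<close>

theorem sign_elimination:
  fixes D :: "('k::real_closed_field \<times> ('z \<Rightarrow> 'l::real_closed_field)) set"
  assumes "pair_ring D" and F: "finite F" "F \<subseteq> pair_ring.poly_pairs D"
  shows "\<exists>G. finite G \<and> G \<subseteq> D \<and> (\<forall>z. (\<forall>(c, w)\<in>G. same_sign c (w z)) \<longrightarrow>
    (\<forall>x. \<exists>y. \<forall>(p, q)\<in>F. same_sign (poly p x) (poly (q z) y)))"
proof -
  interpret pair_ring D by fact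
  obtain C where C: "finite C" "F \<subseteq> C" "C \<subseteq> poly_pairs" "\<And>d e. d \<in> C \<Longrightarrow> e \<in> C \<Longrightarrow> closure_ops d e \<subseteq> C"
  proof -
    have "\<exists>C. finite C \<and> F \<subseteq> C \<and> C \<subseteq> poly_pairs \<and> (\<forall>d\<in>C. \<forall>e\<in>C. closure_ops d e \<subseteq> C)"
      using F by (rule finite_rank_closure[where rank = "\<lambda>e. degree (fst e)"])
        (simp add: closure_ops_def, rule closure_ops_poly_pairs, assumption, assumption, erule closure_ops_degree)
    then show ?thesis using that by (elim exE conjE) simp
  qed
  have "\<exists>N. \<forall>e\<in>C. \<forall>i>N. coeff (fst e) i = 0 \<and> (\<forall>z. coeff (snd e z) i = 0)"
    using C(1,3)
  proof (induction C rule: finite_induct)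
    case (insert e C)
    then obtain N where N: "\<forall>e\<in>C. \<forall>i>N. coeff (fst e) i = 0 \<and> (\<forall>z. coeff (snd e z) i = 0)" by blast
    obtain M where "\<forall>i>M. coeff (fst e) i = 0 \<and> (\<forall>z. coeff (snd e z) i = 0)"
      using insert.prems poly_pairs_bound[of "fst e" "snd e"] by (metis insert_subset prod.collapse)
    with N show ?case by (intro exI[of _ "max N M"]) auto
  qed simp
  then obtain N where N: "\<And>e i z. e \<in> C \<Longrightarrow> i > N \<Longrightarrow> coeff (fst e) i = 0 \<and> coeff (snd e z) i = 0" by blast
  define G where "G = (\<lambda>(e, i). (coeff (fst e) i, \<lambda>z. coeff (snd e z) i)) ` (C \<times> {..N})"
  have finG: "finite G" unfolding G_def using C by simp
  have GD: "G \<subseteq> D" unfolding G_def using C(3) poly_pairs_coeff by fastforce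
  have real: "\<exists>y. \<forall>(p, q)\<in>F. same_sign (poly p x) (poly (q z) y)"
    if z: "\<forall>(c, w)\<in>G. same_sign c (w z)" for z x
  proof -
    have coeffs: "same_sign (coeff p i) (coeff (q z) i)" if "(p, q) \<in> C" for p q i
    proof (cases "i \<le> N")
      case True
      then have "(coeff p i, \<lambda>z. coeff (q z) i) \<in> G"
        unfolding G_def using that by (intro rev_image_eqI[of "((p, q), i)"]) auto
      from bspec[OF z this] show ?thesis by simp
    next
      case False
      then show ?thesis using N[OF that, of i z] by (simp add: same_sign_def)
    qed
    have "finite ((\<lambda>(p, q). (p, q z)) ` C)" using C(1) by simp
    from eventually_same_sign_ends[OF this] coeffs
    obtain B B' where B: "\<And>x y p q. x \<ge> B \<Longrightarrow> y \<ge> B' \<Longrightarrow> (p, q) \<in> C \<Longrightarrow>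
      same_sign (poly p x) (poly (q z) y) \<and> same_sign (poly p (- x)) (poly (q z) (- y))"
      by fastforce
    \<comment> \<open>The end points lie beyond the bounds for the signs near infinity and enclose
      \<open>x\<close>; the \<open>1\<close> in \<open>b'\<close> only ensures
      \<open>- b' < b'\<close>.\<close>
    define b where "b = max B (\<bar>x\<bar> + 1)"
    define b' where "b' = max B' 1"
    have "\<bar>x\<bar> + 1 \<le> b" "1 \<le> b'" "B \<le> b" "B' \<le> b'" by (auto simp: b_def b'_def)
    then have bb: "- b \<le> x" "x \<le> b" "- b < b" "- b' < b'" by (auto simp: abs_if split: if_splits)
    have "chain ((\<lambda>(p, q). (p, q z)) ` C) (- b) b (- b') b'"
      using C coeffs bb B \<open>B \<le> b\<close> \<open>B' \<le> b'\<close> by (intro closed_family_chain) auto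
    from chain_realize[OF this bb(1,2)] obtain y where "agree ((\<lambda>(p, q). (p, q z)) ` C) x y" by blast
    then have "\<forall>(p, q)\<in>F. same_sign (poly p x) (poly (q z) y)"
      using C(2) unfolding agree_def by fastforce
    then show ?thesis by blast
  qed
  show ?thesis
    by (rule exI[of _ G], intro conjI finG GD allI impI) (rule real)
qed

section \<open>Polynomial functions on a real affine space\<close>

text \<open>This stands for the polynomial ring in \<open>n\<close> variables: a pair is a
  polynomial known only through its value at the point \<open>y\<close> over \<open>'b\<close> and
  through its function on real space. When \<open>y\<close> lists generators of an algebra, the
  pairs \<open>(0, w)\<close> are the relations of that algebra.\<close>

inductive_set polyfun ::
  "(real \<Rightarrow> 'b::comm_ring_1) \<Rightarrow> (nat \<Rightarrow> 'b) \<Rightarrow> nat \<Rightarrow> ('b \<times> ((nat \<Rightarrow> real) \<Rightarrow> real)) set"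
  for e y n where
  const: "(e r, \<lambda>_. r) \<in> polyfun e y n"
| var: "i < n \<Longrightarrow> (y i, \<lambda>z. z i) \<in> polyfun e y n"
| diff: "(a, u) \<in> polyfun e y n \<Longrightarrow> (b, v) \<in> polyfun e y n \<Longrightarrow> (a - b, \<lambda>z. u z - v z) \<in> polyfun e y n"
| mult: "(a, u) \<in> polyfun e y n \<Longrightarrow> (b, v) \<in> polyfun e y n \<Longrightarrow> (a * b, \<lambda>z. u z * v z) \<in> polyfun e y n"

definition real_ring_hom :: "(real \<Rightarrow> 'b::comm_ring_1) \<Rightarrow> bool" where
  "real_ring_hom e \<longleftrightarrow> e 1 = 1 \<and> (\<forall>r s. e (r + s) = e r + e s) \<and> (\<forall>r s. e (r * s) = e r * e s)"

lemma polyfun_depends: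
  "(c, w) \<in> polyfun e y n \<Longrightarrow> (\<And>i. i < n \<Longrightarrow> z i = z' i) \<Longrightarrow> w z = w z'"
  by (induction c w rule: polyfun.induct) auto

lemma pair_ring_polyfun:
  fixes y :: "nat \<Rightarrow> 'b::idom"
  assumes "real_ring_hom e"
  shows "pair_ring (polyfun e y n)"
proof
  show "(1, \<lambda>_. 1) \<in> polyfun e y n"
    using polyfun.const[of e 1] assms by (simp add: real_ring_hom_def)
qed (auto intro: polyfun.diff polyfun.mult)

text \<open>A positive real is a square and a unit, so its image is a nonzero square; preservation
  of order is automatic.\<close>

lemma real_ring_hom_same_sign:
  fixes e :: "real \<Rightarrow> 'k::linordered_field"
  assumes e: "real_ring_hom e"
  shows "same_sign (e r) r"
proof -
  have e0: "e 0 = 0" using e unfolding real_ring_hom_def by (metis add_cancel_right_left)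
  have neg: "e (- r) = - e r" for r
  proof -
    have "e (r + - r) = e r + e (- r)" using e unfolding real_ring_hom_def by blast
    then show ?thesis using e0 by (simp add: add_eq_0_iff)
  qed
  have pos: "e r > 0" if "r > 0" for r
  proof -
    have "e (sqrt r * sqrt r) = e (sqrt r) * e (sqrt r)" "e (r * inverse r) = e r * e (inverse r)"
      using e unfolding real_ring_hom_def by blast+
    then have "e r = e (sqrt r) * e (sqrt r)" "e r * e (inverse r) = 1"
      using that e unfolding real_ring_hom_def by auto
    then show ?thesis by (metis mult_zero_left not_square_less_zero zero_neq_one linorder_neqE_linordered_idom)
  qed
  show ?thesis
  proof (cases r "0::real" rule: linorder_cases)
    case less
    then show ?thesis using pos[of "- r"] by (intro same_sign_neg) (simp_all add: neg)
  next
    case equal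
    then show ?thesis by (simp add: e0 same_sign_def)
  next
    case greater
    then show ?thesis using pos by (intro same_sign_pos)
  qed
qed

lemma polyfun_0:
  assumes "real_ring_hom e" "(c, w) \<in> polyfun e y 0"
  shows "\<exists>r. c = e r \<and> w = (\<lambda>_. r)"
  using assms(2)
proof (induction c w rule: polyfun.induct)
  case (diff a u b v)
  then obtain r s where "a = e r" "u = (\<lambda>_. r)" "b = e s" "v = (\<lambda>_. s)" by blast
  moreover have "e (r - s + s) = e (r - s) + e s" using assms(1) unfolding real_ring_hom_def by blast
  ultimately show ?case by (intro exI[of _ "r - s"]) (simp add: algebra_simps)
next
  case (mult a u b v)
  then show ?case using assms(1) unfolding real_ring_hom_def by metis
qed auto

lemma polyfun_Suc:
  fixes y :: "nat \<Rightarrow> 'b::idom"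
  assumes e: "real_ring_hom e" and "(c, w) \<in> polyfun e y (Suc n)"
  shows "\<exists>(p, q)\<in>pair_ring.poly_pairs (polyfun e y n). c = poly p (y n) \<and> (\<forall>z. w z = poly (q z) (z n))"
proof -
  interpret pair_ring "polyfun e y n" by (rule pair_ring_polyfun[OF e])
  from assms(2) show ?thesis
  proof (induction c w rule: polyfun.induct)
    case (const r)
    then show ?case by (intro bexI[OF _ poly_pairs_const[OF polyfun.const[of e r]]]) simp
  next
    case (var i)
    show ?case
    proof (cases "i = n")
      case True
      then show ?thesis by (intro bexI[OF _ poly_pairs_X]) simp
    next
      case False
      with var have "i < n" by simp
      then show ?thesis by (intro bexI[OF _ poly_pairs_const[OF polyfun.var[of i n y e]]]) simp
    qed
  next
    case (diff a u b v)
    then obtain p q f g where "(p, q) \<in> poly_pairs" "a = poly p (y n)" "\<forall>z. u z = poly (q z) (z n)"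
      "(f, g) \<in> poly_pairs" "b = poly f (y n)" "\<forall>z. v z = poly (g z) (z n)" by blast
    then show ?case by (intro bexI[OF _ poly_pairs_diff[of p q f g]]) auto
  next
    case (mult a u b v)
    then obtain p q f g where "(p, q) \<in> poly_pairs" "a = poly p (y n)" "\<forall>z. u z = poly (q z) (z n)"
      "(f, g) \<in> poly_pairs" "b = poly f (y n)" "\<forall>z. v z = poly (g z) (z n)" by blast
    then show ?case by (intro bexI[OF _ poly_pairs_mult[of p q f g]]) auto
  qed
qed

text \<open>The coefficient pairs left by eliminating the last variable are polynomial pairs in
  fewer variables. The induction hypothesis realises their signs at some \<open>z\<close>, and the
  elimination then supplies the last coordinate. Without variables, all values are images of real
  constants.\<close>

theorem polyfun_realize:
  fixes y :: "nat \<Rightarrow> 'k::real_closed_field"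
  assumes e: "real_ring_hom e" and "finite G" "G \<subseteq> polyfun e y n"
  shows "\<exists>z. \<forall>(c, w)\<in>G. same_sign c (w z)"
  using assms(2,3)
proof (induction n arbitrary: G)
  case 0
  have "same_sign c (w z)" if "(c, w) \<in> G" for c w z
  proof -
    have "(c, w) \<in> polyfun e y 0" using 0 that by blast
    from polyfun_0[OF e this] show ?thesis using real_ring_hom_same_sign[OF e] by auto
  qed
  then show ?case by blast
next
  case (Suc n)
  interpret pair_ring "polyfun e y n" by (rule pair_ring_polyfun[OF e])
  have "\<forall>g\<in>G. \<exists>h. h \<in> poly_pairs \<and> fst g = poly (fst h) (y n) \<and> (\<forall>z. snd g z = poly (snd h z) (z n))"
    using polyfun_Suc[OF e] Suc.prems(2) by fastforce
  then obtain H where H: "\<And>g. g \<in> G \<Longrightarrow> H g \<in> poly_pairs" "\<And>g. g \<in> G \<Longrightarrow> fst g = poly (fst (H g)) (y n)"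
    "\<And>g z. g \<in> G \<Longrightarrow> snd g z = poly (snd (H g) z) (z n)" by metis
  have "finite (H ` G)" "H ` G \<subseteq> poly_pairs" using Suc.prems(1) H(1) by auto
  from sign_elimination[OF pair_ring_axioms this]
  obtain G' where G': "finite G'" "G' \<subseteq> polyfun e y n"
    "\<forall>z. (\<forall>(c, w)\<in>G'. same_sign c (w z)) \<longrightarrow>
      (\<forall>x. \<exists>t. \<forall>(p, q)\<in>H ` G. same_sign (poly p x) (poly (q z) t))" by blast
  from Suc.IH[OF G'(1,2)] obtain z where z: "\<forall>(c, w)\<in>G'. same_sign c (w z)" by blast
  with G'(3) obtain t where t: "\<forall>(p, q)\<in>H ` G. same_sign (poly p (y n)) (poly (q z) t)" by blast
  have "same_sign (fst g) (snd g (z(n := t)))" if g: "g \<in> G" for g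
  proof -
    \<comment> \<open>The coefficients involve only the first \<open>n\<close> coordinates, so
      overwriting coordinate \<open>n\<close> leaves them unchanged.\<close>
    have "snd (H g) (z(n := t)) = snd (H g) z"
    proof (rule poly_eqI)
      fix i
      have "(coeff (fst (H g)) i, \<lambda>z. coeff (snd (H g) z) i) \<in> polyfun e y n"
        using H(1)[OF g] by (intro poly_pairs_coeff) simp
      from polyfun_depends[OF this, of "z(n := t)" z]
      show "coeff (snd (H g) (z(n := t))) i = coeff (snd (H g) z) i" by simp
    qed
    moreover have "same_sign (poly (fst (H g)) (y n)) (poly (snd (H g) z) t)"
      using bspec[OF t imageI[OF g]] by (simp add: case_prod_beta)
    ultimately show ?thesis using H(2,3)[OF g] by simp
  qed
  then show ?case by (intro exI[of _ "z(n := t)"]) (auto simp del: fun_upd_apply)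
qed

section \<open>Hilbert's basis theorem for subrings\<close>

definition is_subring :: "'a::comm_ring_1 set \<Rightarrow> bool" where
  "is_subring R \<longleftrightarrow> 1 \<in> R \<and> (\<forall>a\<in>R. \<forall>b\<in>R. a - b \<in> R \<and> a * b \<in> R)"

lemma is_subringD:
  assumes "is_subring R"
  shows "1 \<in> R" "0 \<in> R" "a \<in> R \<Longrightarrow> b \<in> R \<Longrightarrow> a - b \<in> R" "a \<in> R \<Longrightarrow> b \<in> R \<Longrightarrow> a * b \<in> R"
    "a \<in> R \<Longrightarrow> - a \<in> R" "a \<in> R \<Longrightarrow> b \<in> R \<Longrightarrow> a + b \<in> R" "a \<in> R \<Longrightarrow> a ^ n \<in> R"
proof -
  show 1: "1 \<in> R" and d: "\<And>a b. a \<in> R \<Longrightarrow> b \<in> R \<Longrightarrow> a - b \<in> R" and m: "\<And>a b. a \<in> R \<Longrightarrow> b \<in> R \<Longrightarrow> a * b \<in> R"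
    using assms by (auto simp: is_subring_def)
  show 0: "0 \<in> R" using d[OF 1 1] by simp
  show n: "- a \<in> R" if "a \<in> R" for a using d[OF 0 that] by simp
  show "a + b \<in> R" if "a \<in> R" "b \<in> R" using d[OF that(1) n[OF that(2)]] by simp
  show "a ^ n \<in> R" if "a \<in> R" using 1 m that by (induction n) auto
qed

definition ideal_in :: "'a::comm_ring_1 set \<Rightarrow> 'a set \<Rightarrow> bool" where
  "ideal_in R I \<longleftrightarrow> I \<subseteq> R \<and> 0 \<in> I \<and> (\<forall>a\<in>I. \<forall>b\<in>I. a + b \<in> I) \<and> (\<forall>r\<in>R. \<forall>a\<in>I. r * a \<in> I)"

text \<open>Finite generation is expressed through the ideals containing \<open>S\<close>, which
  avoids linear combinations. Everything is relative to a subset \<open>R\<close> and not to a type,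
  because the ring grows with the number of variables.\<close>

definition noetherian_in :: "'a::comm_ring_1 set \<Rightarrow> bool" where
  "noetherian_in R \<longleftrightarrow> (\<forall>I. ideal_in R I \<longrightarrow>
    (\<exists>S. finite S \<and> S \<subseteq> I \<and> (\<forall>J. ideal_in R J \<longrightarrow> S \<subseteq> J \<longrightarrow> I \<subseteq> J)))"

definition polys_over :: "'a::comm_ring_1 set \<Rightarrow> 'a poly set" where
  "polys_over R = {p. \<forall>i. coeff p i \<in> R}"

definition adjoin :: "'a::comm_ring_1 set \<Rightarrow> 'a \<Rightarrow> 'a set" where
  "adjoin R x = (\<lambda>p. poly p x) ` polys_over R"

lemma sum_in_subring: "is_subring R \<Longrightarrow> (\<And>i. i \<in> A \<Longrightarrow> f i \<in> R) \<Longrightarrow> sum f A \<in> R"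
  by (induction A rule: infinite_finite_induct) (auto intro: is_subringD)

lemma polys_over_diff: "is_subring R \<Longrightarrow> p \<in> polys_over R \<Longrightarrow> q \<in> polys_over R \<Longrightarrow> p - q \<in> polys_over R"
  and polys_over_add: "is_subring R \<Longrightarrow> p \<in> polys_over R \<Longrightarrow> q \<in> polys_over R \<Longrightarrow> p + q \<in> polys_over R"
  and polys_over_mult: "is_subring R \<Longrightarrow> p \<in> polys_over R \<Longrightarrow> q \<in> polys_over R \<Longrightarrow> p * q \<in> polys_over R"
  and polys_over_monom: "is_subring R \<Longrightarrow> c \<in> R \<Longrightarrow> monom c n \<in> polys_over R"
  and polys_over_smult: "is_subring R \<Longrightarrow> c \<in> R \<Longrightarrow> p \<in> polys_over R \<Longrightarrow> smult c p \<in> polys_over R"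
  by (auto simp: polys_over_def coeff_mult intro!: sum_in_subring is_subringD)

lemma is_subring_adjoin:
  assumes "is_subring R"
  shows "is_subring (adjoin R x)"
  unfolding is_subring_def
proof (intro conjI ballI)
  show "1 \<in> adjoin R x" unfolding adjoin_def
    by (rule rev_image_eqI[OF polys_over_monom[OF assms is_subringD(1)[OF assms], of 0]]) (simp add: poly_monom)
  fix a b assume "a \<in> adjoin R x" "b \<in> adjoin R x"
  then obtain p q where "a = poly p x" "p \<in> polys_over R" "b = poly q x" "q \<in> polys_over R"
    unfolding adjoin_def by blast
  then show "a - b \<in> adjoin R x" "a * b \<in> adjoin R x"
    unfolding adjoin_def using polys_over_diff[OF assms, of p q] polys_over_mult[OF assms, of p q]
    by (metis imageI poly_diff, metis imageI poly_mult)
qed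

lemma adjoin_least:
  assumes "is_subring R'" "R \<subseteq> R'" "x \<in> R'"
  shows "adjoin R x \<subseteq> R'"
  using assms by (auto simp: adjoin_def polys_over_def poly_altdef intro!: sum_in_subring is_subringD)

lemma subset_adjoin: "is_subring R \<Longrightarrow> R \<subseteq> adjoin R x"
proof
  fix c assume "is_subring R" "c \<in> R"
  then show "c \<in> adjoin R x" unfolding adjoin_def
    by (intro rev_image_eqI[OF polys_over_monom[of R c 0]]) (auto simp: poly_monom)
qed

lemma adjoin_self: "is_subring R \<Longrightarrow> x \<in> adjoin R x"
  unfolding adjoin_def
  by (rule rev_image_eqI[OF polys_over_monom[OF _ is_subringD(1), of R 1]]) (auto simp: poly_monom)

text \<open>Elements of \<open>adjoin R x\<close> have no degree of their own, so leading
  coefficients are taken from representing polynomials. Allowing degree at most \<open>d\<close>,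
  and hence also the coefficient 0, makes this an ideal that increases with
  \<open>d\<close>.\<close>

definition lead_set :: "'a::comm_ring_1 set \<Rightarrow> 'a \<Rightarrow> 'a set \<Rightarrow> nat \<Rightarrow> 'a set" where
  "lead_set R x J d = {coeff p d | p. p \<in> polys_over R \<and> degree p \<le> d \<and> poly p x \<in> J}"

lemma ideal_in_lead_set:
  assumes R: "is_subring R" and J: "ideal_in (adjoin R x) J"
  shows "ideal_in R (lead_set R x J d)"
  unfolding ideal_in_def
proof (intro conjI ballI)
  show "lead_set R x J d \<subseteq> R" by (auto simp: lead_set_def polys_over_def)
  show "0 \<in> lead_set R x J d" using R J
    by (auto simp: lead_set_def polys_over_def ideal_in_def is_subringD intro!: exI[of _ 0])
  fix a assume "a \<in> lead_set R x J d"
  then obtain p where p: "a = coeff p d" "p \<in> polys_over R" "degree p \<le> d" "poly p x \<in> J"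
    by (auto simp: lead_set_def)
  { fix b assume "b \<in> lead_set R x J d"
    then obtain q where q: "b = coeff q d" "q \<in> polys_over R" "degree q \<le> d" "poly q x \<in> J"
      by (auto simp: lead_set_def)
    have "poly (p + q) x \<in> J" using J p q by (auto simp: ideal_in_def)
    then show "a + b \<in> lead_set R x J d"
      unfolding lead_set_def using p q polys_over_add[OF R p(2) q(2)] degree_add_le[OF p(3) q(3)]
      by (intro CollectI exI[of _ "p + q"]) auto }
  { fix r assume r: "r \<in> R"
    then have "r \<in> adjoin R x" using subset_adjoin[OF R] by blast
    then have "poly (smult r p) x \<in> J" using J p by (auto simp: ideal_in_def)
    then show "r * a \<in> lead_set R x J d"
      unfolding lead_set_def using p r polys_over_smult[OF R r p(2)] order_trans[OF degree_smult_le p(3), of r]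
      by (intro CollectI exI[of _ "smult r p"]) auto }
qed

lemma monom_times_in_ideal:
  assumes R: "is_subring R" and J: "ideal_in (adjoin R x) J" and "poly p x \<in> J"
  shows "poly (monom 1 k * p) x \<in> J"
proof -
  have "x ^ k \<in> adjoin R x" using is_subringD(7)[OF is_subring_adjoin[OF R] adjoin_self[OF R]] .
  then show ?thesis using J assms(3) by (simp add: ideal_in_def poly_monom)
qed

lemma lead_set_mono:
  assumes R: "is_subring R" and J: "ideal_in (adjoin R x) J" and "d \<le> e"
  shows "lead_set R x J d \<subseteq> lead_set R x J e"
proof
  fix c assume "c \<in> lead_set R x J d"
  then obtain p where p: "c = coeff p d" "p \<in> polys_over R" "degree p \<le> d" "poly p x \<in> J"
    by (auto simp: lead_set_def)
  have "degree (monom 1 (e - d) * p) \<le> (e - d) + d"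
    by (rule order_trans[OF degree_mult_le add_mono[OF degree_monom_le p(3)]])
  moreover have "coeff (monom 1 (e - d) * p) e = c"
    using assms(3) p(1) by (simp add: coeff_monom_mult)
  ultimately show "c \<in> lead_set R x J e"
    unfolding lead_set_def using assms(3) monom_times_in_ideal[OF R J p(4), of "e - d"]
      polys_over_mult[OF R polys_over_monom[OF R is_subringD(1)[OF R]] p(2)]
    by (intro CollectI exI[of _ "monom 1 (e - d) * p"]) auto
qed

text \<open>The leading ideals increase with the degree and become stationary at some
  \<open>M\<close>, since their union is finitely generated. Polynomials realising generators of the
  leading ideals up to \<open>M\<close> then generate \<open>I\<close>: leading terms are removed
  one after another.\<close>

theorem Hilbert_basis:
  assumes R: "is_subring R" and N: "noetherian_in R"
  shows "noetherian_in (adjoin R x)"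
  unfolding noetherian_in_def
proof (intro allI impI)
  fix I assume I: "ideal_in (adjoin R x) I"
  define U where "U = (\<Union>d. lead_set R x I d)"
  have "ideal_in R U"
    unfolding ideal_in_def
  proof (intro conjI ballI)
    show "U \<subseteq> R" "0 \<in> U" using ideal_in_lead_set[OF R I] unfolding U_def ideal_in_def by blast+
    fix a assume "a \<in> U"
    then obtain d where d: "a \<in> lead_set R x I d" by (auto simp: U_def)
    { fix b assume "b \<in> U"
      then obtain d' where d': "b \<in> lead_set R x I d'" by (auto simp: U_def)
      have "a \<in> lead_set R x I (max d d')" "b \<in> lead_set R x I (max d d')"
        using d d' lead_set_mono[OF R I, of d "max d d'"] lead_set_mono[OF R I, of d' "max d d'"] by auto
      then show "a + b \<in> U" using ideal_in_lead_set[OF R I] by (auto simp: U_def ideal_in_def) }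
    show "r * a \<in> U" if "r \<in> R" for r
      using d that ideal_in_lead_set[OF R I] unfolding U_def ideal_in_def by blast
  qed
  with N obtain S where S: "finite S" "S \<subseteq> U" "\<And>J. ideal_in R J \<Longrightarrow> S \<subseteq> J \<Longrightarrow> U \<subseteq> J"
    unfolding noetherian_in_def by meson
  have "\<exists>M. S \<subseteq> lead_set R x I M"
    using S(1,2)
  proof (induction S rule: finite_induct)
    case (insert s S)
    then obtain M d where M: "S \<subseteq> lead_set R x I M" "s \<in> lead_set R x I d" by (auto simp: U_def)
    then have "insert s S \<subseteq> lead_set R x I (max M d)"
      using lead_set_mono[OF R I, of M "max M d"] lead_set_mono[OF R I, of d "max M d"] by auto
    then show ?case by blast
  qed simp
  then obtain M where M: "U \<subseteq> lead_set R x I M" using S(3) ideal_in_lead_set[OF R I] by blast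
  have "\<forall>d. \<exists>S. finite S \<and> S \<subseteq> lead_set R x I d \<and> (\<forall>J. ideal_in R J \<longrightarrow> S \<subseteq> J \<longrightarrow> lead_set R x I d \<subseteq> J)"
    using N ideal_in_lead_set[OF R I] unfolding noetherian_in_def by blast
  then obtain T where T: "\<And>d. finite (T d)" "\<And>d. T d \<subseteq> lead_set R x I d"
    "\<And>d J. ideal_in R J \<Longrightarrow> T d \<subseteq> J \<Longrightarrow> lead_set R x I d \<subseteq> J" by metis
  have "\<forall>d s. \<exists>p. s \<in> T d \<longrightarrow> p \<in> polys_over R \<and> degree p \<le> d \<and> poly p x \<in> I \<and> s = coeff p d"
    using T(2) unfolding lead_set_def by blast
  then obtain P where P: "\<And>d s. s \<in> T d \<Longrightarrow>
    P d s \<in> polys_over R \<and> degree (P d s) \<le> d \<and> poly (P d s) x \<in> I \<and> s = coeff (P d s) d" by metis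
  define V where "V = (\<Union>d\<le>M. (\<lambda>s. poly (P d s) x) ` T d)"
  have "finite V" unfolding V_def using T(1) by auto
  moreover have "V \<subseteq> I" unfolding V_def using P by auto
  moreover have "I \<subseteq> J'" if J': "ideal_in (adjoin R x) J'" "V \<subseteq> J'" for J'
  proof -
    \<comment> \<open>Intersecting with \<open>I\<close> puts the correcting term \<open>r\<close>
      below into \<open>I\<close>, so that the induction hypothesis applies to
      \<open>p - r\<close>.\<close>
    define J where "J = J' \<inter> I"
    have J: "ideal_in (adjoin R x) J" using J'(1) I by (auto simp: J_def ideal_in_def)
    have VJ: "V \<subseteq> J" using J'(2) \<open>V \<subseteq> I\<close> by (auto simp: J_def)
    have lead: "lead_set R x I d \<subseteq> lead_set R x J d" if "d \<le> M" for d
    proof (rule T(3)[OF ideal_in_lead_set[OF R J]])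
      show "T d \<subseteq> lead_set R x J d"
      proof
        fix s assume s: "s \<in> T d"
        then have "poly (P d s) x \<in> V" using that by (auto simp: V_def)
        then show "s \<in> lead_set R x J d"
          unfolding lead_set_def using P[OF s] VJ by (intro CollectI exI[of _ "P d s"]) auto
      qed
    qed
    have "poly p x \<in> J" if "p \<in> polys_over R" "degree p \<le> d" "poly p x \<in> I" for d p
      using that
    proof (induction d arbitrary: p)
      case 0
      then have "coeff p 0 \<in> lead_set R x J 0" using lead[of 0] by (auto simp: lead_set_def)
      then obtain p2 where p2: "coeff p 0 = coeff p2 0" "degree p2 \<le> 0" "poly p2 x \<in> J"
        by (auto simp: lead_set_def)
      then have "p = p2" using 0 by (metis degree_eq_zeroE le_zero_eq coeff_pCons_0)
      then show ?case using p2 by simp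
    next
      case (Suc d)
      \<comment> \<open>No new leading coefficients arise beyond degree \<open>M\<close>, so a
        polynomial of degree at most \<open>M\<close>, shifted by a power of the variable, can
        cancel the leading term.\<close>
      define e where "e = min (Suc d) M"
      have "coeff p (Suc d) \<in> lead_set R x I (Suc d)" using Suc.prems by (auto simp: lead_set_def)
      then have "coeff p (Suc d) \<in> lead_set R x I e"
        unfolding e_def using M by (cases "Suc d \<le> M") (auto simp: U_def min_def)
      then have "coeff p (Suc d) \<in> lead_set R x J e" using lead[of e] by (auto simp: e_def)
      then obtain p2 where p2: "coeff p (Suc d) = coeff p2 e" "p2 \<in> polys_over R" "degree p2 \<le> e" "poly p2 x \<in> J"
        by (auto simp: lead_set_def)
      define r where "r = monom 1 (Suc d - e) * p2"
      have rJ: "poly r x \<in> J" unfolding r_def by (rule monom_times_in_ideal[OF R J p2(4)])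
      have rR: "r \<in> polys_over R" unfolding r_def
        by (intro polys_over_mult[OF R] polys_over_monom[OF R] is_subringD(1)[OF R] p2)
      have ed: "e \<le> Suc d" by (simp add: e_def)
      have "degree r \<le> (Suc d - e) + e" unfolding r_def
        by (rule order_trans[OF degree_mult_le add_mono[OF degree_monom_le p2(3)]])
      then have dr: "degree r \<le> Suc d" using ed by simp
      have cr: "coeff r (Suc d) = coeff p (Suc d)" unfolding r_def using p2(1) ed by (simp add: coeff_monom_mult)
      have "degree (p - r) \<le> d"
      proof (rule degree_le, intro allI impI)
        fix i assume "d < i"
        then show "coeff (p - r) i = 0"
          using cr dr Suc.prems(2) by (cases "i = Suc d") (auto simp: coeff_eq_0)
      qed
      moreover have "poly (p - r) x \<in> I"
      proof -
        have "poly r x \<in> I" using rJ by (simp add: J_def)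
        then have "- 1 * poly r x \<in> I" using I is_subringD(1,5)[OF is_subring_adjoin[OF R]]
          unfolding ideal_in_def by blast
        then have "poly p x + - 1 * poly r x \<in> I" using I Suc.prems(3) unfolding ideal_in_def by blast
        then show ?thesis by simp
      qed
      ultimately have "poly (p - r) x \<in> J"
        using Suc.IH polys_over_diff[OF R Suc.prems(1) rR] by blast
      then have "poly (p - r) x + poly r x \<in> J" using J rJ unfolding ideal_in_def by blast
      then show ?case by simp
    qed
    then have "I \<subseteq> J" using I unfolding ideal_in_def adjoin_def by fastforce
    then show ?thesis by (auto simp: J_def)
  qed
  ultimately show "\<exists>S. finite S \<and> S \<subseteq> I \<and> (\<forall>J. ideal_in (adjoin R x) J \<longrightarrow> S \<subseteq> J \<longrightarrow> I \<subseteq> J)" by metis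
qed

lemma is_subring_polyfun:
  assumes "real_ring_hom e"
  shows "is_subring (snd ` polyfun e y n)"
  unfolding is_subring_def
proof (intro conjI ballI)
  show "1 \<in> snd ` polyfun e y n"
    by (rule rev_image_eqI[OF polyfun.const[of e 1]]) (simp add: one_fun_def)
  fix a b assume "a \<in> snd ` polyfun e y n" "b \<in> snd ` polyfun e y n"
  then obtain c d where "(c, a) \<in> polyfun e y n" "(d, b) \<in> polyfun e y n" by auto
  from polyfun.diff[OF this] polyfun.mult[OF this]
  show "a - b \<in> snd ` polyfun e y n" "a * b \<in> snd ` polyfun e y n"
    by (auto simp: fun_diff_def times_fun_def intro: rev_image_eqI)
qed

text \<open>The constants form a field, where one nonzero element generates any nonzero ideal; each
  further coordinate function is one adjoined element.\<close>

lemma noetherian_polyfun: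
  assumes e: "real_ring_hom e"
  shows "noetherian_in (snd ` polyfun e y n)"
proof (induction n)
  case 0
  have const: "\<exists>r. w = (\<lambda>_. r)" if "w \<in> snd ` polyfun e y 0" for w
    using polyfun_0[OF e] that by force
  show ?case
    unfolding noetherian_in_def
  proof (intro allI impI)
    fix I assume I: "ideal_in (snd ` polyfun e y 0) I"
    then have IR: "I \<subseteq> snd ` polyfun e y 0" by (simp add: ideal_in_def)
    show "\<exists>S. finite S \<and> S \<subseteq> I \<and> (\<forall>J. ideal_in (snd ` polyfun e y 0) J \<longrightarrow> S \<subseteq> J \<longrightarrow> I \<subseteq> J)"
    proof (cases "I \<subseteq> {0}")
      case True
      then show ?thesis by (intro exI[of _ "{}"]) (auto simp: ideal_in_def)
    next
      case False
      then obtain w where w: "w \<in> I" "w \<noteq> 0" by blast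
      obtain r where r: "w = (\<lambda>_. r)" using const[OF subsetD[OF IR w(1)]] by (elim exE)
      with w have "r \<noteq> 0" by (auto simp: zero_fun_def)
      have "I \<subseteq> J" if J: "ideal_in (snd ` polyfun e y 0) J" "w \<in> J" for J
      proof
        fix v assume v: "v \<in> I"
        obtain s where s: "v = (\<lambda>_. s)" using const[OF subsetD[OF IR v]] by (elim exE)
        have "(\<lambda>_. s / r) \<in> snd ` polyfun e y 0" by (rule rev_image_eqI[OF polyfun.const[of e "s / r"]]) simp
        then have "(\<lambda>_. s / r) * w \<in> J" using J unfolding ideal_in_def by blast
        then show "v \<in> J" using \<open>r \<noteq> 0\<close> by (simp add: r s times_fun_def)
      qed
      then show ?thesis using w by (intro exI[of _ "{w}"]) auto
    qed
  qed
next
  case (Suc n)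
  have mono: "polyfun e y n \<subseteq> polyfun e y (Suc n)"
  proof
    fix g assume "g \<in> polyfun e y n"
    moreover have "(c, w) \<in> polyfun e y (Suc n)" if "(c, w) \<in> polyfun e y n" for c w
      using that by (induction c w rule: polyfun.induct) (auto intro: polyfun.intros)
    ultimately show "g \<in> polyfun e y (Suc n)" by (cases g) simp
  qed
  let ?A = "adjoin (snd ` polyfun e y n) (\<lambda>z. z n)"
  have A: "is_subring ?A" by (rule is_subring_adjoin[OF is_subring_polyfun[OF e]])
  have sub: "snd ` polyfun e y n \<subseteq> ?A" by (rule subset_adjoin[OF is_subring_polyfun[OF e]])
  have "snd ` polyfun e y (Suc n) \<subseteq> ?A"
  proof
    fix w assume "w \<in> snd ` polyfun e y (Suc n)"
    then obtain c where "(c, w) \<in> polyfun e y (Suc n)" by auto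
    then show "w \<in> ?A"
    proof (induction c w rule: polyfun.induct)
      case (const r)
      then show ?case using sub polyfun.const[of e r y n] by force
    next
      case (var i)
      show ?case
      proof (cases "i = n")
        case True
        then show ?thesis using adjoin_self[OF is_subring_polyfun[OF e], of "\<lambda>z. z n"] by simp
      next
        case False
        with var have "i < n" by simp
        then show ?thesis using sub polyfun.var[of i n y e] by force
      qed
    next
      case (diff a u b v)
      then show ?case using is_subringD(3)[OF A, of u v] by (simp add: fun_diff_def)
    next
      case (mult a u b v)
      then show ?case using is_subringD(4)[OF A, of u v] by (simp add: times_fun_def)
    qed
  qed
  moreover have "?A \<subseteq> snd ` polyfun e y (Suc n)"
  proof (rule adjoin_least[OF is_subring_polyfun[OF e]])
    show "snd ` polyfun e y n \<subseteq> snd ` polyfun e y (Suc n)" using mono by blast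
    show "(\<lambda>z. z n) \<in> snd ` polyfun e y (Suc n)"
      by (rule rev_image_eqI[OF polyfun.var[of n "Suc n" y e]]) auto
  qed
  ultimately have "snd ` polyfun e y (Suc n) = ?A" by (rule subset_antisym)
  then show ?case using Hilbert_basis[OF is_subring_polyfun[OF e] Suc.IH] by simp
qed

section \<open>Prime cones\<close>

definition preordering_in :: "'a::comm_ring_1 set \<Rightarrow> 'a set \<Rightarrow> bool" where
  "preordering_in E T \<longleftrightarrow> T \<subseteq> E \<and> (\<forall>a\<in>T. \<forall>b\<in>T. a + b \<in> T \<and> a * b \<in> T) \<and> (\<forall>a\<in>E. a * a \<in> T)"

definition cone_ring :: "'a::comm_ring_1 set \<Rightarrow> 'a set" where
  "cone_ring P = {a. a \<in> P \<or> - a \<in> P}"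

definition cone_supp :: "'a::comm_ring_1 set \<Rightarrow> 'a set" where
  "cone_supp P = {a. a \<in> P \<and> - a \<in> P}"

text \<open>The ambient ring is not a parameter but is recovered as \<open>P\<close> together with
  its negatives. Inclusion of cones thus extends the underlying rings as well, which later lets
  Zorn's lemma enlarge ordered subrings of an algebraic closure.\<close>

definition prime_cone :: "'a::comm_ring_1 set \<Rightarrow> bool" where
  "prime_cone P \<longleftrightarrow> is_subring (cone_ring P) \<and> (\<forall>a\<in>P. \<forall>b\<in>P. a + b \<in> P \<and> a * b \<in> P) \<and> - 1 \<notin> P \<and>
    (\<forall>a\<in>cone_ring P. \<forall>b\<in>cone_ring P. a * b \<in> cone_supp P \<longrightarrow> a \<in> cone_supp P \<or> b \<in> cone_supp P)"

lemma preordering_adjoin: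
  assumes E: "is_subring E" and T: "preordering_in E T" and a: "a \<in> E"
  shows "preordering_in E {t + a * u |t u. t \<in> T \<and> u \<in> T}"
    and "T \<subseteq> {t + a * u |t u. t \<in> T \<and> u \<in> T}"
    and "a \<in> {t + a * u |t u. t \<in> T \<and> u \<in> T}"
proof -
  note Ed = is_subringD[OF E]
  have T0: "0 \<in> T" and T1: "1 \<in> T" using T Ed(1,2) unfolding preordering_in_def by force+
  have TE: "t \<in> E" if "t \<in> T" for t using T that by (auto simp: preordering_in_def)
  have Ta: "t + u \<in> T" and Tm: "t * u \<in> T" if "t \<in> T" "u \<in> T" for t u
    using T that by (auto simp: preordering_in_def)
  have aa: "a * a \<in> T" using T a by (auto simp: preordering_in_def)
  show sub: "T \<subseteq> {t + a * u |t u. t \<in> T \<and> u \<in> T}"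
  proof
    fix t assume "t \<in> T"
    then show "t \<in> {t + a * u |t u. t \<in> T \<and> u \<in> T}"
      using T0 by (intro CollectI exI[of _ t] exI[of _ 0]) simp
  qed
  show "a \<in> {t + a * u |t u. t \<in> T \<and> u \<in> T}"
    using T0 T1 by (intro CollectI exI[of _ 0] exI[of _ 1]) simp
  show "preordering_in E {t + a * u |t u. t \<in> T \<and> u \<in> T}"
    unfolding preordering_in_def
  proof (intro conjI ballI)
    show "{t + a * u |t u. t \<in> T \<and> u \<in> T} \<subseteq> E" using TE a by (auto intro!: Ed)
    show "b * b \<in> {t + a * u |t u. t \<in> T \<and> u \<in> T}" if "b \<in> E" for b
      using T that sub by (auto simp: preordering_in_def)
    fix x y assume "x \<in> {t + a * u |t u. t \<in> T \<and> u \<in> T}" "y \<in> {t + a * u |t u. t \<in> T \<and> u \<in> T}"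
    then obtain t u v w where *: "x = t + a * u" "y = v + a * w" "t \<in> T" "u \<in> T" "v \<in> T" "w \<in> T" by blast
    have "x + y = (t + v) + a * (u + w)" using * by (simp add: algebra_simps)
    then show "x + y \<in> {t + a * u |t u. t \<in> T \<and> u \<in> T}"
      by (intro CollectI exI[of _ "t + v"] exI[of _ "u + w"]) (simp add: Ta *(3-6))
    have "x * y = (t * v + (a * a) * (u * w)) + a * (t * w + u * v)" using * by (simp add: algebra_simps)
    then show "x * y \<in> {t + a * u |t u. t \<in> T \<and> u \<in> T}"
      by (intro CollectI exI[of _ "t * v + (a * a) * (u * w)"] exI[of _ "t * w + u * v"])
        (simp add: Ta Tm aa *(3-6))
  qed
qed

lemma preordering_Union_chain:
  assumes "C \<noteq> {}" "\<And>T. T \<in> C \<Longrightarrow> preordering_in E T"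
    and chain: "\<And>T U. T \<in> C \<Longrightarrow> U \<in> C \<Longrightarrow> T \<subseteq> U \<or> U \<subseteq> T"
  shows "preordering_in E (\<Union>C)"
  unfolding preordering_in_def
proof (intro conjI ballI)
  show "\<Union>C \<subseteq> E" using assms(2) unfolding preordering_in_def by blast
  show "a * a \<in> \<Union>C" if "a \<in> E" for a using assms(1,2) that by (auto simp: preordering_in_def)
  fix a b assume "a \<in> \<Union>C" "b \<in> \<Union>C"
  then obtain T where "T \<in> C" "a \<in> T" "b \<in> T" using chain by blast
  then have "a + b \<in> T" "a * b \<in> T" using assms(2)[of T] by (auto simp: preordering_in_def)
  with \<open>T \<in> C\<close> show "a + b \<in> \<Union>C" "a * b \<in> \<Union>C" by auto
qed

text \<open>For a maximal preordering \<open>M\<close> avoiding the negatives of \<open>S\<close>,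
  every \<open>a\<close> outside \<open>M\<close> admits an identity \<open>- s = t + a * u\<close>.
  Multiplying two such identities puts some \<open>- (s * s')\<close> into \<open>M\<close>, a
  contradiction. Used for \<open>a\<close> and \<open>- a\<close> this gives totality, used for
  \<open>- a'\<close> and \<open>- b'\<close> it gives primality of the support.\<close>

theorem prime_cone_exists:
  assumes E: "is_subring E" and T: "preordering_in E T"
    and S: "1 \<in> S" "\<And>s. s \<in> S \<Longrightarrow> \<exists>r\<in>E. s = r * r" "\<And>s t. s \<in> S \<Longrightarrow> t \<in> S \<Longrightarrow> s * t \<in> S"
    and disj: "\<And>s. s \<in> S \<Longrightarrow> - s \<notin> T"
  shows "\<exists>P. T \<subseteq> P \<and> prime_cone P \<and> cone_ring P = E \<and> (\<forall>s\<in>S. - s \<notin> P)"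
proof -
  define A where "A = {U. preordering_in E U \<and> T \<subseteq> U \<and> (\<forall>s\<in>S. - s \<notin> U)}"
  have "\<exists>M\<in>A. \<forall>X\<in>A. M \<subseteq> X \<longrightarrow> X = M"
  proof (rule subset_Zorn_nonempty)
    show "A \<noteq> {}" using T disj by (auto simp: A_def)
    fix C assume C: "C \<noteq> {}" "subset.chain A C"
    then have "C \<subseteq> A" and ch: "\<And>T U. T \<in> C \<Longrightarrow> U \<in> C \<Longrightarrow> T \<subseteq> U \<or> U \<subseteq> T"
      by (auto simp: subset.chain_def)
    then have "preordering_in E (\<Union>C)"
      using C(1) by (intro preordering_Union_chain) (auto simp: A_def)
    then show "\<Union>C \<in> A" using C(1) \<open>C \<subseteq> A\<close> by (auto simp: A_def)
  qed
  then obtain M where M: "preordering_in E M" "T \<subseteq> M" "\<And>s. s \<in> S \<Longrightarrow> - s \<notin> M"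
    and max: "\<And>X. X \<in> A \<Longrightarrow> M \<subseteq> X \<Longrightarrow> X = M" by (auto simp: A_def)
  note Ed = is_subringD[OF E]
  have ME: "t \<in> E" if "t \<in> M" for t using M(1) that by (auto simp: preordering_in_def)
  have Ma: "t + u \<in> M" and Mm: "t * u \<in> M" if "t \<in> M" "u \<in> M" for t u
    using M(1) that by (auto simp: preordering_in_def)
  have Msq: "a * a \<in> M" if "a \<in> E" for a using M(1) that by (auto simp: preordering_in_def)
  have M0: "0 \<in> M" using Msq[OF Ed(2)] by simp
  have SM: "s \<in> M" if "s \<in> S" for s using S(2)[OF that] Msq by auto
  have ext: "\<exists>s\<in>S. \<exists>t\<in>M. \<exists>u\<in>M. - s = t + a * u" if a: "a \<in> E" "a \<notin> M" for a
  proof (rule ccontr)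
    assume n: "\<not> ?thesis"
    let ?X = "{t + a * u |t u. t \<in> M \<and> u \<in> M}"
    have "?X \<in> A" using preordering_adjoin[OF E M(1) a(1)] M(2) n by (auto simp: A_def)
    with max preordering_adjoin(2,3)[OF E M(1) a(1)] a(2) show False by blast
  qed
  have total: "a \<in> M \<or> - a \<in> M" if a: "a \<in> E" for a
  proof (rule ccontr)
    assume n: "\<not> ?thesis"
    obtain s t u where 1: "s \<in> S" "t \<in> M" "u \<in> M" "- s = t + a * u" using ext[OF a] n by blast
    obtain s' t' u' where 2: "s' \<in> S" "t' \<in> M" "u' \<in> M" "- s' = t' + - a * u'"
      using ext[OF Ed(5)[OF a]] n by blast
    have e: "a * u = - (s + t)" "a * u' = s' + t'" using 1(4) 2(4) by (simp_all add: algebra_simps)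
    have "- (s * s') = s * t' + t * s' + t * t' + a * a * (u * u')"
    proof -
      have "a * a * (u * u') = (a * u) * (a * u')" by (simp add: algebra_simps)
      also have "\<dots> = - ((s + t) * (s' + t'))" unfolding e by (simp add: algebra_simps)
      finally show ?thesis by (simp add: algebra_simps)
    qed
    also have "\<dots> \<in> M" by (simp add: Ma Mm SM Msq a 1(1-3) 2(1-3))
    finally show False using M(3) S(3) 1(1) 2(1) by blast
  qed
  have ring: "cone_ring M = E"
    unfolding cone_ring_def using total ME Ed(5) by (metis (no_types, lifting) minus_minus mem_Collect_eq subsetI subset_antisym)
  have prime: "a \<in> cone_supp M \<or> b \<in> cone_supp M" if "a \<in> E" "b \<in> E" "a * b \<in> cone_supp M" for a b
  proof (rule ccontr)
    assume n: "\<not> ?thesis"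
    \<comment> \<open>An element outside the support has itself or its negative outside
      \<open>M\<close>; the sign is chosen such that \<open>- a'\<close> is outside. Changing signs
      keeps the product in the support.\<close>
    have "\<exists>a'. (a' = a \<or> a' = - a) \<and> a' \<in> E \<and> - a' \<notin> M"
      using n that(1) Ed(5) by (auto simp: cone_supp_def)
    then obtain a' where a': "a' = a \<or> a' = - a" "a' \<in> E" "- a' \<notin> M" by blast
    have "\<exists>b'. (b' = b \<or> b' = - b) \<and> b' \<in> E \<and> - b' \<notin> M"
      using n that(2) Ed(5) by (auto simp: cone_supp_def)
    then obtain b' where b': "b' = b \<or> b' = - b" "b' \<in> E" "- b' \<notin> M" by blast
    have ab: "- (a' * b') \<in> M" using a'(1) b'(1) that(3) by (auto simp: cone_supp_def)
    obtain s t u where 1: "s \<in> S" "t \<in> M" "u \<in> M" "- s = t + - a' * u" using ext[OF Ed(5)[OF a'(2)] a'(3)] by blast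
    obtain s' t' u' where 2: "s' \<in> S" "t' \<in> M" "u' \<in> M" "- s' = t' + - b' * u'"
      using ext[OF Ed(5)[OF b'(2)] b'(3)] by blast
    have e: "a' * u = s + t" "b' * u' = s' + t'" using 1(4) 2(4) by (simp_all add: algebra_simps)
    have "- (s * s') = s * t' + t * s' + t * t' + - (a' * b') * (u * u')"
    proof -
      have "(a' * b') * (u * u') = (a' * u) * (b' * u')" by (simp add: algebra_simps)
      also have "\<dots> = (s + t) * (s' + t')" unfolding e by simp
      finally show ?thesis by (simp add: algebra_simps)
    qed
    also have "\<dots> \<in> M" using 1 2 SM ab by (intro Ma Mm) auto
    finally show False using M(3) S(3) 1(1) 2(1) by blast
  qed
  have "prime_cone M"
    unfolding prime_cone_def ring using E Ma Mm M(3) S(1) prime by blast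
  with ring M show ?thesis by blast
qed

lemma prime_cone_add: "prime_cone P \<Longrightarrow> a \<in> P \<Longrightarrow> b \<in> P \<Longrightarrow> a + b \<in> P"
  and prime_cone_mult: "prime_cone P \<Longrightarrow> a \<in> P \<Longrightarrow> b \<in> P \<Longrightarrow> a * b \<in> P"
  and prime_cone_minus_one: "prime_cone P \<Longrightarrow> - 1 \<notin> P"
  and prime_cone_subring: "prime_cone P \<Longrightarrow> is_subring (cone_ring P)"
  by (auto simp: prime_cone_def)

lemma prime_cone_one: "prime_cone P \<Longrightarrow> 1 \<in> P"
  using is_subringD(1)[OF prime_cone_subring] prime_cone_minus_one by (auto simp: cone_ring_def)

lemma prime_cone_zero: "prime_cone P \<Longrightarrow> 0 \<in> P"
  using is_subringD(2)[OF prime_cone_subring] by (auto simp: cone_ring_def)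

section \<open>The real closure of an ordered field\<close>

text \<open>An order on a domain extends to its fractions. By maximality this will turn the maximal
  ordered subring of the algebraic closure into a field.\<close>

lemma cone_fractions:
  fixes P :: "'c::field set"
  assumes P: "prime_cone P" and s: "cone_supp P = {0}"
  shows "prime_cone {a / b |a b. a \<in> P \<and> b \<in> P \<and> b \<noteq> 0}" (is "prime_cone ?Q")
    and "cone_supp {a / b |a b. a \<in> P \<and> b \<in> P \<and> b \<noteq> 0} = {0}"
    and "P \<subseteq> {a / b |a b. a \<in> P \<and> b \<in> P \<and> b \<noteq> 0}"
proof -
  note Pr = prime_cone_subring[OF P]
  have 1: "1 \<in> P" by (rule prime_cone_one[OF P])
  have Pa: "a + b \<in> P" and Pm: "a * b \<in> P" if "a \<in> P" "b \<in> P" for a b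
    using P that prime_cone_add prime_cone_mult by blast+
  have supp: "a = 0" if "a \<in> P" "- a \<in> P" for a
  proof -
    have "a \<in> cone_supp P" using that by (simp add: cone_supp_def)
    then show ?thesis using s by simp
  qed
  show PQ: "P \<subseteq> ?Q"
  proof
    fix a assume "a \<in> P"
    then show "a \<in> ?Q" using 1 by (intro CollectI exI[of _ a] exI[of _ 1]) simp
  qed
  have ringQ: "x \<in> cone_ring ?Q \<longleftrightarrow> (\<exists>a b. x = a / b \<and> a \<in> cone_ring P \<and> b \<in> P \<and> b \<noteq> 0)" for x
  proof
    assume "x \<in> cone_ring ?Q"
    then consider a b where "x = a / b" "a \<in> P" "b \<in> P" "b \<noteq> 0" | a b where "- x = a / b" "a \<in> P" "b \<in> P" "b \<noteq> 0"
      by (auto simp: cone_ring_def)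
    then show "\<exists>a b. x = a / b \<and> a \<in> cone_ring P \<and> b \<in> P \<and> b \<noteq> 0"
    proof cases
      case 1
      then show ?thesis by (auto simp: cone_ring_def)
    next
      case 2
      then have "x = (- a) / b" by (metis minus_divide_left minus_minus)
      then show ?thesis using 2 by (intro exI[of _ "- a"] exI[of _ b]) (auto simp: cone_ring_def)
    qed
  next
    assume "\<exists>a b. x = a / b \<and> a \<in> cone_ring P \<and> b \<in> P \<and> b \<noteq> 0"
    then obtain a b where *: "x = a / b" "a \<in> cone_ring P" "b \<in> P" "b \<noteq> 0" by blast
    show "x \<in> cone_ring ?Q"
    proof (cases "a \<in> P")
      case True
      then show ?thesis using * by (auto simp: cone_ring_def)
    next
      case False
      then have "- a \<in> P" using * by (auto simp: cone_ring_def)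
      then have "- x \<in> ?Q" using * by (intro CollectI exI[of _ "- a"] exI[of _ b]) simp
      then show ?thesis by (simp add: cone_ring_def)
    qed
  qed
  have PR: "a \<in> cone_ring P" if "a \<in> P" for a using that by (simp add: cone_ring_def)
  show supQ: "cone_supp ?Q = {0}"
  proof (intro equalityI subsetI)
    fix x assume "x \<in> cone_supp ?Q"
    then have "x \<in> ?Q" "- x \<in> ?Q" by (simp_all add: cone_supp_def)
    then obtain a b c d where *: "x = a / b" "a \<in> P" "b \<in> P" "b \<noteq> 0" "- x = c / d" "c \<in> P" "d \<in> P" "d \<noteq> 0"
      by blast
    then have "c = - x * d" "x * b = a" by (simp_all add: nonzero_eq_divide_eq)
    then have "- (a * d) = c * b" by (simp add: algebra_simps)
    then have "a * d = 0" using supp[of "a * d"] Pm * by simp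
    then show "x \<in> {0}" using * by simp
  next
    fix x :: 'c assume "x \<in> {0}"
    then show "x \<in> cone_supp ?Q" using subsetD[OF PQ prime_cone_zero[OF P]] by (simp add: cone_supp_def)
  qed
  show "prime_cone ?Q"
    unfolding prime_cone_def
  proof (intro conjI ballI impI)
    show "is_subring (cone_ring ?Q)"
      unfolding is_subring_def
    proof (intro conjI ballI)
      show "1 \<in> cone_ring ?Q" using subsetD[OF PQ 1] unfolding cone_ring_def by blast
      fix x y assume "x \<in> cone_ring ?Q" "y \<in> cone_ring ?Q"
      then obtain a b c d where *: "x = a / b" "a \<in> cone_ring P" "b \<in> P" "b \<noteq> 0"
        "y = c / d" "c \<in> cone_ring P" "d \<in> P" "d \<noteq> 0" unfolding ringQ by blast
      have "x - y = (a * d - c * b) / (b * d)" using * by (simp add: field_simps)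
      moreover have "a * d - c * b \<in> cone_ring P" using * PR by (intro is_subringD(3,4)[OF Pr]) auto
      moreover have "b * d \<in> P" "b * d \<noteq> 0" using Pm * by auto
      ultimately show "x - y \<in> cone_ring ?Q" unfolding ringQ by blast
      have "x * y = (a * c) / (b * d)" using * by (simp add: field_simps)
      moreover have "a * c \<in> cone_ring P" using * PR by (intro is_subringD(3,4)[OF Pr]) auto
      ultimately show "x * y \<in> cone_ring ?Q" unfolding ringQ using \<open>b * d \<in> P\<close> \<open>b * d \<noteq> 0\<close> by blast
    qed
    fix x y assume "x \<in> ?Q" "y \<in> ?Q"
    then obtain a b c d where *: "x = a / b" "a \<in> P" "b \<in> P" "b \<noteq> 0" "y = c / d" "c \<in> P" "d \<in> P" "d \<noteq> 0" by blast
    have "x + y = (a * d + c * b) / (b * d)" using * by (simp add: field_simps)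
    moreover have "a * d + c * b \<in> P" using * Pa Pm by blast
    moreover have "b * d \<in> P" "b * d \<noteq> 0" using Pm * by auto
    ultimately show "x + y \<in> ?Q" by blast
    have "x * y = (a * c) / (b * d)" using * by (simp add: field_simps)
    moreover have "a * c \<in> P" using * Pm by blast
    ultimately show "x * y \<in> ?Q" using \<open>b * d \<in> P\<close> \<open>b * d \<noteq> 0\<close> by blast
  next
    show "- 1 \<notin> ?Q"
    proof
      assume "- 1 \<in> ?Q"
      then have "(1::'c) \<in> cone_supp ?Q" using subsetD[OF PQ 1] unfolding cone_supp_def by blast
      then show False using supQ by simp
    qed
  next
    fix x y assume "x * y \<in> cone_supp ?Q"
    then show "x \<in> cone_supp ?Q \<or> y \<in> cone_supp ?Q" unfolding supQ by simp
  qed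
qed

lemma prime_coneI_trivial_supp:
  fixes P :: "'c::idom set"
  assumes "is_subring (cone_ring P)" "\<And>a b. a \<in> P \<Longrightarrow> b \<in> P \<Longrightarrow> a + b \<in> P" "\<And>a b. a \<in> P \<Longrightarrow> b \<in> P \<Longrightarrow> a * b \<in> P"
    and s: "cone_supp P = {0}"
  shows "prime_cone P"
  unfolding prime_cone_def
proof (intro conjI ballI impI)
  have "1 \<in> P \<or> - 1 \<in> P" using is_subringD(1)[OF assms(1)] by (simp add: cone_ring_def)
  moreover have "- 1 \<in> P \<Longrightarrow> 1 \<in> P" using assms(3)[of "- 1" "- 1"] by simp
  ultimately have 1: "1 \<in> P" by blast
  show "- 1 \<notin> P"
  proof
    assume "- 1 \<in> P"
    then have "(1::'c) \<in> cone_supp P" using 1 by (simp add: cone_supp_def)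
    then show False using s by simp
  qed
  fix a b assume "a * b \<in> cone_supp P"
  then show "a \<in> cone_supp P \<or> b \<in> cone_supp P" unfolding s by simp
qed (use assms in auto)

text \<open>Trivial support means that the cone is a linear order on a subring of the algebraic
  closure; containing the image of the nonnegative elements makes it extend the order of the base
  field.\<close>

definition extending_cones :: "'k::linordered_field alg_closure set set" where
  "extending_cones = {P. prime_cone P \<and> cone_supp P = {0} \<and> to_ac ` {0..} \<subseteq> P}"

lemma base_cone: "to_ac ` {0..} \<in> (extending_cones :: 'k::linordered_field alg_closure set set)"
proof -
  let ?P = "to_ac ` {0::'k..}"
  have r: "cone_ring ?P = range to_ac"
  proof (intro equalityI subsetI)
    fix x assume "x \<in> cone_ring ?P"
    then show "x \<in> range to_ac" by (auto simp: cone_ring_def) (metis minus_minus range_eqI to_ac_minus)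
  next
    fix x :: "'k alg_closure" assume "x \<in> range to_ac"
    then obtain k where k: "x = to_ac k" by blast
    show "x \<in> cone_ring ?P"
      by (cases "k \<ge> 0") (auto simp: cone_ring_def k simp flip: to_ac_minus)
  qed
  have supp: "cone_supp ?P = {0}"
  proof (intro equalityI subsetI)
    fix x assume "x \<in> cone_supp ?P"
    then obtain k l where "x = to_ac k" "k \<ge> 0" "- x = to_ac l" "l \<ge> 0" by (auto simp: cone_supp_def)
    then have "to_ac (- k) = to_ac l" by simp
    then have "- k = l" by (simp del: to_ac_minus)
    with \<open>k \<ge> 0\<close> \<open>l \<ge> 0\<close> have "k = 0" by simp
    then show "x \<in> {0}" using \<open>x = to_ac k\<close> by simp
  next
    fix x :: "'k alg_closure" assume "x \<in> {0}"
    then show "x \<in> cone_supp ?P" by (auto simp: cone_supp_def intro!: rev_image_eqI[of 0])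
  qed
  have "prime_cone ?P"
  proof (rule prime_coneI_trivial_supp[OF _ _ _ supp])
    show "is_subring (cone_ring ?P)"
      unfolding r is_subring_def
      by (auto simp flip: to_ac_diff to_ac_mult to_ac_1)
    show "a + b \<in> ?P" if "a \<in> ?P" "b \<in> ?P" for a b
      using that by (auto simp flip: to_ac_add)
    show "a * b \<in> ?P" if "a \<in> ?P" "b \<in> ?P" for a b
      using that by (auto simp flip: to_ac_mult)
  qed
  then show ?thesis using supp by (simp add: extending_cones_def)
qed

lemma maximal_cone_exists:
  "\<exists>M\<in>extending_cones. \<forall>P\<in>extending_cones. M \<subseteq> P \<longrightarrow> P = (M :: 'k::linordered_field alg_closure set)"
proof (rule subset_Zorn_nonempty)
  show "extending_cones \<noteq> ({} :: 'k alg_closure set set)" using base_cone by blast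
  fix C :: "'k alg_closure set set" assume C: "C \<noteq> {}" "subset.chain extending_cones C"
  then have CA: "C \<subseteq> extending_cones" and ch: "\<And>T U. T \<in> C \<Longrightarrow> U \<in> C \<Longrightarrow> T \<subseteq> U \<or> U \<subseteq> T"
    by (auto simp: subset.chain_def)
  have pc: "prime_cone T" "cone_supp T = {0}" "to_ac ` {0..} \<subseteq> T" if "T \<in> C" for T
    using that CA by (auto simp: extending_cones_def)
  obtain T0 where T0: "T0 \<in> C" using C by blast
  have two: "\<exists>T\<in>C. a \<in> T \<and> b \<in> T" if "a \<in> \<Union>C" "b \<in> \<Union>C" for a b
    using that ch by blast
  have supp: "cone_supp (\<Union>C) = {0}"
  proof (intro equalityI subsetI)
    fix x assume "x \<in> cone_supp (\<Union>C)"
    then have "x \<in> \<Union>C" "- x \<in> \<Union>C" by (simp_all add: cone_supp_def)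
    from two[OF this] obtain T where "T \<in> C" "x \<in> cone_supp T" by (auto simp: cone_supp_def)
    then show "x \<in> {0}" using pc by blast
  next
    fix x :: "'k alg_closure" assume "x \<in> {0}"
    then show "x \<in> cone_supp (\<Union>C)" using T0 prime_cone_zero[OF pc(1)[OF T0]] by (auto simp: cone_supp_def)
  qed
  have ring: "is_subring (cone_ring (\<Union>C))"
    unfolding is_subring_def
  proof (intro conjI ballI)
    show "1 \<in> cone_ring (\<Union>C)" using T0 prime_cone_one[OF pc(1)[OF T0]] by (auto simp: cone_ring_def)
    fix a b assume "a \<in> cone_ring (\<Union>C)" "b \<in> cone_ring (\<Union>C)"
    then obtain a' b' where *: "a' \<in> \<Union>C" "b' \<in> \<Union>C" "a' = a \<or> a' = - a" "b' = b \<or> b' = - b"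
      unfolding cone_ring_def by blast
    from two[OF *(1,2)] obtain T where T: "T \<in> C" "a' \<in> T" "b' \<in> T" by blast
    then have "a \<in> cone_ring T" "b \<in> cone_ring T" using *(3,4) by (auto simp: cone_ring_def)
    then have "a - b \<in> cone_ring T" "a * b \<in> cone_ring T"
      using is_subringD(3,4)[OF prime_cone_subring[OF pc(1)[OF T(1)]]] by blast+
    then show "a - b \<in> cone_ring (\<Union>C)" "a * b \<in> cone_ring (\<Union>C)"
      using T(1) unfolding cone_ring_def by blast+
  qed
  have "prime_cone (\<Union>C)"
  proof (rule prime_coneI_trivial_supp[OF ring _ _ supp])
    fix a b assume "a \<in> \<Union>C" "b \<in> \<Union>C"
    from two[OF this] obtain T where T: "T \<in> C" "a \<in> T" "b \<in> T" by blast
    then have "a + b \<in> T" "a * b \<in> T" using prime_cone_add prime_cone_mult pc(1) by blast+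
    then show "a + b \<in> \<Union>C" "a * b \<in> \<Union>C" using T(1) by blast+
  qed
  then show "\<Union>C \<in> extending_cones" using supp pc(3)[OF T0] T0 by (auto simp: extending_cones_def)
qed

definition max_cone :: "'k::linordered_field alg_closure set" where
  "max_cone = (SOME M. M \<in> extending_cones \<and> (\<forall>P\<in>extending_cones. M \<subseteq> P \<longrightarrow> P = M))"

lemma max_cone: "max_cone \<in> extending_cones" "P \<in> extending_cones \<Longrightarrow> max_cone \<subseteq> P \<Longrightarrow> P = max_cone"
  using someI_ex[of "\<lambda>M. M \<in> extending_cones \<and> (\<forall>P\<in>extending_cones. M \<subseteq> P \<longrightarrow> P = M)"] maximal_cone_exists
  unfolding max_cone_def by blast+

lemma max_cone_prime: "prime_cone max_cone" "cone_supp max_cone = {0}" "k \<ge> 0 \<Longrightarrow> to_ac k \<in> max_cone"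
  using max_cone(1) by (auto simp: extending_cones_def)

lemma max_cone_add: "a \<in> max_cone \<Longrightarrow> b \<in> max_cone \<Longrightarrow> a + b \<in> max_cone"
  and max_cone_mult: "a \<in> max_cone \<Longrightarrow> b \<in> max_cone \<Longrightarrow> a * b \<in> max_cone"
  and max_cone_0: "0 \<in> max_cone"
  using prime_cone_add prime_cone_mult prime_cone_zero max_cone_prime(1) by blast+

lemma max_cone_antisym: "a \<in> max_cone \<Longrightarrow> - a \<in> max_cone \<Longrightarrow> a = 0"
  using max_cone_prime(2) by (auto simp: cone_supp_def)

text \<open>The cone of fractions is again in \<open>extending_cones\<close> and contains
  \<open>max_cone\<close>, so by maximality the two coincide.\<close>

lemma max_cone_divide: "a \<in> max_cone \<Longrightarrow> b \<in> max_cone \<Longrightarrow> a / b \<in> max_cone"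
proof (cases "b = 0")
  case False
  let ?Q = "{a / b |a b. a \<in> max_cone \<and> b \<in> max_cone \<and> b \<noteq> (0 :: 'a alg_closure)}"
  note Q = cone_fractions[OF max_cone_prime(1,2)]
  have "to_ac ` {0..} \<subseteq> ?Q" using Q(3) max_cone_prime(3) by (intro order_trans[OF _ Q(3)]) auto
  with Q have "?Q \<in> extending_cones" by (simp add: extending_cones_def)
  from max_cone(2)[OF this Q(3)] have "?Q = max_cone" .
  moreover assume "a \<in> max_cone" "b \<in> max_cone"
  then have "a / b \<in> ?Q" using False by blast
  ultimately show ?thesis by simp
qed (simp add: max_cone_0)

typedef (overloaded) 'k real_closure = "cone_ring (max_cone :: 'k::linordered_field alg_closure set)"
  using is_subringD(1)[OF prime_cone_subring[OF max_cone_prime(1)]] by blast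

setup_lifting type_definition_real_closure

instantiation real_closure :: (linordered_field) linordered_field
begin

lift_definition zero_real_closure :: "'a real_closure" is 0
  by (rule is_subringD(2)[OF prime_cone_subring[OF max_cone_prime(1)]])
lift_definition one_real_closure :: "'a real_closure" is 1
  by (rule is_subringD(1)[OF prime_cone_subring[OF max_cone_prime(1)]])
lift_definition plus_real_closure :: "'a real_closure \<Rightarrow> 'a real_closure \<Rightarrow> 'a real_closure" is "(+)"
  by (rule is_subringD(6)[OF prime_cone_subring[OF max_cone_prime(1)]])
lift_definition minus_real_closure :: "'a real_closure \<Rightarrow> 'a real_closure \<Rightarrow> 'a real_closure" is "(-)"
  by (rule is_subringD(3)[OF prime_cone_subring[OF max_cone_prime(1)]])
lift_definition uminus_real_closure :: "'a real_closure \<Rightarrow> 'a real_closure" is uminus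
  by (rule is_subringD(5)[OF prime_cone_subring[OF max_cone_prime(1)]])
lift_definition times_real_closure :: "'a real_closure \<Rightarrow> 'a real_closure \<Rightarrow> 'a real_closure" is "(*)"
  by (rule is_subringD(4)[OF prime_cone_subring[OF max_cone_prime(1)]])
lift_definition divide_real_closure :: "'a real_closure \<Rightarrow> 'a real_closure \<Rightarrow> 'a real_closure" is "(/)"
proof -
  fix a b :: "'a alg_closure"
  assume "a \<in> cone_ring max_cone" "b \<in> cone_ring max_cone"
  then show "a / b \<in> cone_ring max_cone"
    using max_cone_divide[of a b] max_cone_divide[of "- a" b] max_cone_divide[of a "- b"] max_cone_divide[of "- a" "- b"]
    by (auto simp: cone_ring_def)
qed
lift_definition inverse_real_closure :: "'a real_closure \<Rightarrow> 'a real_closure" is inverse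
proof -
  fix a :: "'a alg_closure"
  assume "a \<in> cone_ring max_cone"
  then show "inverse a \<in> cone_ring max_cone"
    using max_cone_divide[OF prime_cone_one[OF max_cone_prime(1)], of a]
      max_cone_divide[OF prime_cone_one[OF max_cone_prime(1)], of "- a"]
    by (auto simp: cone_ring_def inverse_eq_divide)
qed
lift_definition less_eq_real_closure :: "'a real_closure \<Rightarrow> 'a real_closure \<Rightarrow> bool" is "\<lambda>a b. b - a \<in> max_cone" .
definition less_real_closure :: "'a real_closure \<Rightarrow> 'a real_closure \<Rightarrow> bool" where
  "less_real_closure a b \<longleftrightarrow> a \<le> b \<and> \<not> b \<le> a"
definition abs_real_closure :: "'a real_closure \<Rightarrow> 'a real_closure" where
  "abs_real_closure a = (if a < 0 then - a else a)"
definition sgn_real_closure :: "'a real_closure \<Rightarrow> 'a real_closure" where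
  "sgn_real_closure a = (if a = 0 then 0 else if 0 < a then 1 else - 1)"

instance
proof
  have antisym: "a \<le> b \<Longrightarrow> b \<le> a \<Longrightarrow> a = b" for a b :: "'a real_closure"
  proof transfer
    fix a b :: "'a alg_closure"
    assume "b - a \<in> max_cone" "a - b \<in> max_cone"
    then show "a = b" using max_cone_antisym[of "b - a"] by simp
  qed
  fix a b c :: "'a real_closure"
  show "a + b + c = a + (b + c)" "a + b = b + a" "0 + a = a" "- a + a = 0" "a - b = a + - b"
    "a * b * c = a * (b * c)" "a * b = b * a" "1 * a = a" "(a + b) * c = a * c + b * c" "(0::'a real_closure) \<noteq> 1"
    "a \<noteq> 0 \<Longrightarrow> inverse a * a = 1" "a div b = a * inverse b" "inverse 0 = (0::'a real_closure)"
    "a + b - a = b" "a - b - c = a - (b + c)" "0 * a = 0" "a * 0 = 0"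
    by (transfer; simp add: algebra_simps divide_inverse)+
  show "(a < b) = (a \<le> b \<and> \<not> b \<le> a)" by (simp add: less_real_closure_def)
  show "\<bar>a\<bar> = (if a < 0 then - a else a)" "sgn a = (if a = 0 then 0 else if 0 < a then 1 else - 1)"
    by (simp_all add: abs_real_closure_def sgn_real_closure_def)
  show "a \<le> a" by transfer (simp add: max_cone_0)
  show "a \<le> b \<Longrightarrow> b \<le> c \<Longrightarrow> a \<le> c"
  proof transfer
    fix a b c :: "'a alg_closure"
    assume "b - a \<in> max_cone" "c - b \<in> max_cone"
    from max_cone_add[OF this] show "c - a \<in> max_cone" by simp
  qed
  show "a \<le> b \<Longrightarrow> b \<le> a \<Longrightarrow> a = b" by (rule antisym)
  show "a \<le> b \<or> b \<le> a"
  proof transfer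
    fix a b :: "'a alg_closure"
    assume "a \<in> cone_ring max_cone" "b \<in> cone_ring max_cone"
    then have "b - a \<in> cone_ring max_cone" by (intro is_subringD(3)[OF prime_cone_subring[OF max_cone_prime(1)]])
    then show "b - a \<in> max_cone \<or> a - b \<in> max_cone" by (auto simp: cone_ring_def)
  qed
  show "a \<le> b \<Longrightarrow> c + a \<le> c + b" by transfer simp
  show "a < b \<Longrightarrow> 0 < c \<Longrightarrow> c * a < c * b"
  proof -
    assume ab: "a < b" and c: "0 < c"
    have "c * a \<le> c * b"
      using ab c unfolding less_real_closure_def
    proof (elim conjE, transfer)
      fix a b c :: "'a alg_closure"
      assume "b - a \<in> max_cone" "c - 0 \<in> max_cone"
      from max_cone_mult[OF this] show "c * b - c * a \<in> max_cone" by (simp add: algebra_simps)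
    qed
    moreover have "c * a \<noteq> c * b"
    proof -
      have "a \<noteq> b" "c \<noteq> 0" using ab c by (auto simp: less_real_closure_def)
      then show ?thesis by transfer simp
    qed
    ultimately show ?thesis unfolding less_real_closure_def using antisym by blast
  qed
qed

end

section \<open>Algebraic extensions of the maximal ordered subfield\<close>

lemma cone_supp_ideal:
  assumes P: "prime_cone P" and x: "x \<in> cone_supp P" and e: "e \<in> cone_ring P"
  shows "e * x \<in> cone_supp P"
  using e x prime_cone_mult[OF P, of e x] prime_cone_mult[OF P, of e "- x"]
    prime_cone_mult[OF P, of "- e" x] prime_cone_mult[OF P, of "- e" "- x"]
  by (auto simp: cone_ring_def cone_supp_def)

lemma cone_supp_diff:
  assumes P: "prime_cone P" and "x \<in> cone_supp P" "y \<in> cone_supp P"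
  shows "x - y \<in> cone_supp P"
  using assms(2,3) prime_cone_add[OF P, of x "- y"] prime_cone_add[OF P, of "- x" y]
  by (auto simp: cone_supp_def)

lemma cone_supp_zero: "prime_cone P \<Longrightarrow> 0 \<in> cone_supp P"
  by (simp add: cone_supp_def prime_cone_zero)

lift_definition of_base :: "'k::linordered_field \<Rightarrow> 'k real_closure" is to_ac
proof -
  fix k :: 'k
  show "to_ac k \<in> cone_ring max_cone"
    using max_cone_prime(3)[of k] max_cone_prime(3)[of "- k"] by (cases "k \<ge> 0") (auto simp: cone_ring_def)
qed

lemma of_base_simps: "of_base (a + b) = of_base a + of_base b" "of_base (a * b) = of_base a * of_base b"
  "of_base 1 = 1" "of_base 0 = 0"
  by (transfer; simp)+

lemma of_base_mono: "a \<le> b \<Longrightarrow> of_base a \<le> of_base b"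
  by transfer (metis diff_ge_0_iff_ge max_cone_prime(3) to_ac_diff)

lemma of_base_le_iff: "of_base a \<le> of_base b \<longleftrightarrow> a \<le> b"
proof
  assume *: "of_base a \<le> of_base b"
  show "a \<le> b"
  proof (rule ccontr)
    assume "\<not> a \<le> b"
    then have "of_base b \<le> of_base a" by (intro of_base_mono) simp
    with * have "of_base a = of_base b" by simp
    then have "a = b" by transfer simp
    with \<open>\<not> a \<le> b\<close> show False by simp
  qed
qed (rule of_base_mono)

definition aceval :: "'k::linordered_field alg_closure \<Rightarrow> 'k real_closure poly \<Rightarrow> 'k alg_closure" where
  "aceval \<alpha> p = poly (map_poly Rep_real_closure p) \<alpha>"

lemma aceval_pCons: "aceval \<alpha> (pCons c p) = Rep_real_closure c + \<alpha> * aceval \<alpha> p"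
  by (simp add: aceval_def map_poly_pCons zero_real_closure.rep_eq)

lemma aceval_0 [simp]: "aceval \<alpha> 0 = 0"
  by (simp add: aceval_def)

lemma aceval_1 [simp]: "aceval \<alpha> 1 = 1"
  by (simp add: aceval_pCons one_pCons one_real_closure.rep_eq)

lemma aceval_add: "aceval \<alpha> (p + q) = aceval \<alpha> p + aceval \<alpha> q"
  by (induction p q rule: poly_induct2) (simp_all add: aceval_pCons plus_real_closure.rep_eq algebra_simps)

lemma aceval_smult: "aceval \<alpha> (smult c p) = Rep_real_closure c * aceval \<alpha> p"
  by (induction p) (simp_all add: aceval_pCons times_real_closure.rep_eq algebra_simps)

lemma aceval_mult: "aceval \<alpha> (p * q) = aceval \<alpha> p * aceval \<alpha> q"
  by (induction p)
    (simp_all add: aceval_pCons aceval_add aceval_smult zero_real_closure.rep_eq algebra_simps)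

lemma aceval_in_ring: "aceval \<alpha> p \<in> adjoin (cone_ring max_cone) \<alpha>"
  unfolding aceval_def adjoin_def polys_over_def
  by (auto simp: coeff_map_poly zero_real_closure.rep_eq Rep_real_closure)

lemma adjoin_aceval:
  fixes \<alpha> :: "'k::linordered_field alg_closure"
  assumes "x \<in> adjoin (cone_ring max_cone) \<alpha>"
  obtains p where "x = aceval \<alpha> p"
proof -
  obtain q where q: "x = poly q \<alpha>" "\<And>i. coeff q i \<in> cone_ring max_cone"
    using assms by (auto simp: adjoin_def polys_over_def)
  have "Abs_real_closure (0 :: 'k alg_closure) = 0" by (simp add: zero_real_closure.abs_eq)
  then have "map_poly Rep_real_closure (map_poly Abs_real_closure q) = q"
    using q(2) by (intro poly_eqI) (simp add: coeff_map_poly zero_real_closure.rep_eq Abs_real_closure_inverse)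
  then show ?thesis using that[of "map_poly Abs_real_closure q"] q(1) by (simp add: aceval_def)
qed

lemma aceval_Rep: "aceval (Rep_real_closure r) p = Rep_real_closure (poly p r)"
  by (induction p) (simp_all add: aceval_pCons zero_real_closure.rep_eq plus_real_closure.rep_eq times_real_closure.rep_eq)

lemma aceval_mod: "aceval \<alpha> f = 0 \<Longrightarrow> aceval \<alpha> (p mod f) = aceval \<alpha> p"
proof -
  assume "aceval \<alpha> f = 0"
  then have "aceval \<alpha> (p div f * f + p mod f) = aceval \<alpha> (p mod f)" by (simp only: aceval_add aceval_mult) simp
  then show ?thesis by simp
qed

text \<open>When \<open>P\<close> is a prime cone inside the subring \<open>E\<close>, this is the
  least preordering of \<open>E\<close> containing \<open>P\<close>. If it avoids
  \<open>- 1\<close>, it can be enlarged to a prime cone of \<open>E\<close>.\<close>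

inductive_set weighted_squares :: "'a::comm_ring_1 set \<Rightarrow> 'a set \<Rightarrow> 'a set" for P E where
  base: "p \<in> P \<Longrightarrow> g \<in> E \<Longrightarrow> p * (g * g) \<in> weighted_squares P E"
| add: "s \<in> weighted_squares P E \<Longrightarrow> t \<in> weighted_squares P E \<Longrightarrow> s + t \<in> weighted_squares P E"

lemma preordering_weighted_squares:
  assumes P: "prime_cone P" and E: "is_subring E" "P \<subseteq> E"
  shows "preordering_in E (weighted_squares P E)" "P \<subseteq> weighted_squares P E"
proof -
  note Ed = is_subringD[OF E(1)]
  have mult: "s * t \<in> weighted_squares P E" if "s \<in> weighted_squares P E" "t \<in> weighted_squares P E" for s t
    using that
  proof (induction s arbitrary: t rule: weighted_squares.induct)
    case (base p g)
    from base(3) show ?case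
    proof (induction t rule: weighted_squares.induct)
      case (base p' g')
      have "(p * p') * ((g * g') * (g * g')) \<in> weighted_squares P E"
        using base \<open>p \<in> P\<close> \<open>g \<in> E\<close> prime_cone_mult[OF P] Ed(4) by (intro weighted_squares.base) auto
      then show ?case by (simp add: algebra_simps)
    next
      case (add s t)
      then show ?case by (auto simp: distrib_left intro: weighted_squares.add)
    qed
  next
    case (add s t')
    then show ?case by (auto simp: distrib_right intro: weighted_squares.add)
  qed
  have sub: "s \<in> E" if "s \<in> weighted_squares P E" for s
    using that E(2) by (induction s rule: weighted_squares.induct) (auto intro!: Ed)
  have sq: "a * a \<in> weighted_squares P E" if "a \<in> E" for a
    using weighted_squares.base[OF prime_cone_one[OF P] that] by simp
  show "preordering_in E (weighted_squares P E)"
    unfolding preordering_in_def using mult sub sq by (auto intro: weighted_squares.add)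
  show "P \<subseteq> weighted_squares P E"
  proof
    fix p assume "p \<in> P"
    from weighted_squares.base[OF this Ed(1)] show "p \<in> weighted_squares P E" by simp
  qed
qed

text \<open>Minimality of \<open>f\<close> makes the adjoined ring a field, so the proper ideal
  \<open>cone_supp P\<close> has to vanish. In terms of degrees: let \<open>u\<close> be nonzero of
  least degree with value in the support. If \<open>u\<close> were smaller than \<open>f\<close>, it
  would divide \<open>f\<close>, and the quotient would annihilate \<open>\<alpha>\<close> in too
  small a degree. But every value has a representative of degree below that of
  \<open>f\<close>.\<close>

lemma real_closure_extension_trivial_supp:
  fixes \<alpha> :: "'k::linordered_field alg_closure"
  assumes f: "aceval \<alpha> f = 0" "degree f > 0" and min: "\<And>p. p \<noteq> 0 \<Longrightarrow> aceval \<alpha> p = 0 \<Longrightarrow> degree f \<le> degree p"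
    and P: "prime_cone P" "cone_ring P = adjoin (cone_ring max_cone) \<alpha>"
  shows "cone_supp P = {0}"
proof (intro equalityI subsetI)
  fix x assume x: "x \<in> cone_supp P"
  have Ering: "aceval \<alpha> p \<in> cone_ring P" for p unfolding P(2) by (rule aceval_in_ring)
  have "x \<in> cone_ring P" using x by (simp add: cone_supp_def cone_ring_def)
  then obtain g where g: "x = aceval \<alpha> g" unfolding P(2) by (rule adjoin_aceval)
  have f0: "f \<noteq> 0" using f by auto
  have "\<exists>u. u \<noteq> 0 \<and> aceval \<alpha> u \<in> cone_supp P" using f f0 cone_supp_zero[OF P(1)] by metis
  from ex_has_least_nat[of "\<lambda>u. u \<noteq> 0 \<and> aceval \<alpha> u \<in> cone_supp P" _ degree]
  obtain u where u: "u \<noteq> 0" "aceval \<alpha> u \<in> cone_supp P"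
    "\<And>v. v \<noteq> 0 \<Longrightarrow> aceval \<alpha> v \<in> cone_supp P \<Longrightarrow> degree u \<le> degree v"
    using f f0 cone_supp_zero[OF P(1)] by metis
  have du: "degree u \<noteq> 0"
  proof
    assume "degree u = 0"
    then obtain c where c: "u = [:c:]" by (metis degree_eq_zeroE)
    then have "aceval \<alpha> [:inverse c:] * aceval \<alpha> u = 1"
      using u(1) by (simp flip: aceval_mult add: one_pCons[symmetric])
    with cone_supp_ideal[OF P(1) u(2) Ering[of "[:inverse c:]"]] have "1 \<in> cone_supp P" by simp
    then show False using prime_cone_minus_one[OF P(1)] by (simp add: cone_supp_def)
  qed
  have "degree f \<le> degree u"
  proof (rule ccontr)
    assume lt: "\<not> ?thesis"
    have "aceval \<alpha> (f div u * u + f mod u) = 0" using f(1) by simp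
    then have "aceval \<alpha> (f mod u) = 0 - aceval \<alpha> (f div u) * aceval \<alpha> u"
      by (simp only: aceval_add aceval_mult) (simp add: eq_neg_iff_add_eq_0 add.commute)
    then have "aceval \<alpha> (f mod u) \<in> cone_supp P"
      using cone_supp_diff[OF P(1) cone_supp_zero[OF P(1)] cone_supp_ideal[OF P(1) u(2) Ering]] by simp
    then have "f mod u = 0" using u(3)[of "f mod u"] degree_mod_less'[of u f] u(1) du
      by (metis degree_mod_less_degree not_le gr0I u(3))
    then have fu: "f = f div u * u" by (metis div_mult_mod_eq add.right_neutral)
    then have "aceval \<alpha> (f div u) * aceval \<alpha> u = 0" using f(1) by (metis aceval_mult)
    moreover have "aceval \<alpha> u \<noteq> 0" using min[OF u(1)] lt by blast
    ultimately have "aceval \<alpha> (f div u) = 0" by simp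
    moreover have "f div u \<noteq> 0" using fu f0 by auto
    ultimately have "degree f \<le> degree (f div u)" using min by blast
    moreover have "degree f = degree (f div u) + degree u"
      using fu \<open>f div u \<noteq> 0\<close> u(1) degree_mult_eq by metis
    ultimately show False using du by simp
  qed
  show "x \<in> {0}"
  proof (rule ccontr)
    assume "x \<notin> {0}"
    have e: "aceval \<alpha> (g mod f) = x" using aceval_mod[OF f(1)] g by simp
    with \<open>x \<notin> {0}\<close> have "g mod f \<noteq> 0" by auto
    then have "degree u \<le> degree (g mod f)" using u(3) e x by blast
    moreover have "degree (g mod f) < degree f" using degree_mod_less[OF f0, of g] f by auto
    ultimately show False using \<open>degree f \<le> degree u\<close> by simp
  qed
next
  fix x :: "'k alg_closure" assume "x \<in> {0}"
  then show "x \<in> cone_supp P" using cone_supp_zero[OF P(1)] by simp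
qed

text \<open>Each \<open>g\<close> is reduced modulo \<open>f\<close> before squaring, which keeps
  the representative nonnegative at all points of the field. The degree bound is what makes the
  cofactor \<open>h\<close> in \<open>1 + w = f * h\<close> smaller than \<open>f\<close>.\<close>

lemma weighted_squares_representation:
  fixes \<alpha> :: "'k::linordered_field alg_closure"
  assumes f: "aceval \<alpha> f = 0" "degree f > 0"
    and "t \<in> weighted_squares max_cone (adjoin (cone_ring max_cone) \<alpha>)"
  shows "\<exists>w. t = aceval \<alpha> w \<and> (\<forall>x. poly w x \<ge> 0) \<and> degree w \<le> 2 * (degree f - 1)"
  using assms(3)
proof (induction t rule: weighted_squares.induct)
  case (base p g)
  obtain c where c: "p = Rep_real_closure c" "c \<ge> 0"
  proof -
    have "p \<in> cone_ring max_cone" using base(1) by (simp add: cone_ring_def)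
    then have "p = Rep_real_closure (Abs_real_closure p)" by (simp add: Abs_real_closure_inverse)
    moreover have "Abs_real_closure p \<ge> 0"
      unfolding less_eq_real_closure.rep_eq using base(1) calculation by (simp add: zero_real_closure.rep_eq)
    ultimately show ?thesis using that by blast
  qed
  obtain G where G: "g = aceval \<alpha> G" using base(2) by (rule adjoin_aceval)
  let ?r = "G mod f"
  have "f \<noteq> 0" using f by auto
  then have "degree ?r < degree f" using degree_mod_less[of f G] f by auto
  moreover have "degree (smult c (?r * ?r)) \<le> degree ?r + degree ?r"
    by (rule order_trans[OF degree_smult_le degree_mult_le])
  ultimately have "degree (smult c (?r * ?r)) \<le> 2 * (degree f - 1)" by simp
  moreover have "p * (g * g) = aceval \<alpha> (smult c (?r * ?r))"
    by (simp add: aceval_smult aceval_mult aceval_mod[OF f(1)] c G)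
  moreover have "poly (smult c (?r * ?r)) x \<ge> 0" for x using c by simp
  ultimately show ?case by blast
next
  case (add s t)
  then obtain w v where "s = aceval \<alpha> w" "\<forall>x. poly w x \<ge> 0" "degree w \<le> 2 * (degree f - 1)"
    "t = aceval \<alpha> v" "\<forall>x. poly v x \<ge> 0" "degree v \<le> 2 * (degree f - 1)" by blast
  then show ?case by (intro exI[of _ "w + v"]) (auto simp: aceval_add degree_add_le)
qed

text \<open>
  Artin--Schreier argument with a sign change in place of an odd degree: for a counterexample \<open>f\<close> of
  minimal degree, adjoining a root of \<open>f\<close> must destroy the ordering (maximality), which yields
  \<open>1 + w = f h\<close> with \<open>w\<close> a positively weighted sum of squares, and \<open>h\<close> is a smaller counterexample.
\<close>
lemma real_closure_IVT:
  fixes f :: "'k::linordered_field real_closure poly"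
  assumes "a < b" "poly f a * poly f b < 0"
  shows "\<exists>c. a < c \<and> c < b \<and> poly f c = 0"
  using assms(2)
proof (induction "degree f" arbitrary: f rule: less_induct)
  case less
  have IH: "\<exists>c. a < c \<and> c < b \<and> poly g c = 0" if "degree g < degree f" "poly g a * poly g b < 0" for g
    using less.hyps[OF that] .
  have df: "degree f > 0"
  proof (rule ccontr)
    assume "\<not> ?thesis"
    then obtain c where "f = [:c:]" by (metis degree_eq_zeroE gr0I)
    then show False using less.prems by (simp add: not_square_less_zero)
  qed
  then have f0: "f \<noteq> 0" by auto
  have "degree (map_poly Rep_real_closure f) = degree f"
    by (intro degree_map_poly) (metis Rep_real_closure_inject df f0 leading_coeff_0_iff zero_real_closure.rep_eq)
  with df obtain \<alpha> where "poly (map_poly Rep_real_closure f) \<alpha> = 0"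
    by (metis alg_closed_imp_poly_has_root)
  then have fa: "aceval \<alpha> f = 0" by (simp add: aceval_def)
  have mod0: "m dvd u" if "aceval \<alpha> m = 0" "m \<noteq> 0" "degree m > 0" "\<And>p. p \<noteq> 0 \<Longrightarrow> aceval \<alpha> p = 0 \<Longrightarrow> degree m \<le> degree p"
    "aceval \<alpha> u = 0" for m u
  proof -
    have "aceval \<alpha> (u mod m) = 0" using aceval_mod that by metis
    moreover have "degree (u mod m) < degree m" using degree_mod_less[OF that(2), of u] that(3) by auto
    ultimately have "u mod m = 0" using that(4) by (meson not_le)
    then show ?thesis by (simp add: mod_eq_0_iff_dvd)
  qed
  obtain m where m: "m \<noteq> 0" "aceval \<alpha> m = 0" "\<And>p. p \<noteq> 0 \<Longrightarrow> aceval \<alpha> p = 0 \<Longrightarrow> degree m \<le> degree p"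
    using ex_has_least_nat[of "\<lambda>u. u \<noteq> 0 \<and> aceval \<alpha> u = 0" f degree] f0 fa by metis
  have dm: "degree m > 0"
  proof (rule ccontr)
    assume "\<not> ?thesis"
    then obtain c where "m = [:c:]" by (metis degree_eq_zeroE gr0I)
    then show False using m(1,2) by (simp add: aceval_pCons) (metis Rep_real_closure_inject zero_real_closure.rep_eq)
  qed
  show ?case
  proof (cases "degree m < degree f")
    case True
    \<comment> \<open>If \<open>f\<close> is not of least degree among the annihilators of
      \<open>\<alpha>\<close>, it factors properly, and a sign change of the product is a sign
      change of one factor.\<close>
    obtain k where k: "f = m * k" using mod0[OF m(2,1) dm m(3) fa] by (auto elim: dvdE)
    have "k \<noteq> 0" using k f0 by auto
    then have "degree f = degree m + degree k" using k m(1) by (simp add: degree_mult_eq)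
    then have "degree k < degree f" using dm by simp
    have "poly f a * poly f b = (poly m a * poly m b) * (poly k a * poly k b)" by (simp add: k)
    then have "poly m a * poly m b < 0 \<or> poly k a * poly k b < 0"
      using less.prems by (metis mult_nonneg_nonneg not_less)
    then show ?thesis using IH[OF True] IH[OF \<open>degree k < degree f\<close>] k by auto
  next
    case False
    then have min: "degree f \<le> degree p" if "p \<noteq> 0" "aceval \<alpha> p = 0" for p
      using m(3)[OF that] by simp
    let ?E = "adjoin (cone_ring max_cone) \<alpha>"
    let ?T = "weighted_squares max_cone ?E"
    have R: "is_subring (cone_ring (max_cone :: 'k alg_closure set))"
      by (rule prime_cone_subring[OF max_cone_prime(1)])
    have E: "is_subring ?E" "max_cone \<subseteq> ?E"
      using is_subring_adjoin[OF R] subset_adjoin[OF R, of \<alpha>] by (auto simp: cone_ring_def)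
    show ?thesis
    proof (cases "- 1 \<in> ?T")
      case True
      from weighted_squares_representation[OF fa df this]
      obtain w where w: "- 1 = aceval \<alpha> w" "\<And>x. poly w x \<ge> 0" "degree w \<le> 2 * (degree f - 1)" by blast
      have "aceval \<alpha> (1 + w) = 1 + (- 1)" unfolding w(1) by (simp add: aceval_add)
      then have "f dvd 1 + w" using mod0[OF fa f0 df min] by simp
      then obtain h where h: "1 + w = f * h" by (elim dvdE)
      have pos: "poly f x * poly h x > 0" for x
      proof -
        have "poly (1 + w) x > 0" using w(2)[of x] by (simp add: add_pos_nonneg)
        then show ?thesis unfolding h by simp
      qed
      have "h \<noteq> 0" using pos[of 0] by auto
      have "degree (1 + w) \<le> 2 * (degree f - 1)" using w(3) by (intro degree_add_le) auto
      then have "degree f + degree h \<le> 2 * (degree f - 1)" using h f0 \<open>h \<noteq> 0\<close> by (simp add: degree_mult_eq)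
      then have dh: "degree h < degree f" using df by simp
      have "(poly f a * poly f b) * (poly h a * poly h b) > 0"
        using mult_pos_pos[OF pos[of a] pos[of b]] by (simp add: algebra_simps)
      then have "poly h a * poly h b < 0" using less.prems zero_less_mult_iff[of "poly f a * poly f b" "poly h a * poly h b"] by (metis less_asym)
      from IH[OF dh this] obtain c where "poly h c = 0" by blast
      then show ?thesis using pos[of c] by simp
    next
      case False
      obtain P where P: "?T \<subseteq> P" "prime_cone P" "cone_ring P = ?E"
        using prime_cone_exists[OF E(1) preordering_weighted_squares(1)[OF max_cone_prime(1) E], of "{1}"] False is_subringD(1)[OF E(1)]
        by force
      have "max_cone \<subseteq> P" using preordering_weighted_squares(2)[OF max_cone_prime(1) E] P(1) by blast
      moreover have "cone_supp P = {0}"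
        by (rule real_closure_extension_trivial_supp[OF fa df min P(2,3)])
      ultimately have "P \<in> extending_cones"
        using P(2) max_cone_prime(3) by (auto simp: extending_cones_def)
      then have "P = max_cone" using max_cone(2) \<open>max_cone \<subseteq> P\<close> by blast
      \<comment> \<open>Maximality puts \<open>\<alpha>\<close> into the real closure itself, so
        \<open>f\<close>, having least degree, is linear; its sign change then places the root
        between \<open>a\<close> and \<open>b\<close>.\<close>
      then have "\<alpha> \<in> cone_ring max_cone" using P(3) adjoin_self[OF R, of \<alpha>] by simp
      then obtain r where r: "\<alpha> = Rep_real_closure r" by (metis Abs_real_closure_inverse)
      have "poly f r = 0"
        using fa unfolding r aceval_Rep by (metis Rep_real_closure_inject zero_real_closure.rep_eq)
      then obtain k where k: "f = [:- r, 1:] * k" by (auto simp: poly_eq_0_iff_dvd elim: dvdE)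
      have "degree f \<le> degree [:- r, 1:]"
        by (rule min) (simp_all add: r aceval_Rep zero_real_closure.rep_eq)
      moreover have "k \<noteq> 0" using k f0 by auto
      moreover have "degree f = degree [:- r, 1:] + degree k"
        unfolding k using \<open>k \<noteq> 0\<close> by (intro degree_mult_eq) auto
      ultimately have "degree k = 0" by simp
      then obtain c where "k = [:c:]" by (metis degree_eq_zeroE)
      then have "(a - r) * (b - r) * (c * c) < 0" using less.prems k by (simp add: algebra_simps)
      then have "(a - r) * (b - r) < 0" by (metis mult_nonneg_nonneg not_less zero_le_square)
      then have "a < r" "r < b" using assms(1) by (auto simp: mult_less_0_iff)
      then show ?thesis using \<open>poly f r = 0\<close> by blast
    qed
  qed
qed

instance real_closure :: (linordered_field) real_closed_field
proof
  fix a b :: "'a real_closure" and f n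
  assume *: "a < b" "(\<Sum>i\<le>n. f i * a ^ i) < 0" "(\<Sum>i\<le>n. f i * b ^ i) > 0"
  define p where "p = (\<Sum>i\<le>n. monom (f i) i)"
  have p: "poly p x = (\<Sum>i\<le>n. f i * x ^ i)" for x by (simp add: p_def poly_sum poly_monom)
  have "poly p a * poly p b < 0" using *(2,3) by (simp add: p mult_neg_pos)
  from real_closure_IVT[OF *(1) this] show "\<exists>c. a < c \<and> c < b \<and> (\<Sum>i\<le>n. f i * c ^ i) = 0" by (simp add: p)
qed

section \<open>The ordered domain of a prime cone\<close>

text \<open>Only finitely many signs are prescribed at a time, which is as much as the transfer to
  the reals delivers. Listing both \<open>g\<close> and \<open>- g\<close> in \<open>G\<close> fixes
  a strict sign or a zero.\<close>

definition realizable :: "'a::{comm_ring_1,real_algebra_1} set \<Rightarrow> bool" where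
  "realizable P \<longleftrightarrow> (\<forall>G. finite G \<longrightarrow> (\<exists>y. real_alg_hom y \<and> (\<forall>g\<in>G. g \<in> P \<longleftrightarrow> 0 \<le> y g)))"

text \<open>
  Type definitions cannot depend on a cone as a parameter. A fixed cone that refutes the Artin--Lang
  theorem whenever some cone does is enough: the theorem only has to be proved for this one. The
  scalar cone is a dummy value.
\<close>
definition chosen_cone :: "'a::{comm_ring_1,real_algebra_1} set" where
  "chosen_cone = (if \<exists>P::'a set. prime_cone P \<and> cone_ring P = UNIV \<and> \<not> realizable P
    then SOME P. prime_cone P \<and> cone_ring P = UNIV \<and> \<not> realizable P
    else range (\<lambda>r. (r * r) *\<^sub>R 1))"

text \<open>Ensures that \<open>chosen_cone\<close> is a prime cone in either case, so that the type
  built from it is an ordered domain unconditionally.\<close>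

lemma prime_cone_scalars: "prime_cone (range (\<lambda>r. (r * r) *\<^sub>R (1::'a::{comm_ring_1,real_algebra_1})))"
proof -
  let ?P = "range (\<lambda>r. (r * r) *\<^sub>R (1::'a))"
  have P: "x \<in> ?P \<longleftrightarrow> (\<exists>r\<ge>0. x = r *\<^sub>R 1)" for x
  proof
    assume "\<exists>r\<ge>0. x = r *\<^sub>R 1"
    then obtain r where "r \<ge> 0" "x = r *\<^sub>R 1" by blast
    then have "x = (sqrt r * sqrt r) *\<^sub>R 1" by simp
    then show "x \<in> ?P" by blast
  qed auto
  have ring: "cone_ring ?P = range (\<lambda>r. r *\<^sub>R 1)"
  proof (intro equalityI subsetI)
    fix x assume "x \<in> cone_ring ?P"
    then obtain r where "x = r *\<^sub>R 1 \<or> - x = r *\<^sub>R 1" by (auto simp: cone_ring_def)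
    then have "x = r *\<^sub>R 1 \<or> x = (- r) *\<^sub>R 1" by (metis add.inverse_inverse scaleR_minus_left)
    then show "x \<in> range (\<lambda>r. r *\<^sub>R 1)" by blast
  next
    fix x :: 'a assume "x \<in> range (\<lambda>r. r *\<^sub>R 1)"
    then obtain r where "x = r *\<^sub>R 1" by blast
    then have "x = r *\<^sub>R 1 \<and> r \<ge> 0 \<or> - x = (- r) *\<^sub>R 1 \<and> - r \<ge> 0" by auto
    then show "x \<in> cone_ring ?P" unfolding cone_ring_def mem_Collect_eq P by blast
  qed
  have inj: "r *\<^sub>R (1::'a) = s *\<^sub>R 1 \<longleftrightarrow> r = s" for r s by simp
  show ?thesis
    unfolding prime_cone_def
  proof (intro conjI ballI impI)
    show "is_subring (cone_ring ?P)"
      unfolding ring is_subring_def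
    proof (intro conjI ballI)
      show "1 \<in> range (\<lambda>r. r *\<^sub>R (1::'a))" by (rule range_eqI[of _ _ 1]) simp
      fix x y assume "x \<in> range (\<lambda>r. r *\<^sub>R (1::'a))" "y \<in> range (\<lambda>r. r *\<^sub>R (1::'a))"
      then obtain r s where "x = r *\<^sub>R 1" "y = s *\<^sub>R 1" by blast
      then have "x - y = (r - s) *\<^sub>R 1" "x * y = (r * s) *\<^sub>R 1" by (simp_all add: scaleR_diff_left)
      then show "x - y \<in> range (\<lambda>r. r *\<^sub>R 1)" "x * y \<in> range (\<lambda>r. r *\<^sub>R 1)" by blast+
    qed
  next
    fix x y assume "x \<in> ?P" "y \<in> ?P"
    then obtain r s where "r \<ge> 0" "s \<ge> 0" "x = r *\<^sub>R 1" "y = s *\<^sub>R 1" unfolding P by blast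
    then have "x + y = (r + s) *\<^sub>R 1" "x * y = (r * s) *\<^sub>R 1" "r + s \<ge> 0" "r * s \<ge> 0" by (simp_all add: scaleR_add_left)
    then show "x + y \<in> ?P" "x * y \<in> ?P" unfolding P by blast+
  next
    show "- 1 \<notin> ?P"
    proof
      assume "- 1 \<in> ?P"
      then obtain r where "r \<ge> 0" "(- 1 :: 'a) = r *\<^sub>R 1" unfolding P by blast
      then have "(- 1) *\<^sub>R (1::'a) = r *\<^sub>R 1" by simp
      then show False using \<open>r \<ge> 0\<close> unfolding inj by simp
    qed
  next
    fix x y assume "x \<in> cone_ring ?P" "y \<in> cone_ring ?P" "x * y \<in> cone_supp ?P"
    then obtain r s where rs: "x = r *\<^sub>R 1" "y = s *\<^sub>R 1" unfolding ring by blast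
    have "r * s \<ge> 0" "r * s \<le> 0"
    proof -
      have "x * y \<in> ?P" "- (x * y) \<in> ?P" using \<open>x * y \<in> cone_supp ?P\<close> by (auto simp: cone_supp_def)
      then obtain t u where "t \<ge> 0" "x * y = t *\<^sub>R 1" "u \<ge> 0" "- (x * y) = u *\<^sub>R 1" unfolding P by blast
      moreover have "x * y = (r * s) *\<^sub>R 1" "- (x * y) = (- (r * s)) *\<^sub>R 1" using rs by simp_all
      ultimately have "r * s = t" "- (r * s) = u" unfolding inj by (metis inj)+
      with \<open>t \<ge> 0\<close> \<open>u \<ge> 0\<close> show "r * s \<ge> 0" "r * s \<le> 0" by auto
    qed
    then have "r * s = 0" by simp
    then have "r = 0 \<or> s = 0" by simp
    moreover have "(0::'a) \<in> cone_supp ?P" unfolding cone_supp_def mem_Collect_eq P by (intro conjI exI[of _ 0]) auto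
    ultimately show "x \<in> cone_supp ?P \<or> y \<in> cone_supp ?P" using rs by auto
  qed
qed

lemma chosen_cone_counterexample:
  assumes "prime_cone P" "cone_ring P = UNIV" "\<not> realizable (P :: 'a::{comm_ring_1,real_algebra_1} set)"
  shows "cone_ring (chosen_cone :: 'a set) = UNIV" "\<not> realizable (chosen_cone :: 'a set)"
proof -
  have ex: "\<exists>P::'a set. prime_cone P \<and> cone_ring P = UNIV \<and> \<not> realizable P" using assms by blast
  from someI_ex[OF ex] ex
  show "cone_ring (chosen_cone :: 'a set) = UNIV" "\<not> realizable (chosen_cone :: 'a set)"
    by (simp_all add: chosen_cone_def)
qed

lemma prime_cone_chosen: "prime_cone (chosen_cone :: 'a::{comm_ring_1,real_algebra_1} set)"
proof (cases "\<exists>P::'a set. prime_cone P \<and> cone_ring P = UNIV \<and> \<not> realizable P")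
  case True
  from someI_ex[OF this] True show ?thesis by (simp add: chosen_cone_def)
next
  case False
  then have "(chosen_cone :: 'a set) = range (\<lambda>r. (r * r) *\<^sub>R 1)" unfolding chosen_cone_def by (rule if_not_P)
  then show ?thesis by (rule ssubst[where P = prime_cone]) (rule prime_cone_scalars)
qed

lemmas chosen_ring = is_subringD[OF prime_cone_subring[OF prime_cone_chosen]]

text \<open>The relation is reflexive only on the ring of the cone, because the fallback value of
  \<open>chosen_cone\<close> orders nothing beyond the scalar multiples of 1. Hence the quotient is
  a partial one.\<close>

definition cone_rel :: "'a::{comm_ring_1,real_algebra_1} \<Rightarrow> 'a \<Rightarrow> bool" where
  "cone_rel a b \<longleftrightarrow> a \<in> cone_ring chosen_cone \<and> b \<in> cone_ring chosen_cone \<and> a - b \<in> cone_supp chosen_cone"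

lemma cone_supp_add: "prime_cone P \<Longrightarrow> x \<in> cone_supp P \<Longrightarrow> y \<in> cone_supp P \<Longrightarrow> x + y \<in> cone_supp P"
  using cone_supp_diff[of P x "0 - y"] cone_supp_diff[of P 0 y] cone_supp_zero[of P] by simp

lemma cone_supp_uminus: "x \<in> cone_supp P \<Longrightarrow> - x \<in> cone_supp P"
  by (auto simp: cone_supp_def)

quotient_type (overloaded) 'a cone_domain = "'a::{comm_ring_1,real_algebra_1}" / partial: cone_rel
  morphisms cone_class_rep cone_class
proof (rule part_equivpI)
  show "\<exists>x::'a. cone_rel x x"
    using chosen_ring(1) cone_supp_zero[OF prime_cone_chosen] by (intro exI[of _ 1]) (simp add: cone_rel_def)
  show "symp (cone_rel :: 'a \<Rightarrow> _)"
    by (rule sympI) (auto simp: cone_rel_def dest: cone_supp_uminus)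
  show "transp (cone_rel :: 'a \<Rightarrow> _)"
  proof (rule transpI)
    fix x y z :: 'a assume "cone_rel x y" "cone_rel y z"
    then show "cone_rel x z" using cone_supp_add[OF prime_cone_chosen, of "x - y" "y - z"] by (auto simp: cone_rel_def)
  qed
qed

lemma cone_rel_le:
  assumes "cone_rel a a'" "cone_rel b b'" "b - a \<in> chosen_cone"
  shows "b' - a' \<in> chosen_cone"
proof -
  have "(b' - b) + (a - a') \<in> chosen_cone"
    using assms cone_supp_add[OF prime_cone_chosen cone_supp_uminus[of "b - b'"], of "a - a'"]
    by (auto simp: cone_rel_def cone_supp_def)
  from prime_cone_add[OF prime_cone_chosen this assms(3)] show ?thesis by simp
qed

lemma cone_rel_sym: "cone_rel a b \<Longrightarrow> cone_rel b a"
  by (auto simp: cone_rel_def dest: cone_supp_uminus)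

instantiation cone_domain :: ("{comm_ring_1,real_algebra_1}") linordered_idom
begin

lift_definition zero_cone_domain :: "'a cone_domain" is 0
  using chosen_ring(2) cone_supp_zero[OF prime_cone_chosen] by (simp add: cone_rel_def)
lift_definition one_cone_domain :: "'a cone_domain" is 1
  using chosen_ring(1) cone_supp_zero[OF prime_cone_chosen] by (simp add: cone_rel_def)
lift_definition plus_cone_domain :: "'a cone_domain \<Rightarrow> 'a cone_domain \<Rightarrow> 'a cone_domain" is "(+)"
proof -
  fix a b c d :: 'a assume "cone_rel a b" "cone_rel c d"
  then show "cone_rel (a + c) (b + d)"
    using cone_supp_add[OF prime_cone_chosen, of "a - b" "c - d"] chosen_ring(6)
    by (auto simp: cone_rel_def algebra_simps)
qed
lift_definition minus_cone_domain :: "'a cone_domain \<Rightarrow> 'a cone_domain \<Rightarrow> 'a cone_domain" is "(-)"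
proof -
  fix a b c d :: 'a assume "cone_rel a b" "cone_rel c d"
  then show "cone_rel (a - c) (b - d)"
    using cone_supp_diff[OF prime_cone_chosen, of "a - b" "c - d"] chosen_ring(3)
    by (auto simp: cone_rel_def algebra_simps)
qed
lift_definition uminus_cone_domain :: "'a cone_domain \<Rightarrow> 'a cone_domain" is uminus
proof -
  fix a b :: 'a assume "cone_rel a b"
  then show "cone_rel (- a) (- b)"
    using cone_supp_uminus[of "a - b"] chosen_ring(5)
    by (auto simp: cone_rel_def)
qed
lift_definition times_cone_domain :: "'a cone_domain \<Rightarrow> 'a cone_domain \<Rightarrow> 'a cone_domain" is "(*)"
proof -
  fix a b c d :: 'a assume *: "cone_rel a b" "cone_rel c d"
  have "a * c - b * d = c * (a - b) + b * (c - d)" by (simp add: algebra_simps)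
  moreover have "c * (a - b) + b * (c - d) \<in> cone_supp chosen_cone"
    using * by (intro cone_supp_add cone_supp_ideal prime_cone_chosen) (auto simp: cone_rel_def)
  ultimately show "cone_rel (a * c) (b * d)"
    using * chosen_ring(4) by (auto simp: cone_rel_def)
qed
lift_definition less_eq_cone_domain :: "'a cone_domain \<Rightarrow> 'a cone_domain \<Rightarrow> bool" is
  "\<lambda>a b. b - a \<in> chosen_cone"
  using cone_rel_le cone_rel_sym by blast
definition less_cone_domain :: "'a cone_domain \<Rightarrow> 'a cone_domain \<Rightarrow> bool" where
  "less_cone_domain a b \<longleftrightarrow> a \<le> b \<and> \<not> b \<le> a"
definition abs_cone_domain :: "'a cone_domain \<Rightarrow> 'a cone_domain" where
  "abs_cone_domain a = (if a < 0 then - a else a)"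
definition sgn_cone_domain :: "'a cone_domain \<Rightarrow> 'a cone_domain" where
  "sgn_cone_domain a = (if a = 0 then 0 else if 0 < a then 1 else - 1)"

instance
proof
  have refl: "cone_rel x y" if "x = y" "x \<in> cone_ring chosen_cone" for x y :: 'a
    using that cone_supp_zero[OF prime_cone_chosen] by (simp add: cone_rel_def)
  have ring: "x \<in> cone_ring chosen_cone" if "cone_rel x x" for x :: 'a
    using that by (simp add: cone_rel_def)
  note closed = chosen_ring(1-6)
  have antisym: "a \<le> b \<Longrightarrow> b \<le> a \<Longrightarrow> a = b" for a b :: "'a cone_domain"
  proof transfer
    fix a b :: 'a
    assume "cone_rel a a" "cone_rel b b" "b - a \<in> chosen_cone" "a - b \<in> chosen_cone"
    then show "cone_rel a b" by (simp add: cone_rel_def cone_supp_def)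
  qed
  fix a b c :: "'a cone_domain"
  show "a + b + c = a + (b + c)" "a + b = b + a" "0 + a = a" "- a + a = 0" "a - b = a + - b"
    "a * b * c = a * (b * c)" "a * b = b * a" "1 * a = a" "(a + b) * c = a * c + b * c"
    "a + b - a = b" "a - b - c = a - (b + c)" "0 * a = 0" "a * 0 = 0"
    by (transfer, rule refl, simp add: algebra_simps, simp add: ring closed)+
  show "(0::'a cone_domain) \<noteq> 1"
    by transfer (auto simp: cone_rel_def cone_supp_def prime_cone_minus_one[OF prime_cone_chosen])
  show "(a < b) = (a \<le> b \<and> \<not> b \<le> a)" by (simp add: less_cone_domain_def)
  show "\<bar>a\<bar> = (if a < 0 then - a else a)" "sgn a = (if a = 0 then 0 else if 0 < a then 1 else - 1)"
    by (simp_all add: abs_cone_domain_def sgn_cone_domain_def)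
  show "a \<le> a" by transfer (simp add: prime_cone_zero prime_cone_chosen)
  show "a \<le> b \<Longrightarrow> b \<le> c \<Longrightarrow> a \<le> c"
  proof transfer
    fix a b c :: 'a
    assume "b - a \<in> chosen_cone" "c - b \<in> chosen_cone"
    from prime_cone_add[OF prime_cone_chosen this] show "c - a \<in> chosen_cone" by simp
  qed
  show "a \<le> b \<Longrightarrow> b \<le> a \<Longrightarrow> a = b" by (rule antisym)
  show "a \<le> b \<or> b \<le> a"
  proof transfer
    fix a b :: 'a
    assume "cone_rel a a" "cone_rel b b"
    then have "b - a \<in> cone_ring chosen_cone" by (intro closed ring)
    then show "b - a \<in> chosen_cone \<or> a - b \<in> chosen_cone" by (auto simp: cone_ring_def)
  qed
  show "a \<le> b \<Longrightarrow> c + a \<le> c + b" by transfer simp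
  show "a < b \<Longrightarrow> 0 < c \<Longrightarrow> c * a < c * b"
  proof -
    assume ab: "a < b" and c: "0 < c"
    have "c * a \<le> c * b"
      using ab c unfolding less_cone_domain_def
    proof (elim conjE, transfer)
      fix a b c :: 'a
      assume "b - a \<in> chosen_cone" "c - 0 \<in> chosen_cone"
      from prime_cone_mult[OF prime_cone_chosen this] show "c * b - c * a \<in> chosen_cone" by (simp add: algebra_simps)
    qed
    moreover have "c * a \<noteq> c * b"
    proof -
      have "a \<noteq> b" "c \<noteq> 0" using ab c by (auto simp: less_cone_domain_def)
      then show ?thesis
      proof transfer
        fix a b c :: 'a
        assume *: "cone_rel a a" "cone_rel b b" "cone_rel c c" "\<not> cone_rel a b" "\<not> cone_rel c 0"
        then have "a - b \<notin> cone_supp chosen_cone" "c \<notin> cone_supp chosen_cone"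
          using chosen_ring(2) by (auto simp: cone_rel_def)
        moreover have "a - b \<in> cone_ring chosen_cone" "c \<in> cone_ring chosen_cone"
          using * by (auto intro: closed ring)
        ultimately have "c * (a - b) \<notin> cone_supp chosen_cone"
          using prime_cone_chosen[where ?'a = 'a] unfolding prime_cone_def by blast
        then show "\<not> cone_rel (c * a) (c * b)" by (simp add: cone_rel_def algebra_simps)
      qed
    qed
    ultimately show ?thesis unfolding less_cone_domain_def using antisym by blast
  qed
qed

end

section \<open>The Artin--Lang theorem\<close>

text \<open>The value 0 outside the ring of the cone is a default that makes the map total; it never
  occurs under the assumption \<open>full\<close> of the context below.\<close>

lift_definition to_cone_domain :: "'a::{comm_ring_1,real_algebra_1} \<Rightarrow> 'a cone_domain" is
  "\<lambda>a. if a \<in> cone_ring chosen_cone then a else 0"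
  using chosen_ring(2) cone_supp_zero[OF prime_cone_chosen] by (auto simp: cone_rel_def)

definition to_rc :: "'a::{comm_ring_1,real_algebra_1} \<Rightarrow> 'a cone_domain fract real_closure" where
  "to_rc a = of_base (Fract (to_cone_domain a) 1)"

context
  assumes full: "cone_ring (chosen_cone :: 'a::{comm_ring_1,real_algebra_1} set) = UNIV"
begin

lemma to_cone_domain_hom:
  "to_cone_domain (a + b :: 'a) = to_cone_domain a + to_cone_domain b"
  "to_cone_domain (a - b :: 'a) = to_cone_domain a - to_cone_domain b"
  "to_cone_domain (a * b :: 'a) = to_cone_domain a * to_cone_domain b"
  "to_cone_domain (1 :: 'a) = 1" "to_cone_domain (0 :: 'a) = 0"
  by (transfer; simp add: full cone_rel_def cone_supp_zero prime_cone_chosen)+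

lemma to_cone_domain_nonneg: "0 \<le> to_cone_domain (a :: 'a) \<longleftrightarrow> a \<in> chosen_cone"
  by transfer (simp add: full)

lemma to_rc_hom:
  "to_rc (a + b :: 'a) = to_rc a + to_rc b"
  "to_rc (a * b :: 'a) = to_rc a * to_rc b"
  "to_rc (1 :: 'a) = 1" "to_rc (0 :: 'a) = 0"
  by (simp_all add: to_rc_def to_cone_domain_hom flip: of_base_simps Zero_fract_def One_fract_def)

lemma to_rc_diff: "to_rc (a - b :: 'a) = to_rc a - to_rc b"
  using to_rc_hom(1)[of "a - b" b] by simp

lemma to_rc_nonneg: "0 \<le> to_rc (a :: 'a) \<longleftrightarrow> a \<in> chosen_cone"
  using of_base_le_iff[of 0 "Fract (to_cone_domain a) 1"]
  by (simp add: to_rc_def of_base_simps zero_le_Fract_iff to_cone_domain_nonneg)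

lemma polyfun_to_rc:
  "(c, w) \<in> polyfun e a n \<Longrightarrow> (to_rc (c :: 'a), w) \<in> polyfun (\<lambda>r. to_rc (e r)) (\<lambda>i. to_rc (a i)) n"
proof (induction c w rule: polyfun.induct)
  case (const r)
  then show ?case using polyfun.const[of "\<lambda>r. to_rc (e r)" r] by simp
next
  case (var i)
  then show ?case using polyfun.var[of i n "\<lambda>i. to_rc (a i)"] by simp
qed (auto simp: to_rc_hom to_rc_diff intro: polyfun.intros)

end

lemma polyfun_generates:
  fixes G :: "'a::{comm_ring_1,real_algebra_1} set"
  assumes G: "\<And>g. g \<in> G \<Longrightarrow> \<exists>i<n. a i = g" and "b \<in> subalg_gen G"
  shows "\<exists>w. (b, w) \<in> polyfun (\<lambda>r. r *\<^sub>R 1) a n"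
  using assms(2)
proof (induction b rule: subalg_gen.induct)
  case (gen b)
  then obtain i where "i < n" "a i = b" using G by blast
  then show ?case using polyfun.var[of i n a] by blast
next
  case one
  show ?case using polyfun.const[of "\<lambda>r. r *\<^sub>R (1::'a)" 1 a n] by auto
next
  case (add b c)
  then obtain u v where uv: "(b, u) \<in> polyfun (\<lambda>r. r *\<^sub>R 1) a n" "(c, v) \<in> polyfun (\<lambda>r. r *\<^sub>R 1) a n" by blast
  have "(0, \<lambda>_. 0) \<in> polyfun (\<lambda>r. r *\<^sub>R (1::'a)) a n" using polyfun.const[of "\<lambda>r. r *\<^sub>R (1::'a)" 0 a n] by simp
  from polyfun.diff[OF uv(1) polyfun.diff[OF this uv(2)]] show ?case by auto
next
  case (mult b c)
  then show ?case using polyfun.mult by blast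
next
  case (scale b r)
  then obtain u where "(b, u) \<in> polyfun (\<lambda>r. r *\<^sub>R 1) a n" by blast
  from polyfun.mult[OF polyfun.const[of "\<lambda>r. r *\<^sub>R (1::'a)" r] this] show ?case by auto
qed

text \<open>A homomorphism to the reals is a real point at which all relations of the algebra
  vanish. The relations form an ideal of polynomial functions with a finite basis \<open>S\<close>,
  so vanishing on \<open>S\<close> together with the signs on \<open>G\<close> is a finite system.
  The images of the generators solve it over the real closure of the fraction field, and the
  solution is transferred.\<close>

theorem Artin_Lang:
  fixes P :: "'a::{comm_ring_1,real_algebra_1} set"
  assumes fg: "fin_gen_algebra TYPE('a)" and P: "prime_cone P" "cone_ring P = UNIV"
  shows "realizable P"
proof (rule ccontr)
  assume "\<not> realizable P"
  note full = chosen_cone_counterexample(1)[OF P this]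
  have "realizable (chosen_cone :: 'a set)"
    unfolding realizable_def
  proof (intro allI impI)
    fix G :: "'a set" assume "finite G"
    obtain A :: "'a set" where A: "finite A" "subalg_gen A = UNIV" using fg unfolding fin_gen_algebra_def by blast
    obtain n :: nat and a :: "nat \<Rightarrow> 'a" where a: "A = a ` {i. i < n}" using finite_imp_nat_seg_image_inj_on[OF A(1)] by blast
    let ?e = "\<lambda>r. r *\<^sub>R (1::'a)"
    let ?R = "polyfun ?e a n"
    have ex: "\<exists>w. (b, w) \<in> ?R" for b
      by (rule polyfun_generates[of A]) (auto simp: a A(2)[unfolded a])
    define h where "h b = (SOME w. (b, w) \<in> ?R)" for b
    have h: "(b, h b) \<in> ?R" for b unfolding h_def by (rule someI_ex[OF ex])
    have e: "real_ring_hom ?e" by (auto simp: real_ring_hom_def scaleR_add_left)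
    have e': "real_ring_hom (\<lambda>r. to_rc (?e r))"
      using e unfolding real_ring_hom_def by (metis to_rc_hom[OF full])
    have zero: "(0, \<lambda>_. 0) \<in> ?R" using polyfun.const[of ?e 0 a n] by simp
    have add: "(b + c, \<lambda>z. u z + v z) \<in> ?R" if "(b, u) \<in> ?R" "(c, v) \<in> ?R" for b c u v
      using polyfun.diff[OF that(1) polyfun.diff[OF zero that(2)]] by simp
    have ideal: "ideal_in (snd ` ?R) {w. (0, w) \<in> ?R}"
      unfolding ideal_in_def
    proof (intro conjI ballI)
      show "{w. (0, w) \<in> ?R} \<subseteq> snd ` ?R" by (auto intro: rev_image_eqI)
      show "0 \<in> {w. (0, w) \<in> ?R}" using zero by (simp add: zero_fun_def)
      show "u + v \<in> {w. (0, w) \<in> ?R}" if "u \<in> {w. (0, w) \<in> ?R}" "v \<in> {w. (0, w) \<in> ?R}" for u v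
        using add[of 0 u 0 v] that by (simp add: plus_fun_def)
      show "r * u \<in> {w. (0, w) \<in> ?R}" if r: "r \<in> snd ` ?R" and u: "u \<in> {w. (0, w) \<in> ?R}" for r u
      proof -
        obtain c where "(c, r) \<in> ?R" using r by auto
        from polyfun.mult[OF this, of 0 u] u show ?thesis by (simp add: times_fun_def)
      qed
    qed
    then obtain S where S: "finite S" "S \<subseteq> {w. (0, w) \<in> ?R}"
      "\<And>J. ideal_in (snd ` ?R) J \<Longrightarrow> S \<subseteq> J \<Longrightarrow> {w. (0, w) \<in> ?R} \<subseteq> J"
      using noetherian_polyfun[OF e, of a n] unfolding noetherian_in_def by meson
    \<comment> \<open>A pair with first component \<open>to_rc 0\<close> forces its function to
      vanish at the real point, so relations are treated as sign conditions.\<close>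
    let ?F = "(\<lambda>w. (to_rc 0, w)) ` S \<union> (\<lambda>g. (to_rc g, h g)) ` G"
    have "finite ?F" using S(1) \<open>finite G\<close> by simp
    moreover have "?F \<subseteq> polyfun (\<lambda>r. to_rc (?e r)) (\<lambda>i. to_rc (a i)) n"
      using S(2) h polyfun_to_rc[OF full] by blast
    ultimately obtain z where z: "\<forall>(c, w)\<in>?F. same_sign c (w z)" using polyfun_realize[OF e'] by blast
    have Sz: "s z = 0" if "s \<in> S" for s
    proof -
      have "same_sign (to_rc (0::'a)) (s z)" using z that by auto
      then show ?thesis using same_sign_0_iff to_rc_hom(4)[OF full] by metis
    qed
    have kernel: "w z = 0" if "(0, w) \<in> ?R" for w
    proof -
      have "ideal_in (snd ` ?R) {w \<in> snd ` ?R. w z = 0}"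
        unfolding ideal_in_def
      proof (intro conjI ballI)
        show "0 \<in> {w \<in> snd ` ?R. w z = 0}" using is_subringD(2)[OF is_subring_polyfun[OF e]] by simp
        show "u + v \<in> {w \<in> snd ` ?R. w z = 0}"
          if "u \<in> {w \<in> snd ` ?R. w z = 0}" "v \<in> {w \<in> snd ` ?R. w z = 0}" for u v
          using that is_subringD(6)[OF is_subring_polyfun[OF e], of u a n v] by simp
        show "u * v \<in> {w \<in> snd ` ?R. w z = 0}"
          if "u \<in> snd ` ?R" "v \<in> {w \<in> snd ` ?R. w z = 0}" for u v
          using that is_subringD(4)[OF is_subring_polyfun[OF e], of u a n v] by simp
      qed auto
      moreover have "S \<subseteq> {w \<in> snd ` ?R. w z = 0}"
      proof
        fix s assume s: "s \<in> S"
        then have "(0, s) \<in> ?R" using S(2) by blast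
        then have "s \<in> snd ` ?R" by (rule rev_image_eqI) simp
        with Sz[OF s] show "s \<in> {w \<in> snd ` ?R. w z = 0}" by simp
      qed
      ultimately have "{w. (0, w) \<in> ?R} \<subseteq> {w \<in> snd ` ?R. w z = 0}" by (rule S(3))
      then show ?thesis using that by blast
    qed
    define y where "y b = h b z" for b
    \<comment> \<open>Two polynomials representing the same element differ by a relation, which
      vanishes at \<open>z\<close>. Hence \<open>y\<close> is independent of the choice made in
      \<open>h\<close>, and this is what makes it a homomorphism.\<close>
    have y: "y b = w z" if "(b, w) \<in> ?R" for b w
      using kernel[of "\<lambda>z. h b z - w z"] polyfun.diff[OF h[of b] that] by (simp add: y_def)
    have "real_alg_hom y"
      unfolding real_alg_hom_def
    proof (intro conjI allI)
      show "y 1 = 1" using y[OF polyfun.const[of ?e 1]] by simp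
      show "y (b + c) = y b + y c" for b c using y[OF add[OF h[of b] h[of c]]] by (simp add: y_def)
      show "y (b * c) = y b * y c" for b c using y[OF polyfun.mult[OF h[of b] h[of c]]] by (simp add: y_def)
      show "y (r *\<^sub>R b) = r * y b" for r b
        using y[OF polyfun.mult[OF polyfun.const[of ?e r] h[of b]]] by (simp add: y_def)
    qed
    moreover have "g \<in> chosen_cone \<longleftrightarrow> 0 \<le> y g" if "g \<in> G" for g
    proof -
      have "same_sign (to_rc g) (y g)" using z that by (auto simp: y_def)
      then have "0 \<le> to_rc g \<longleftrightarrow> 0 \<le> y g" by (auto simp: same_sign_def not_less[symmetric])
      then show ?thesis using to_rc_nonneg[OF full] by simp
    qed
    ultimately show "\<exists>y. real_alg_hom y \<and> (\<forall>g\<in>G. g \<in> chosen_cone \<longleftrightarrow> 0 \<le> y g)" by blast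
  qed
  with chosen_cone_counterexample(2)[OF P \<open>\<not> realizable P\<close>] show False by blast
qed

section \<open>The Positivstellensatz and moment conditions\<close>

lemma real_alg_hom_simps:
  assumes "real_alg_hom y"
  shows "y 0 = 0" "y 1 = 1" "y (a + b) = y a + y b" "y (a - b) = y a - y b" "y (a * b) = y a * y b"
    "y (r *\<^sub>R a) = r * y a" "y (- a) = - y a" "y (a ^ n) = y a ^ n" "y (sum f A) = (\<Sum>x\<in>A. y (f x))"
proof -
  show 0: "y 0 = 0" and 1: "y 1 = 1" and a: "\<And>a b. y (a + b) = y a + y b" and m: "\<And>a b. y (a * b) = y a * y b"
    and "y (r *\<^sub>R a) = r * y a"
    using assms unfolding real_alg_hom_def by (metis add_cancel_right_left, metis+)
  show u: "y (- a) = - y a" for a using a[of a "- a"] 0 by simp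
  show "y (a - b) = y a - y b" using a[of a "- b"] u by simp
  show "y (a ^ n) = y a ^ n" using 1 m by (induction n) auto
  show "y (sum f A) = (\<Sum>x\<in>A. y (f x))" using 0 a by (induction A rule: infinite_finite_induct) auto
qed

lemma real_alg_hom_sos: "real_alg_hom y \<Longrightarrow> s \<in> sos \<Longrightarrow> 0 \<le> y s"
proof -
  assume y: "real_alg_hom y" and "s \<in> sos"
  then obtain fs where "s = sum_list (map (\<lambda>a. a ^ 2) fs)" by (auto simp: sos_def)
  moreover have "0 \<le> y (sum_list (map (\<lambda>a. a ^ 2) fs))" for fs
    by (induction fs) (simp_all add: real_alg_hom_simps[OF y])
  ultimately show ?thesis by simp
qed

lemma square_in_sos: "a * a \<in> (sos :: 'a::comm_ring_1 set)"
  unfolding sos_def by (intro CollectI exI[of _ "[a]"]) (simp add: power2_eq_square)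

lemma zero_in_sos: "0 \<in> (sos :: 'a::comm_ring_1 set)"
  unfolding sos_def by (intro CollectI exI[of _ "[]"]) simp

lemma generator_combination:
  fixes g :: "'a::comm_ring_1"
  assumes "g \<in> set xs"
  shows "\<exists>ss. length ss = length xs \<and> set ss \<subseteq> sos \<and> sum_list (map2 (*) ss xs) = g"
  using assms
proof (induction xs)
  case (Cons x xs)
  show ?case
  proof (cases "g = x")
    case True
    have "sum_list (map2 (*) (replicate (length xs) 0) xs) = 0" by (induction xs) auto
    then show ?thesis using True square_in_sos[of 1] zero_in_sos
      by (intro exI[of _ "1 # replicate (length xs) 0"]) auto
  next
    case False
    with Cons obtain ss where "length ss = length xs" "set ss \<subseteq> sos" "sum_list (map2 (*) ss xs) = g" by auto
    then show ?thesis using zero_in_sos by (intro exI[of _ "0 # ss"]) auto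
  qed
qed simp

lemma real_alg_hom_combination:
  assumes y: "real_alg_hom y" and "set ss \<subseteq> sos" "\<forall>g\<in>set xs. 0 \<le> y g"
  shows "0 \<le> y (sum_list (map2 (*) ss xs))"
  using assms(2,3)
proof (induction ss xs rule: list_induct2')
  case (4 s ss x xs)
  then show ?case using real_alg_hom_sos[OF y, of s] by (simp add: real_alg_hom_simps[OF y])
qed (simp_all add: real_alg_hom_simps[OF y])

lemma fin_gen_qm_generators:
  fixes Q :: "'a::{comm_ring_1,real_algebra_1} set"
  assumes "fin_gen_qm Q"
  obtains gs where "set gs \<subseteq> Q" "\<And>y. real_alg_hom y \<Longrightarrow> \<forall>g\<in>set gs. 0 \<le> y g \<Longrightarrow> y \<in> K_Y Q"
proof -
  obtain gs where Q: "Q = {sum_list (map2 (*) ss (1 # gs)) | ss. length ss = Suc (length gs) \<and> set ss \<subseteq> sos}"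
    using assms unfolding fin_gen_qm_def by blast
  show ?thesis
  proof (rule that)
    show "set gs \<subseteq> Q"
    proof
      fix g assume "g \<in> set gs"
      then have "g \<in> set (1 # gs)" by simp
      from generator_combination[OF this] show "g \<in> Q" unfolding Q by force
    qed
    show "y \<in> K_Y Q" if y: "real_alg_hom y" "\<forall>g\<in>set gs. 0 \<le> y g" for y
    proof -
      have "\<forall>g\<in>set (1 # gs). 0 \<le> y g" using y by (simp add: real_alg_hom_simps(2)[OF y(1)])
      then have "\<forall>q\<in>Q. 0 \<le> y q" unfolding Q using real_alg_hom_combination[OF y(1)] by blast
      then show ?thesis using y(1) by (simp add: K_Y_def homs_Y_def)
    qed
  qed
qed

text \<open>The set \<open>S\<close> serves both conditions. If it contains \<open>f * f\<close>,
  the prime cone cannot contain \<open>f\<close>: the product of \<open>f\<close> and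
  \<open>- f\<close> would be a forbidden negative of a member of \<open>S\<close>. This turns the
  inequality at the real point into a strict one.\<close>

theorem Positivstellensatz:
  fixes Q :: "'a::{comm_ring_1,real_algebra_1} set"
  assumes fg: "fin_gen_algebra TYPE('a)" "fin_gen_qm Q" and Q: "preordering_in UNIV Q"
    and S: "1 \<in> S" "\<And>s. s \<in> S \<Longrightarrow> \<exists>r. s = r * r" "\<And>s t. s \<in> S \<Longrightarrow> t \<in> S \<Longrightarrow> s * t \<in> S"
    and n: "\<not> (\<exists>p\<in>Q. \<exists>q\<in>Q. \<exists>s\<in>S. p * f = s + q)"
  shows "\<exists>y\<in>K_Y Q. y f \<le> 0 \<and> (f * f \<in> S \<longrightarrow> y f < 0)"
proof -
  let ?T = "{t + - f * u |t u. t \<in> Q \<and> u \<in> Q}"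
  have U: "is_subring (UNIV :: 'a set)" by (simp add: is_subring_def)
  have "\<exists>P. ?T \<subseteq> P \<and> prime_cone P \<and> cone_ring P = UNIV \<and> (\<forall>s\<in>S. - s \<notin> P)"
  proof (rule prime_cone_exists[OF U preordering_adjoin(1)[OF U Q UNIV_I] S(1)])
    show "\<exists>r\<in>UNIV. s = r * r" if "s \<in> S" for s using S(2)[OF that] by simp
    show "s * t \<in> S" if "s \<in> S" "t \<in> S" for s t using S(3) that .
    show "- s \<notin> ?T" if "s \<in> S" for s
    proof
      assume "- s \<in> ?T"
      then obtain t u where "t \<in> Q" "u \<in> Q" "- s = t + - f * u" by blast
      then have "u * f = s + t" by (simp add: algebra_simps)
      with n \<open>t \<in> Q\<close> \<open>u \<in> Q\<close> that show False by blast
    qed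
  qed
  then obtain P where P: "?T \<subseteq> P" "prime_cone P" "cone_ring P = UNIV" "\<forall>s\<in>S. - s \<notin> P"
    by (elim exE conjE)
  have QP: "Q \<subseteq> P" "- f \<in> P" using preordering_adjoin(2,3)[OF U Q, of "- f"] P(1) by auto
  obtain gs where gs: "set gs \<subseteq> Q" "\<And>y. real_alg_hom y \<Longrightarrow> \<forall>g\<in>set gs. 0 \<le> y g \<Longrightarrow> y \<in> K_Y Q"
    using fin_gen_qm_generators[OF fg(2)] by blast
  \<comment> \<open>The generators will put \<open>y\<close> into \<open>K_Y Q\<close>,
    \<open>- f\<close> yields \<open>y f \<le> 0\<close>, and \<open>f\<close> decides
    strictness.\<close>
  have "finite (set gs \<union> {f, - f})" by simp
  then obtain y where y: "real_alg_hom y" "\<forall>g\<in>set gs \<union> {f, - f}. g \<in> P \<longleftrightarrow> 0 \<le> y g"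
    using Artin_Lang[OF fg(1) P(2,3)] unfolding realizable_def by blast
  have K: "y \<in> K_Y Q" using y gs(1) QP(1) by (intro gs(2)) auto
  have "0 \<le> y (- f)" using y(2) QP(2) by auto
  then have le: "y f \<le> 0" using real_alg_hom_simps(7)[OF y(1), of f] by simp
  have "y f < 0" if "f * f \<in> S"
  proof -
    have "f \<notin> P"
    proof
      assume "f \<in> P"
      from prime_cone_mult[OF P(2) this QP(2)] P(4) that show False by auto
    qed
    then show ?thesis using y(2) by auto
  qed
  with K le show ?thesis by blast
qed

text \<open>
  The multiplier \<open>p\<^sup>2 (1 + f)\<^sup>2\<close> is a square, and
  \<open>p\<^sup>2 (1 + f)\<^sup>2 f = 2 (p f)\<^sup>2 + p (p f) (1 + f\<^sup>2)\<close>.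
\<close>
lemma sos_multiplier:
  fixes Q :: "'a::comm_ring_1 set"
  assumes Q: "preordering_in UNIV Q" and pq: "p \<in> Q" "q \<in> Q" "p * f = s + q" and s: "s \<in> Q"
  shows "\<exists>p'\<in>sos. \<exists>q'\<in>Q. p' * f = s * s + q'"
proof -
  have a: "a + b \<in> Q" and m: "a * b \<in> Q" if "a \<in> Q" "b \<in> Q" for a b using Q that by (auto simp: preordering_in_def)
  have sq: "a * a \<in> Q" for a using Q by (auto simp: preordering_in_def)
  have one: "1 \<in> Q" using sq[of 1] by simp
  define q' where "q' = s * s + (s * q + s * q) + (s * q + s * q) + (q * q + q * q) + p * (s + q) * (1 + f * f)"
  have "(p * (1 + f)) * (p * (1 + f)) * f = (p * f) * (p * f) + (p * f) * (p * f) + p * (p * f) * (1 + f * f)"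
    by (simp add: algebra_simps)
  also have "\<dots> = s * s + q'" unfolding pq(3) q'_def by (simp add: algebra_simps)
  finally have "(p * (1 + f)) * (p * (1 + f)) * f = s * s + q'" .
  moreover have "q' \<in> Q" unfolding q'_def by (intro a m sq pq s one)
  ultimately show ?thesis using square_in_sos by blast
qed

section \<open>Convergence and closure in the space of homomorphisms\<close>

lemma homs_eqI:
  assumes "real_alg_hom y" "real_alg_hom z" "subalg_gen G = UNIV" "\<And>g. g \<in> G \<Longrightarrow> y g = z g"
  shows "y = z"
proof
  fix a
  have "a \<in> subalg_gen G" using assms(3) by simp
  then show "y a = z a"
    by (induction a rule: subalg_gen.induct)
      (simp_all add: real_alg_hom_simps[OF assms(1)] real_alg_hom_simps[OF assms(2)] assms(4))
qed

lemma homs_tendsto: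
  fixes y :: "'a::{comm_ring_1,real_algebra_1} \<Rightarrow> real"
  assumes y: "real_alg_hom y" and z: "\<And>n::nat. real_alg_hom (z n)" and G: "subalg_gen G = UNIV"
    and lim: "\<And>g. g \<in> G \<Longrightarrow> (\<lambda>n. z n g) \<longlonglongrightarrow> y g"
  shows "(\<lambda>n. z n a) \<longlonglongrightarrow> y a"
proof -
  have "a \<in> subalg_gen G" using G by simp
  then show ?thesis
    by (induction a rule: subalg_gen.induct)
      (auto simp: real_alg_hom_simps[OF y] real_alg_hom_simps[OF z] intro!: tendsto_intros lim)
qed

text \<open>The squared Euclidean distance from \<open>y\<close> in the coordinates given by
  \<open>G\<close>, formed inside the algebra so that Q1 and Q2 can be applied to it.\<close>

definition sq_dist :: "'a::{comm_ring_1,real_algebra_1} set \<Rightarrow> ('a \<Rightarrow> real) \<Rightarrow> 'a" where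
  "sq_dist G y = (\<Sum>g\<in>G. (g - y g *\<^sub>R 1) ^ 2)"

lemma real_alg_hom_sq_dist:
  assumes "real_alg_hom z"
  shows "z (sq_dist G y) = (\<Sum>g\<in>G. (z g - y g) ^ 2)"
  by (simp add: sq_dist_def real_alg_hom_simps[OF assms])

lemma openin_Y_eval:
  assumes "open U"
  shows "openin (Y_topology TYPE('a)) {y \<in> homs_Y TYPE('a::{comm_ring_1,real_algebra_1}). y a \<in> U}"
proof -
  have "openin (product_topology (\<lambda>_. euclideanreal) (UNIV :: 'a set)) {y \<in> topspace (product_topology (\<lambda>_. euclideanreal) UNIV). y a \<in> U}"
    using assms by (intro openin_continuous_map_preimage[OF continuous_map_product_projection]) auto
  then show ?thesis
    unfolding Y_topology_def openin_subtopology by (intro exI[of _ "{y. y a \<in> U}"]) auto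
qed

lemma closure_eval_nonneg:
  fixes y :: "'a::{comm_ring_1,real_algebra_1} \<Rightarrow> real"
  assumes y: "y \<in> Y_topology TYPE('a) closure_of M" and "\<And>z. z \<in> M \<Longrightarrow> 0 \<le> z f"
  shows "0 \<le> y f"
proof (rule ccontr)
  assume "\<not> ?thesis"
  moreover have "y \<in> homs_Y TYPE('a)" using y by (simp add: in_closure_of Y_topology_def)
  ultimately have "y \<in> {y \<in> homs_Y TYPE('a). y f \<in> {..<0}}" by simp
  then have "y \<in> {y \<in> homs_Y TYPE('a). y f \<in> {..<0}} \<and>
      openin (Y_topology TYPE('a)) {y \<in> homs_Y TYPE('a). y f \<in> {..<0}}"
    using openin_Y_eval[OF open_lessThan] by blast
  moreover have "\<forall>T. y \<in> T \<and> openin (Y_topology TYPE('a)) T \<longrightarrow> (\<exists>z. z \<in> M \<and> z \<in> T)"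
    using y by (simp add: in_closure_of)
  ultimately obtain z where "z \<in> M" "z \<in> {y \<in> homs_Y TYPE('a). y f \<in> {..<0}}"
    by (elim allE impE) (assumption, blast)
  with assms(2)[of z] show False by simp
qed

text \<open>A basic open set restricts only finitely many coordinates, so a pointwise convergent
  sequence eventually enters it.\<close>

lemma closure_limit:
  fixes y :: "'a::{comm_ring_1,real_algebra_1} \<Rightarrow> real"
  assumes y: "real_alg_hom y" and z: "\<And>n::nat. z n \<in> M" and lim: "\<And>a. (\<lambda>n. z n a) \<longlonglongrightarrow> y a"
    and M: "M \<subseteq> homs_Y TYPE('a)"
  shows "y \<in> Y_topology TYPE('a) closure_of M"
  unfolding in_closure_of
proof (intro conjI allI impI)
  show "y \<in> topspace (Y_topology TYPE('a))" using y by (simp add: Y_topology_def homs_Y_def)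
  fix T assume "y \<in> T \<and> openin (Y_topology TYPE('a)) T"
  then obtain S where S: "openin (product_topology (\<lambda>_. euclideanreal) UNIV) S" "T = S \<inter> homs_Y TYPE('a)" "y \<in> S"
    unfolding Y_topology_def openin_subtopology by blast
  from product_topology_open_contains_basis[OF S(1,3)] obtain V where
    V: "y \<in> (\<Pi>\<^sub>E i\<in>UNIV. V i)" "\<And>i. open (V i)" "finite {i. V i \<noteq> UNIV}" "(\<Pi>\<^sub>E i\<in>UNIV. V i) \<subseteq> S"
    by auto
  have "\<forall>\<^sub>F n in sequentially. z n i \<in> V i" for i
    using topological_tendstoD[OF lim V(2)[of i], of i] V(1) by auto
  then have "\<forall>\<^sub>F n in sequentially. \<forall>i\<in>{i. V i \<noteq> UNIV}. z n i \<in> V i"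
    using V(3) by (intro eventually_ball_finite) auto
  then obtain n where "\<forall>i\<in>{i. V i \<noteq> UNIV}. z n i \<in> V i"
    using eventually_happens'[OF sequentially_bot] by blast
  then have "z n \<in> (\<Pi>\<^sub>E i\<in>UNIV. V i)" by auto
  then show "\<exists>x. x \<in> M \<and> x \<in> T" using V(4) S(2) z[of n] M by blast
qed

theorem theorem1p4:
  fixes X :: "'x set"
    and bar :: "'a::{comm_ring_1,real_algebra_1} \<Rightarrow> 'x \<Rightarrow> real"
    and Q :: "'a set"
  assumes "fin_gen_algebra TYPE('a)"
    and "alg_hom_to_funs X bar"
    and "quadratic_module Q"
    and "fin_gen_qm Q"
    and "\<forall>a\<in>Q. \<forall>b\<in>Q. a * b \<in> Q"
  shows "((\<forall>f. (\<forall>x\<in>K_X X bar Q. bar f x > 0) \<longrightarrow>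
             (\<exists>p\<in>sos. \<exists>q\<in>Q. p * f = 1 + q))
          \<longleftrightarrow> m_map bar ` K_X X bar Q = K_Y Q)
       \<and> ((\<forall>f. (\<forall>x\<in>K_X X bar Q. bar f x \<ge> 0) \<longrightarrow>
             (\<exists>p\<in>sos. \<exists>q\<in>Q. \<exists>k::nat. p * f = f ^ (2 * k) + q))
          \<longleftrightarrow> Y_topology TYPE('a) closure_of (m_map bar ` K_X X bar Q) = K_Y Q)"
proof -
  let ?M = "m_map bar ` K_X X bar Q"
  have Q: "preordering_in UNIV Q"
  proof -
    have "a * a \<in> Q" for a
      using assms(3) unfolding quadratic_module_def by (metis mult.right_neutral power2_eq_square)
    then show ?thesis using assms(3,5) by (auto simp: preordering_in_def quadratic_module_def)
  qed
  have Qsq: "a * a \<in> Q" for a using Q by (simp add: preordering_in_def)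
  obtain G :: "'a set" where G: "finite G" "subalg_gen G = UNIV"
    using assms(1) unfolding fin_gen_algebra_def by blast
  have m: "real_alg_hom (m_map bar x)" "m_map bar x a = bar a x" if "x \<in> K_X X bar Q" for x a
    using assms(2) that by (auto simp: alg_hom_to_funs_def K_X_def m_map_def)
  have MK: "?M \<subseteq> K_Y Q"
  proof
    fix y assume "y \<in> ?M"
    then obtain x where "x \<in> K_X X bar Q" "y = m_map bar x" by blast
    then show "y \<in> K_Y Q" using m by (simp add: K_Y_def homs_Y_def) (simp add: K_X_def)
  qed
  have hom: "real_alg_hom y" if "y \<in> K_Y Q" for y using that by (simp add: K_Y_def homs_Y_def)
  have clK: "Y_topology TYPE('a) closure_of ?M \<subseteq> K_Y Q"
  proof
    fix y assume y: "y \<in> Y_topology TYPE('a) closure_of ?M"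
    then have "y \<in> homs_Y TYPE('a)" by (simp add: in_closure_of Y_topology_def)
    moreover have "0 \<le> y g" if "g \<in> Q" for g
      using y by (rule closure_eval_nonneg) (use MK that in \<open>auto simp: K_Y_def\<close>)
    ultimately show "y \<in> K_Y Q" by (simp add: K_Y_def)
  qed
  have "m_map bar ` K_X X bar Q = K_Y Q"
    if Q1: "\<forall>f. (\<forall>x\<in>K_X X bar Q. bar f x > 0) \<longrightarrow> (\<exists>p\<in>sos. \<exists>q\<in>Q. p * f = 1 + q)"
  proof (rule subset_antisym[OF MK], rule subsetI, rule ccontr)
    fix y assume y: "y \<in> K_Y Q" "y \<notin> ?M"
    \<comment> \<open>A homomorphism is determined on generators, so this element vanishes at
      \<open>y\<close> but is positive on the image of \<open>m_map bar\<close>. At \<open>y\<close>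
      the identity from Q1 then reads \<open>0 = 1 + y q\<close> with \<open>y q\<close>
      nonnegative.\<close>
    have "bar (sq_dist G y) x > 0" if x: "x \<in> K_X X bar Q" for x
    proof -
      have "m_map bar x \<noteq> y" using y x by blast
      then obtain g where "g \<in> G" "m_map bar x g \<noteq> y g"
        using homs_eqI[OF m(1)[OF x] hom[OF y(1)] G(2)] by blast
      then have "(\<Sum>g\<in>G. (m_map bar x g - y g) ^ 2) > 0"
        using G(1) by (intro sum_pos2) auto
      then show ?thesis using real_alg_hom_sq_dist[OF m(1)[OF x]] m(2)[OF x] by simp
    qed
    with Q1 obtain p q where "q \<in> Q" "p * sq_dist G y = 1 + q" by blast
    then have "y (p * sq_dist G y) = y (1 + q)" "0 \<le> y q" using y(1) by (simp_all add: K_Y_def)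
    then show False
      using real_alg_hom_sq_dist[OF hom[OF y(1)], of G y] by (simp add: real_alg_hom_simps[OF hom[OF y(1)]])
  qed
  moreover have "\<exists>p\<in>sos. \<exists>q\<in>Q. p * f = 1 + q"
    if eq: "?M = K_Y Q" and f: "\<forall>x\<in>K_X X bar Q. bar f x > 0" for f
  proof -
    have pos: "0 < y f" if "y \<in> K_Y Q" for y using that f m(2) unfolding eq[symmetric] by auto
    have "\<exists>p\<in>Q. \<exists>q\<in>Q. \<exists>s\<in>{1}. p * f = s + q"
    proof (rule ccontr)
      assume none: "\<not> ?thesis"
      have "\<exists>y\<in>K_Y Q. y f \<le> 0 \<and> (f * f \<in> {1} \<longrightarrow> y f < 0)"
        by (rule Positivstellensatz[OF assms(1,4) Q _ _ _ none]) (auto intro: exI[of _ 1])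
      with pos show False by (auto simp: not_le[symmetric])
    qed
    then obtain p q where "p \<in> Q" "q \<in> Q" "p * f = 1 + q" by blast
    from sos_multiplier[OF Q this] Qsq[of 1] show ?thesis by simp
  qed
  moreover have "Y_topology TYPE('a) closure_of ?M = K_Y Q"
    if Q2: "\<forall>f. (\<forall>x\<in>K_X X bar Q. bar f x \<ge> 0) \<longrightarrow>
      (\<exists>p\<in>sos. \<exists>q\<in>Q. \<exists>k::nat. p * f = f ^ (2 * k) + q)"
  proof (rule subset_antisym[OF clK], rule subsetI)
    fix y assume y: "y \<in> K_Y Q"
    note hy = hom[OF y]
    have "\<exists>x\<in>K_X X bar Q. (\<Sum>g\<in>G. (bar g x - y g) ^ 2) < e" if e: "e > 0" for e
    proof (rule ccontr)
      assume n: "\<not> ?thesis"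
      \<comment> \<open>If the image keeps squared distance at least \<open>e\<close> from
        \<open>y\<close>, this element is nonnegative on \<open>K_X X bar Q\<close> but equals
        \<open>- e\<close> at \<open>y\<close>. There the left side of the identity from Q2 is at
        most 0, while the right side is positive.\<close>
      let ?f = "sq_dist G y - e *\<^sub>R 1"
      have "bar ?f x \<ge> 0" if x: "x \<in> K_X X bar Q" for x
        using n x real_alg_hom_sq_dist[OF m(1)[OF x], of G y]
          real_alg_hom_simps(2,4,6)[OF m(1)[OF x]] m(2)[OF x] by (auto simp: not_less)
      with Q2 obtain p q and k :: nat where *: "p \<in> sos" "q \<in> Q" "p * ?f = ?f ^ (2 * k) + q" by blast
      have f: "y ?f = - e" using real_alg_hom_sq_dist[OF hy, of G y] by (simp add: real_alg_hom_simps[OF hy])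
      have "y p * - e = (- e) ^ (2 * k) + y q"
        using arg_cong[OF *(3), of y] f real_alg_hom_simps(3,5,8)[OF hy] by metis
      moreover have "(- e) ^ (2 * k) > 0" using e by (simp add: power_mult)
      moreover have "y q \<ge> 0" using y *(2) by (simp add: K_Y_def)
      moreover have "y p * - e \<le> 0" using real_alg_hom_sos[OF hy *(1)] e by simp
      ultimately show False by linarith
    qed
    then have "\<forall>n::nat. \<exists>x\<in>K_X X bar Q. (\<Sum>g\<in>G. (bar g x - y g) ^ 2) < inverse (real (Suc n))" by simp
    then obtain x where x: "\<And>n. x n \<in> K_X X bar Q"
      "\<And>n. (\<Sum>g\<in>G. (bar g (x n) - y g) ^ 2) < inverse (real (Suc n))" by metis
    have lim: "(\<lambda>n. m_map bar (x n) g) \<longlonglongrightarrow> y g" if g: "g \<in> G" for g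
    proof -
      have "(\<lambda>n. (bar g (x n) - y g) ^ 2) \<longlonglongrightarrow> 0"
      proof (rule tendsto_sandwich[OF _ _ tendsto_const LIMSEQ_inverse_real_of_nat])
        have "(bar g (x n) - y g) ^ 2 \<le> (\<Sum>g\<in>G. (bar g (x n) - y g) ^ 2)" for n
          using G(1) g by (intro member_le_sum) auto
        then show "\<forall>\<^sub>F n in sequentially. (bar g (x n) - y g) ^ 2 \<le> inverse (real (Suc n))"
          using x(2) by (intro always_eventually) (meson le_less_trans less_imp_le)
      qed auto
      then have "(\<lambda>n. bar g (x n) - y g) \<longlonglongrightarrow> 0" by (simp add: power_tendsto_0_iff)
      then show ?thesis by (simp add: LIM_zero_iff m(2)[OF x(1)])
    qed
    have "(\<lambda>n. m_map bar (x n) a) \<longlonglongrightarrow> y a" for a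
      by (rule homs_tendsto[OF hy _ G(2)]) (simp_all add: m(1)[OF x(1)] lim)
    then show "y \<in> Y_topology TYPE('a) closure_of ?M"
      using x(1) MK by (intro closure_limit[OF hy, of "\<lambda>n. m_map bar (x n)"]) (auto simp: K_Y_def)
  qed
  moreover have "\<exists>p\<in>sos. \<exists>q\<in>Q. \<exists>k::nat. p * f = f ^ (2 * k) + q"
    if eq: "Y_topology TYPE('a) closure_of ?M = K_Y Q" and f: "\<forall>x\<in>K_X X bar Q. bar f x \<ge> 0" for f
  proof -
    have nonneg: "0 \<le> y f" if "y \<in> K_Y Q" for y
    proof (rule closure_eval_nonneg[where M = ?M])
      show "y \<in> Y_topology TYPE('a) closure_of ?M" using that eq by simp
      show "0 \<le> z f" if "z \<in> ?M" for z using that f m(2) by auto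
    qed
    \<comment> \<open>Exponent 0 provides the unit, and exponent 2 puts \<open>f * f\<close> into
      the set, which makes the Positivstellensatz return a strictly negative value; nonnegativity on
      the closure excludes it.\<close>
    let ?S = "range (\<lambda>k::nat. f ^ (2 * k))"
    have "\<exists>p\<in>Q. \<exists>q\<in>Q. \<exists>s\<in>?S. p * f = s + q"
    proof (rule ccontr)
      have 1: "1 \<in> ?S" by (rule range_eqI[of _ _ 0]) simp
      have sq: "\<exists>r. s = r * r" if "s \<in> ?S" for s
        using that by (auto simp: mult_2 power_add)
      have mult: "s * t \<in> ?S" if "s \<in> ?S" "t \<in> ?S" for s t
      proof -
        obtain k l where "s = f ^ (2 * k)" "t = f ^ (2 * l)" using \<open>s \<in> ?S\<close> \<open>t \<in> ?S\<close> by blast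
        then have "s * t = f ^ (2 * (k + l))" by (simp add: power_add distrib_left)
        then show ?thesis by (rule range_eqI)
      qed
      have ff: "f * f \<in> ?S" by (rule range_eqI[of _ _ 1]) (simp add: power2_eq_square)
      assume none: "\<not> ?thesis"
      have "\<exists>y\<in>K_Y Q. y f \<le> 0 \<and> (f * f \<in> ?S \<longrightarrow> y f < 0)"
        by (rule Positivstellensatz[OF assms(1,4) Q 1 _ _ none]) (rule sq, assumption, rule mult)
      then obtain y where "y \<in> K_Y Q" "f * f \<in> ?S \<longrightarrow> y f < 0" by (elim bexE conjE)
      then show False using ff nonneg[of y] by linarith
    qed
    then obtain p q k where pq: "p \<in> Q" "q \<in> Q" "p * f = f ^ (2 * k) + q" by blast
    have "f ^ (2 * k) \<in> Q" using Qsq[of "f ^ k"] by (simp add: mult_2 power_add)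
    from sos_multiplier[OF Q pq this] obtain p' q' where
      "p' \<in> sos" "q' \<in> Q" "p' * f = f ^ (2 * k) * f ^ (2 * k) + q'" by blast
    \<comment> \<open>Replacing the multiplier from \<open>Q\<close> by one from \<open>sos\<close>
      squares the power of \<open>f\<close>, so the exponent delivered for Q2 is given by
      \<open>2 * k\<close> instead of \<open>k\<close>.\<close>
    moreover have "f ^ (2 * k) * f ^ (2 * k) = f ^ (2 * (2 * k))" by (simp add: mult_2 power_add)
    ultimately show ?thesis by metis
  qed
  ultimately show ?thesis by (intro conjI iffI allI impI)
qed

end
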